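(* (1) Let $\alpha=\frac43$ and let $Q$ be the unique positive radial solution to $-\Delta Q+Q-|Q|^{\frac43}Q=0$ on $\mathbb{R}^3$. If $c\ge M(Q)$, then there is no minimizer for $I(c)$. (2) Let $\frac43<\alpha<4$. Then for any $c>0$, there is no minimizer for $I(c)$.
   Context: Fix $b\in\mathbb{R}$, $b\neq0$, and let $A(x)=\frac b2(-x_2,x_1,0)$ for $x\in\mathbb{R}^3$. Define $H^1_A(\mathbb{R}^3)=\{f\in L^2(\mathbb{R}^3;\mathbb{C}): |(\nabla+iA)f|\in L^2(\mathbb{R}^3)\}$. Notation: $M(f)=\|f\|_{L^2}^2$, $E(f)=\frac12\|(\nabla+iA)f\|_{L^2}^2-\frac1{\alpha+2}\|f\|_{L^{\alpha+2}}^{\alpha+2}$, $S(c)=\{f\in H^1_A(\mathbb{R}^3):M(f)=c\}$, $I(c)=\inf\{E(f):f\in S(c)\}\in[-\infty,\infty)$; a minimizer for $I(c)$ is $f\in S(c)$ with $E(f)=I(c)$. *)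

theory Defs
  imports "HOL-Analysis.Analysis"
begin

section \<open>Calculus on three-dimensional space\<close>

definition partial :: "3 \<Rightarrow> (real^3 \<Rightarrow> 'b::real_normed_vector) \<Rightarrow> real^3 \<Rightarrow> 'b" where
  "partial j f x = vector_derivative (\<lambda>t. f (x + t *\<^sub>R axis j 1)) (at 0)"

primrec Ck :: "nat \<Rightarrow> (real^3 \<Rightarrow> 'b::real_normed_vector) \<Rightarrow> bool" where
  "Ck 0 f \<longleftrightarrow> continuous_on UNIV f"
| "Ck (Suc k) f \<longleftrightarrow> (\<forall>x. f differentiable at x) \<and> (\<forall>j. Ck k (partial j f))"

definition laplacian :: "(real^3 \<Rightarrow> real) \<Rightarrow> real^3 \<Rightarrow> real" where
  "laplacian f x = (\<Sum>j\<in>UNIV. partial j (partial j f) x)"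

definition test_function :: "(real^3 \<Rightarrow> complex) \<Rightarrow> bool" where
  "test_function \<phi> \<longleftrightarrow> (\<forall>k. Ck k \<phi>) \<and> (\<exists>K. compact K \<and> (\<forall>x. x \<notin> K \<longrightarrow> \<phi> x = 0))"


section \<open>Lebesgue spaces\<close>

text \<open>
  Elements of Lebesgue and Sobolev spaces are represented by Borel functions; every
  almost-everywhere class has such a representative, and mass, energy and membership
  depend only on the class.
\<close>

definition Lp :: "real \<Rightarrow> (real^3 \<Rightarrow> 'b::euclidean_space) set" where
  "Lp p = {f \<in> borel_measurable lborel. integrable lborel (\<lambda>x. norm (f x) powr p)}"

definition Lp_norm :: "real \<Rightarrow> (real^3 \<Rightarrow> 'b::euclidean_space) \<Rightarrow> real" where
  "Lp_norm p f = (\<integral>x. norm (f x) powr p \<partial>lborel) powr (1 / p)"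


section \<open>Magnetic Sobolev space\<close>

definition magnetic_potential :: "real \<Rightarrow> real^3 \<Rightarrow> real^3" where
  "magnetic_potential b x = (b / 2) *\<^sub>R vector [- (x $ 2), x $ 1, 0]"

text \<open>
  The identity \<open>g = (\<nabla> + \<i>A) f\<close> in the sense of distributions, componentwise and with the
  bilinear pairing of \<open>f\<close> and \<open>\<phi>\<close> (no conjugation).
\<close>

definition weak_cov_gradient ::
    "(real^3 \<Rightarrow> real^3) \<Rightarrow> (real^3 \<Rightarrow> complex) \<Rightarrow> (real^3 \<Rightarrow> complex^3) \<Rightarrow> bool" where
  "weak_cov_gradient A f g \<longleftrightarrow>
     (\<forall>\<phi> j. test_function \<phi> \<longrightarrow>
        (\<integral>x. g x $ j * \<phi> x \<partial>lborel)
        = (\<integral>x. f x * (- partial j \<phi> x + \<i> * of_real (A x $ j) * \<phi> x) \<partial>lborel))"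

definition H1 :: "(real^3 \<Rightarrow> real^3) \<Rightarrow> (real^3 \<Rightarrow> complex) set" where
  "H1 A = {f \<in> Lp 2. \<exists>g \<in> Lp 2. weak_cov_gradient A f g}"

text \<open>For \<open>f \<in> H1 A\<close> this is determined up to a null set.\<close>

definition cov_gradient ::
    "(real^3 \<Rightarrow> real^3) \<Rightarrow> (real^3 \<Rightarrow> complex) \<Rightarrow> real^3 \<Rightarrow> complex^3" where
  "cov_gradient A f = (SOME g. g \<in> Lp 2 \<and> weak_cov_gradient A f g)"


section \<open>The variational problem\<close>

definition mass :: "(real^3 \<Rightarrow> complex) \<Rightarrow> real" where
  "mass f = (Lp_norm 2 f)\<^sup>2"

text \<open>
  Only meaningful for \<open>f \<in> H1 (magnetic_potential b)\<close> and \<open>0 \<le> \<alpha> \<le> 4\<close>, where the Sobolev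
  embedding makes all the norms finite.
\<close>

definition energy :: "real \<Rightarrow> real \<Rightarrow> (real^3 \<Rightarrow> complex) \<Rightarrow> real" where
  "energy b \<alpha> f =
     1 / 2 * (Lp_norm 2 (cov_gradient (magnetic_potential b) f))\<^sup>2
     - 1 / (\<alpha> + 2) * Lp_norm (\<alpha> + 2) f powr (\<alpha> + 2)"

definition mass_sphere :: "real \<Rightarrow> real \<Rightarrow> (real^3 \<Rightarrow> complex) set" where
  "mass_sphere b c = {f \<in> H1 (magnetic_potential b). mass f = c}"

definition min_energy :: "real \<Rightarrow> real \<Rightarrow> real \<Rightarrow> ereal" where
  "min_energy b \<alpha> c = (INF f \<in> mass_sphere b c. ereal (energy b \<alpha> f))"

definition minimizer :: "real \<Rightarrow> real \<Rightarrow> real \<Rightarrow> (real^3 \<Rightarrow> complex) \<Rightarrow> bool" where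
  "minimizer b \<alpha> c f \<longleftrightarrow> f \<in> mass_sphere b c \<and> ereal (energy b \<alpha> f) = min_energy b \<alpha> c"


section \<open>The ground state\<close>

text \<open>
  Solutions are classical and lie in the usual (non-magnetic) Sobolev space. Some such
  condition at infinity is implicit in the notion of ``the'' positive radial solution: the
  constant function 1 also solves the equation.
\<close>

definition positive_radial_solution :: "(real^3 \<Rightarrow> real) \<Rightarrow> bool" where
  "positive_radial_solution Q \<longleftrightarrow>
     Ck 2 Q \<and> (\<lambda>x. complex_of_real (Q x)) \<in> H1 (\<lambda>x. 0) \<and>
     (\<forall>x. Q x > 0) \<and> (\<forall>x y. norm x = norm y \<longrightarrow> Q x = Q y) \<and>
     (\<forall>x. - laplacian Q x + Q x - \<bar>Q x\<bar> powr (4 / 3) * Q x = 0)"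

definition unique_positive_radial_solution :: "(real^3 \<Rightarrow> real) \<Rightarrow> bool" where
  "unique_positive_radial_solution Q \<longleftrightarrow>
     positive_radial_solution Q \<and> (\<forall>R. positive_radial_solution R \<longrightarrow> R = Q)"

end

theory Submission
  imports Defs
begin

text \<open>
  Dilations \<open>\<lambda>\<^bsup>3/2\<^esup> h(\<lambda>x)\<close> of a real function preserve the mass, multiply the kinetic energy by \<open>\<lambda>\<^sup>2\<close>,
  the contribution of the potential by \<open>\<lambda>\<^bsup>-2\<^esup>\<close> and the nonlinear term by \<open>\<lambda>\<^bsup>3\<alpha>/2\<^esup>\<close>. For \<open>\<alpha> > 4/3\<close>
  this gives \<open>I(c) = -\<infinity>\<close>. For \<open>\<alpha> = 4/3\<close> it gives \<open>I(c) = -\<infinity>\<close> as soon as some real \<open>h\<close> of mass at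
  most \<open>c\<close> has negative nonmagnetic energy; moreover \<open>Q\<close> has zero nonmagnetic energy by the Nehari and
  Pohozaev identities, and finite second moment, so concentrating it shows \<open>I(c) \<le> 0\<close> for \<open>c \<ge> M(Q)\<close>.

  No sharp Gagliardo--Nirenberg inequality is needed. If \<open>f\<close> were a minimizer for \<open>\<alpha> = 4/3\<close>, then
  \<open>E(f) \<le> 0\<close>, and the nonmagnetic energy of \<open>|f|\<close> is strictly smaller: the diamagnetic inequality
  \<open>\<parallel>\<nabla>|f|\<parallel> \<le> \<parallel>(\<nabla> + \<i>A)f\<parallel>\<close> is strict, quantitatively, because the commutator of two components of
  \<open>\<nabla> + \<i>A\<close> is \<open>\<i>b\<close>. Hence \<open>I(c) = -\<infinity>\<close>, a contradiction. Working with regularized moduli of mollified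
  cutoffs of \<open>f\<close>, only upper bounds on the kinetic energy and Fatou's lemma are needed.
\<close>

section \<open>Functions with continuous partial derivatives\<close>

text \<open>The diamagnetic gap must survive approximation, so it is sought as a quantity depending
  only on |b|, the mass and a kinetic bound. Relative to the phase of f, write the covariant
  derivatives D_j f as r_j + i m_j. The loss |Df|^2 - |grad |f||^2 is the sum of the m_j^2, whereas
  Im(D_1 f conj(D_2 f)) = m_1 r_2 - r_1 m_2 has integral b M/2 by the commutator. With the r_j
  bounded in L^2, a small loss would make this integral small. Semicontinuity then goes the useful
  way twice: the gap wants the mass of the approximants bounded below, and negativity of the energy
  wants their nonlinear term bounded below. For c above M(Q), amplification by S = c/M only helps:
  the quadratic terms gain S, the nonlinear one S^(5/3). The delicate point about Q is its second
  moment, without which the confinement term could be infinite. Only H^1 membership and the equation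
  are given, so decay is derived: the mechanical energy of the radial equation decreases, hence Q is
  Lipschitz, hence Q in L^2 tends to 0. For the same reason the identities for Q are first proved
  against compactly supported weights.\<close>

lemma lborel_integral_translation:
  fixes f :: "'a::euclidean_space \<Rightarrow> 'b::{banach, second_countable_topology}"
  assumes [measurable]: "f \<in> borel_measurable borel"
  shows "(LBINT x. f (x + a)) = (LBINT x. f x)"
proof -
  have "(LBINT x. f x) = (\<integral>x. f x \<partial>(distr lborel borel ((+) a)))"
    by (simp add: lborel_distr_plus)
  also have "\<dots> = (LBINT x. f (a + x))"
    by (rule integral_distr) auto
  finally show ?thesis by (simp add: add.commute)
qed

lemma lborel_integrable_translation:
  fixes f :: "'a::euclidean_space \<Rightarrow> 'b::{banach, second_countable_topology}"
  assumes "integrable lborel f"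
  shows "integrable lborel (\<lambda>x. f (x + a))"
proof -
  have [measurable]: "f \<in> borel_measurable borel" using assms by auto
  have "integrable (distr lborel borel ((+) a)) f"
    using assms by (simp add: lborel_distr_plus)
  then show ?thesis
    by (subst (asm) integrable_distr_eq) (auto simp: add.commute)
qed

lemma lborel_integral_scaleR:
  fixes f :: "'a::euclidean_space \<Rightarrow> 'b::{banach, second_countable_topology}"
  assumes [measurable]: "f \<in> borel_measurable borel" and "c \<noteq> 0"
  shows "(LBINT x. f (c *\<^sub>R x)) = (1 / \<bar>c\<bar> ^ DIM('a)) *\<^sub>R (LBINT x. f x)"
proof -
  have "(LBINT x. f x) = (\<integral>x. f x \<partial>(density (distr lborel borel (\<lambda>x. 0 + c *\<^sub>R x)) (\<lambda>_. ennreal (\<bar>c\<bar>^DIM('a)))))"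
    using lborel_affine[OF \<open>c \<noteq> 0\<close>, of "0::'a"] by (simp flip: ennreal_power)
  also have "\<dots> = (\<integral>x. (\<bar>c\<bar>^DIM('a)) *\<^sub>R f x \<partial>(distr lborel borel (\<lambda>x. 0 + c *\<^sub>R x)))"
    by (rule integral_density) auto
  also have "\<dots> = (LBINT x. (\<bar>c\<bar>^DIM('a)) *\<^sub>R f (0 + c *\<^sub>R x))"
    by (rule integral_distr) auto
  also have "\<dots> = (\<bar>c\<bar>^DIM('a)) *\<^sub>R (LBINT x. f (c *\<^sub>R x))"
    by simp
  finally show ?thesis using \<open>c \<noteq> 0\<close> by simp
qed

definition compactly_supported :: "('a::real_normed_vector \<Rightarrow> 'b::zero) \<Rightarrow> bool" where
  "compactly_supported f \<longleftrightarrow> (\<exists>R. \<forall>x. R < norm x \<longrightarrow> f x = 0)"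

lemma compactly_supportedE:
  assumes "compactly_supported f"
  obtains R where "R > 0" "\<And>x. R < norm x \<Longrightarrow> f x = 0"
proof -
  obtain R where "\<forall>x. R < norm x \<longrightarrow> f x = 0" using assms by (auto simp: compactly_supported_def)
  then show thesis by (intro that[of "max R 1"]) auto
qed

lemma compactly_supported_mult:
  fixes f g :: "'a::real_normed_vector \<Rightarrow> 'b::mult_zero"
  shows "compactly_supported f \<Longrightarrow> compactly_supported (\<lambda>x. f x * g x)"
  and "compactly_supported f \<Longrightarrow> compactly_supported (\<lambda>x. g x * f x)"
  by (auto simp: compactly_supported_def) (metis mult_zero_left, metis mult_zero_right)

lemma compactly_supported_comp:
  "compactly_supported f \<Longrightarrow> (\<And>x. f x = 0 \<Longrightarrow> g x = 0) \<Longrightarrow> compactly_supported g"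
  unfolding compactly_supported_def by metis

lemma compactly_supported_bounded:
  fixes f :: "'a::euclidean_space \<Rightarrow> 'b::real_normed_vector"
  assumes "continuous_on UNIV f" "compactly_supported f"
  obtains B where "B > 0" "\<And>x. norm (f x) \<le> B"
proof -
  obtain R where R: "R > 0" "\<And>x. R < norm x \<Longrightarrow> f x = 0"
    using assms(2) by (rule compactly_supportedE) blast
  have "compact (f ` cball 0 R)"
    using assms(1) by (intro compact_continuous_image) (auto intro: continuous_on_subset)
  then have "bounded (f ` cball 0 R)" by (rule compact_imp_bounded)
  then obtain B where B: "B > 0" "\<And>x. x \<in> cball 0 R \<Longrightarrow> norm (f x) \<le> B"
    by (auto simp: bounded_pos)
  show thesis
  proof (rule that[OF \<open>B > 0\<close>])
    fix x show "norm (f x) \<le> B"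
      using B R by (cases "norm x \<le> R") auto
  qed
qed

lemma integrable_compactly_supported:
  fixes f :: "'a::euclidean_space \<Rightarrow> 'b::euclidean_space"
  assumes "continuous_on UNIV f" "compactly_supported f"
  shows "integrable lborel f"
proof -
  obtain R where R: "\<And>x. R < norm x \<Longrightarrow> f x = 0"
    using assms(2) by (rule compactly_supportedE) blast
  have "integrable lborel (\<lambda>x. indicator (cball 0 R) x *\<^sub>R f x)"
    using assms(1) by (intro borel_integrable_compact) (auto intro: continuous_on_subset)
  moreover have "(\<lambda>x. indicator (cball 0 R) x *\<^sub>R f x) = f"
    using R by (fastforce simp: indicator_def fun_eq_iff)
  ultimately show ?thesis by simp
qed

text \<open>If the integral were zero, the function would vanish almost everywhere, making a
  nonempty open box negligible.\<close>

lemma integral_pos_on_box: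
  fixes g :: "real^'n \<Rightarrow> real"
  assumes int: "integrable lborel g" and nn: "\<And>x. 0 \<le> g x" and "r > 0"
    and pos: "\<And>x. x \<in> box (vec (- r)) (vec r) \<Longrightarrow> 0 < g x"
  shows "0 < (LBINT x. g x)"
proof (rule ccontr)
  let ?B = "box (vec (- r)) (vec r) :: (real^'n) set"
  assume "\<not> 0 < (LBINT x. g x)"
  moreover have "0 \<le> (LBINT x. g x)" by (intro Bochner_Integration.integral_nonneg nn)
  ultimately have "(LBINT x. g x) = 0" by simp
  then have "AE x in lborel. g x = 0"
    using int nn by (subst (asm) integral_nonneg_eq_0_iff_AE) auto
  then have "AE x in lborel. x \<notin> ?B"
    by eventually_elim (use pos in force)
  then have "?B \<in> null_sets lborel"
    by (simp add: AE_iff_null_sets)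
  then have "negligible ?B"
    by (simp add: negligible_iff_null_sets null_sets_def)
  then have "?B = {}"
    by (simp add: negligible_interval)
  moreover have "0 \<in> ?B" using \<open>r > 0\<close> by (simp add: mem_box_cart)
  ultimately show False using \<open>r > 0\<close> by simp
qed

text \<open>Continuous partial derivatives along the coordinate axes are all the regularity
  that the trial functions need.\<close>

definition has_partials ::
    "(real^3 \<Rightarrow> 'b::real_normed_vector) \<Rightarrow> (3 \<Rightarrow> real^3 \<Rightarrow> 'b) \<Rightarrow> bool" where
  "has_partials f F \<longleftrightarrow> continuous_on UNIV f \<and> (\<forall>j. continuous_on UNIV (F j) \<and>
     (\<forall>x. ((\<lambda>t. f (x + t *\<^sub>R axis j 1)) has_vector_derivative F j x) (at 0)))"

lemma has_partialsD:
  assumes "has_partials f F"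
  shows "continuous_on UNIV f" "continuous_on UNIV (F j)"
    "((\<lambda>t. f (x + t *\<^sub>R axis j 1)) has_vector_derivative F j x) (at 0)"
  using assms by (auto simp: has_partials_def)

text \<open>The definition gives derivatives at parameter 0 only; moving the base point along the
  axis turns this into a derivative at every parameter.\<close>

lemma has_partials_line:
  assumes "has_partials f F"
  shows "((\<lambda>t. f (x + t *\<^sub>R axis j 1)) has_vector_derivative F j (x + s *\<^sub>R axis j 1)) (at s)"
proof -
  have "((\<lambda>t. f ((x + s *\<^sub>R axis j 1) + t *\<^sub>R axis j 1)) has_vector_derivative F j (x + s *\<^sub>R axis j 1)) (at (s - s))"
    using has_partialsD(3)[OF assms] by simp
  then have "((\<lambda>t. f ((x + s *\<^sub>R axis j 1) + t *\<^sub>R axis j 1)) \<circ> (\<lambda>t. t - s) has_vector_derivative 1 *\<^sub>R F j (x + s *\<^sub>R axis j 1)) (at s)"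
    by (intro vector_diff_chain_at) (auto intro!: derivative_eq_intros)
  then show ?thesis
    by (simp add: o_def algebra_simps)
qed

lemma has_partials_bilinear:
  assumes bl: "bounded_bilinear prd" and f: "has_partials f F" and g: "has_partials g G"
  shows "has_partials (\<lambda>x. prd (f x) (g x)) (\<lambda>j x. prd (f x) (G j x) + prd (F j x) (g x))"
proof -
  interpret bounded_bilinear prd by fact
  show ?thesis unfolding has_partials_def
  proof (intro conjI allI)
    show "continuous_on UNIV (\<lambda>x. prd (f x) (g x))"
      by (intro continuous_on has_partialsD[OF f] has_partialsD[OF g])
    fix j show "continuous_on UNIV (\<lambda>x. prd (f x) (G j x) + prd (F j x) (g x))"
      by (intro continuous_on_add continuous_on has_partialsD[OF f] has_partialsD[OF g])
    fix x
    have "((\<lambda>t. prd (f (x + t *\<^sub>R axis j 1)) (g (x + t *\<^sub>R axis j 1))) has_vector_derivative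
        prd (f (x + 0 *\<^sub>R axis j 1)) (G j x) + prd (F j x) (g (x + 0 *\<^sub>R axis j 1))) (at 0)"
      by (intro has_vector_derivative bl has_partialsD(3)[OF f] has_partialsD(3)[OF g])
    then show "((\<lambda>t. prd (f (x + t *\<^sub>R axis j 1)) (g (x + t *\<^sub>R axis j 1))) has_vector_derivative
        prd (f x) (G j x) + prd (F j x) (g x)) (at 0)" by simp
  qed
qed

lemmas has_partials_mult = has_partials_bilinear[OF bounded_bilinear_mult]

lemma has_partials_linear:
  assumes bl: "bounded_linear T" and f: "has_partials f F"
  shows "has_partials (\<lambda>x. T (f x)) (\<lambda>j x. T (F j x))"
proof -
  interpret bounded_linear T by fact
  show ?thesis unfolding has_partials_def
    by (intro conjI allI continuous_on has_partialsD[OF f] has_vector_derivative)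
qed

lemma has_partials_add:
  assumes f: "has_partials f F" and g: "has_partials g G"
  shows "has_partials (\<lambda>x. f x + g x) (\<lambda>j x. F j x + G j x)"
  unfolding has_partials_def
  by (intro conjI allI continuous_on_add has_partialsD[OF f] has_partialsD[OF g]
        has_vector_derivative_add)

lemma has_partials_chain:
  fixes f :: "real^3 \<Rightarrow> real" and \<phi> :: "real \<Rightarrow> real"
  assumes f: "has_partials f F" and d: "\<And>x. (\<phi> has_real_derivative \<phi>' (f x)) (at (f x))"
    and c: "continuous_on UNIV (\<lambda>x. \<phi>' (f x))"
  shows "has_partials (\<lambda>x. \<phi> (f x)) (\<lambda>j x. \<phi>' (f x) * F j x)"
  unfolding has_partials_def
proof (intro conjI allI)
  have "continuous (at x) (\<lambda>x. \<phi> (f x))" for x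
  proof -
    have "continuous (at x) f" using has_partialsD(1)[OF f] by (simp add: continuous_on_eq_continuous_at)
    moreover have "continuous (at (f x)) \<phi>" using d DERIV_isCont by blast
    ultimately show ?thesis using continuous_at_compose by (force simp: o_def)
  qed
  then show "continuous_on UNIV (\<lambda>x. \<phi> (f x))" by (simp add: continuous_on_eq_continuous_at)
  fix j show "continuous_on UNIV (\<lambda>x. \<phi>' (f x) * F j x)"
    by (intro continuous_on_mult c has_partialsD[OF f])
  fix x
  have "((\<lambda>t. f (x + t *\<^sub>R axis j 1)) has_real_derivative F j x) (at 0)"
    using has_partialsD(3)[OF f] by (simp add: has_real_derivative_iff_has_vector_derivative)
  moreover have "(\<phi> has_real_derivative \<phi>' (f x)) (at (f (x + 0 *\<^sub>R axis j 1)))" using d by simp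
  ultimately have "((\<lambda>t. \<phi> (f (x + t *\<^sub>R axis j 1))) has_real_derivative \<phi>' (f x) * F j x) (at 0)"
    by (rule DERIV_chain2[rotated])
  then show "((\<lambda>t. \<phi> (f (x + t *\<^sub>R axis j 1))) has_vector_derivative \<phi>' (f x) * F j x) (at 0)"
    by (simp add: has_real_derivative_iff_has_vector_derivative)
qed

lemma has_partials_component: "has_partials (\<lambda>x. x $ i) (\<lambda>j x. if i = j then 1 else 0 :: real)"
  unfolding has_partials_def
  by (auto intro!: continuous_intros derivative_eq_intros simp: axis_def)

lemma has_partials_const: "has_partials (\<lambda>x. c) (\<lambda>j x. 0)"
  unfolding has_partials_def by (auto intro!: continuous_intros)

text \<open>The exterior of a closed ball is open, so near \<open>x\<close> the function is
  constantly zero along the axis.\<close>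

lemma has_partials_support:
  assumes f: "has_partials f F" and R: "\<And>x. R < norm x \<Longrightarrow> f x = 0" and x: "R < norm x"
  shows "F j x = 0"
proof -
  have "((\<lambda>t. 0) has_vector_derivative F j x) (at 0)"
  proof (rule has_vector_derivative_transform_within[OF has_partialsD(3)[OF f]])
    show "0 < norm x - R" using x by simp
    fix t :: real assume "dist t 0 < norm x - R"
    then have "\<bar>t\<bar> < norm x - R" by simp
    then have "norm (t *\<^sub>R (axis j 1 :: real^3)) < norm x - R" by simp
    then have "R < norm (x + t *\<^sub>R axis j 1)"
      using norm_diff_ineq[of x "t *\<^sub>R axis j 1"] by linarith
    then show "f (x + t *\<^sub>R axis j 1) = 0" by (rule R)
  qed auto
  then show ?thesis
    using vector_derivative_unique_at[of "\<lambda>t. 0" "F j x" 0 0] by auto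
qed

lemma has_partials_compactly_supported:
  assumes "has_partials f F" "compactly_supported f"
  shows "compactly_supported (F j)"
  using has_partials_support[OF assms(1)] assms(2) unfolding compactly_supported_def by metis

text \<open>Mean value inequality on the axis segment; a bound on the ball of radius
  \<open>\<bar>t\<bar>\<close> about \<open>x\<close> is enough, which later allows local
  bounds.\<close>

lemma has_partials_increment_bound:
  assumes f: "has_partials f F" and "\<And>y. norm (y - x) \<le> \<bar>t\<bar> \<Longrightarrow> norm (F j y) \<le> B"
  shows "norm (f (x + t *\<^sub>R axis j 1) - f x) \<le> B * \<bar>t\<bar>"
proof -
  have "norm (f (x + t *\<^sub>R axis j 1) - f (x + 0 *\<^sub>R axis j 1)) \<le> B * norm (t - 0)"
  proof (rule differentiable_bound[where S="closed_segment 0 t"])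
    fix s assume s: "s \<in> closed_segment 0 t"
    show "((\<lambda>t. f (x + t *\<^sub>R axis j 1)) has_derivative (\<lambda>h. h *\<^sub>R F j (x + s *\<^sub>R axis j 1))) (at s within closed_segment 0 t)"
      using has_partials_line[OF f, of x j s] 
      by (auto simp: has_vector_derivative_def intro: has_derivative_at_withinI)
    have "\<bar>s\<bar> \<le> \<bar>t\<bar>" using s by (auto simp: closed_segment_eq_real_ivl split: if_splits)
    then have "norm (F j (x + s *\<^sub>R axis j 1)) \<le> B" using assms(2)[of "x + s *\<^sub>R axis j 1"] by simp
    then show "onorm (\<lambda>h. h *\<^sub>R F j (x + s *\<^sub>R axis j 1)) \<le> B"
      by (intro onorm_le) (simp add: mult.commute[of B] mult_left_mono)
  qed auto
  then show ?thesis by simp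
qed

section \<open>Difference quotients and integration by parts\<close>

definition diff_quot :: "3 \<Rightarrow> real \<Rightarrow> (real^3 \<Rightarrow> 'b::real_normed_vector) \<Rightarrow> real^3 \<Rightarrow> 'b" where
  "diff_quot j t f x = (1 / t) *\<^sub>R (f (x + t *\<^sub>R axis j 1) - f x)"

lemma diff_quot_tendsto:
  assumes f: "has_partials f F" and t: "t \<longlonglongrightarrow> 0" "\<And>n. t n \<noteq> 0"
  shows "(\<lambda>n. diff_quot j (t n) f x) \<longlonglongrightarrow> F j x"
proof -
  have "((\<lambda>s. norm (f (0 + s) - f 0 - s *\<^sub>R D) / norm s) \<longlongrightarrow> 0) (at 0)"
    if "(f has_vector_derivative D) (at 0)" for f :: "real \<Rightarrow> 'a" and D
    using that by (simp add: has_vector_derivative_def has_derivative_at)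
  from this[OF has_partialsD(3)[OF f, of x j]]
  have "((\<lambda>s. norm (f (x + s *\<^sub>R axis j 1) - f x - s *\<^sub>R F j x) / norm s) \<longlongrightarrow> 0) (at 0)"
    by simp
  then have "(\<lambda>n. norm (f (x + t n *\<^sub>R axis j 1) - f x - t n *\<^sub>R F j x) / norm (t n)) \<longlonglongrightarrow> 0"
    by (rule filterlim_compose) (use t in \<open>auto simp: filterlim_at\<close>)
  moreover have "norm (f (x + t n *\<^sub>R axis j 1) - f x - t n *\<^sub>R F j x) / norm (t n)
      = norm (diff_quot j (t n) f x - F j x)" for n
  proof -
    have "diff_quot j (t n) f x - F j x = (1 / t n) *\<^sub>R (f (x + t n *\<^sub>R axis j 1) - f x - t n *\<^sub>R F j x)"
      using t(2)[of n] by (simp add: diff_quot_def scaleR_diff_right)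
    then show ?thesis by (simp add: divide_inverse mult.commute)
  qed
  ultimately have "(\<lambda>n. norm (diff_quot j (t n) f x - F j x)) \<longlonglongrightarrow> 0" by simp
  then show ?thesis using Lim_null[of "\<lambda>n. diff_quot j (t n) f x" "F j x"] tendsto_norm_zero_iff by blast
qed

lemma has_partials_shift:
  assumes "has_partials f F"
  shows "has_partials (\<lambda>x. f (x + a)) (\<lambda>j x. F j (x + a))"
  unfolding has_partials_def
proof (intro conjI allI)
  show "continuous_on UNIV (\<lambda>x. f (x + a))"
    by (rule continuous_on_compose2[OF has_partialsD(1)[OF assms]]) (auto intro!: continuous_intros)
  fix j show "continuous_on UNIV (\<lambda>x. F j (x + a))"
    by (rule continuous_on_compose2[OF has_partialsD(2)[OF assms]]) (auto intro!: continuous_intros)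
  fix x show "((\<lambda>t. f (x + t *\<^sub>R axis j 1 + a)) has_vector_derivative F j (x + a)) (at 0)"
    using has_partialsD(3)[OF assms, of "x + a" j] by (simp add: algebra_simps)
qed

lemma has_partials_diff_quot:
  assumes "has_partials f F"
  shows "has_partials (diff_quot j t f) (\<lambda>i. diff_quot j t (F i))"
proof -
  have "has_partials (\<lambda>x. (1 / t) *\<^sub>R (f (x + t *\<^sub>R axis j 1) + (- f x)))
      (\<lambda>i x. (1 / t) *\<^sub>R (F i (x + t *\<^sub>R axis j 1) + (- F i x)))"
    by (intro has_partials_linear[OF bounded_linear_scaleR_right] has_partials_add
        has_partials_shift assms has_partials_linear[OF bounded_linear_minus[OF bounded_linear_ident]])
  then show ?thesis by (simp add: diff_quot_def[abs_def])
qed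

lemma diff_quot_bound:
  assumes f: "has_partials f F" and "t \<noteq> 0" "\<bar>t\<bar> \<le> 1"
    and B: "\<And>y. norm y \<le> R + 1 \<Longrightarrow> norm (F j y) \<le> B" and x: "norm x \<le> R"
  shows "norm (diff_quot j t f x) \<le> B"
proof -
  have "norm (f (x + t *\<^sub>R axis j 1) - f x) \<le> B * \<bar>t\<bar>"
  proof (rule has_partials_increment_bound[OF f])
    fix y assume "norm (y - x) \<le> \<bar>t\<bar>"
    then have "norm y \<le> R + 1" using assms(3) x norm_triangle_ineq[of "y - x" x] by simp
    then show "norm (F j y) \<le> B" by (rule B)
  qed
  then show ?thesis using \<open>t \<noteq> 0\<close> by (simp add: diff_quot_def divide_simps)
qed

lemma diff_quot_support:
  assumes "\<And>x. R < norm x \<Longrightarrow> f x = 0" "\<bar>t\<bar> \<le> 1" "R + 1 < norm x"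
  shows "diff_quot j t f x = 0"
proof -
  have "norm (t *\<^sub>R (axis j 1 :: real^3)) \<le> 1" using assms(2) by simp
  then have "R < norm (x + t *\<^sub>R axis j 1)"
    using norm_diff_ineq[of x "t *\<^sub>R axis j 1"] assms(3) by linarith
  then show ?thesis using assms by (simp add: diff_quot_def)
qed

lemma continuous_on_diff_quot:
  "continuous_on UNIV f \<Longrightarrow> continuous_on UNIV (diff_quot j t f)"
  unfolding diff_quot_def[abs_def]
  by (intro continuous_on_scaleR continuous_on_const continuous_on_diff
      continuous_on_compose2[of UNIV f _ "\<lambda>x. x + t *\<^sub>R axis j 1"] continuous_on_add continuous_on_id subset_UNIV)

lemma continuous_bounded_on_ball:
  fixes f :: "'a::euclidean_space \<Rightarrow> 'b::real_normed_vector"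
  assumes "continuous_on UNIV f"
  obtains B where "B > 0" "\<And>y. norm y \<le> R \<Longrightarrow> norm (f y) \<le> B"
proof -
  have "compact (f ` cball 0 R)"
    using assms(1) by (intro compact_continuous_image) (auto intro: continuous_on_subset)
  then obtain B where "B > 0" "\<forall>y\<in>f ` cball 0 R. norm y \<le> B"
    using compact_imp_bounded by (metis bounded_pos)
  then show thesis by (intro that[of B]) auto
qed

text \<open>Compact support of either factor suffices: with steps of length at most 1 the product
  vanishes outside radius R + 1, and inside it the mean value bound supplies a dominating
  constant.\<close>

lemma integral_diff_quot_tendsto:
  fixes f :: "real^3 \<Rightarrow> 'b::{real_normed_field, euclidean_space}"
  assumes f: "has_partials f F" and g: "continuous_on UNIV g"
    and cs: "compactly_supported f \<or> compactly_supported g"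
    and t: "t \<longlonglongrightarrow> 0" "\<And>n. t n \<noteq> 0" "\<And>n. \<bar>t n\<bar> \<le> 1"
  shows "(\<lambda>n. LBINT x. g x * diff_quot j (t n) f x) \<longlonglongrightarrow> (LBINT x. g x * F j x)"
proof -
  obtain R where R: "(\<forall>x. R < norm x \<longrightarrow> f x = 0) \<or> (\<forall>x. R < norm x \<longrightarrow> g x = 0)"
    using cs unfolding compactly_supported_def by blast
  \<comment> \<open>For \<open>norm x\<close> at most R + 1 and a step of length at most 1, the
    quotient sees \<open>F j\<close> only within radius R + 2.\<close>
  obtain B1 where B1: "B1 > 0" "\<And>y. norm y \<le> R + 1 + 1 \<Longrightarrow> norm (F j y) \<le> B1"
    using continuous_bounded_on_ball[OF has_partialsD(2)[OF f]] by metis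
  obtain B2 where B2: "B2 > 0" "\<And>y. norm y \<le> R + 1 \<Longrightarrow> norm (g y) \<le> B2"
    using continuous_bounded_on_ball[OF g] by metis
  have bound: "norm (g x * diff_quot j (t n) f x) \<le> B2 * B1 * indicator (cball 0 (R + 1)) x" for x n
  proof (cases "norm x \<le> R + 1")
    case True
    then show ?thesis
      using B2(2)[OF True] diff_quot_bound[OF f t(2)[of n] t(3)[of n] B1(2), of "R + 1" x] B1(1) B2(1)
      by (simp add: norm_mult mult_mono)
  next
    case False
    then have "R < norm x" by simp
    then have "g x = 0 \<or> diff_quot j (t n) f x = 0"
      using R diff_quot_support[of R f "t n" x j] t(3)[of n] False by auto
    then show ?thesis using False by auto
  qed
  show ?thesis
  proof (rule integral_dominated_convergence[where w="\<lambda>x. B2 * B1 * indicator (cball 0 (R + 1)) x"])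
    show "(\<lambda>x. g x * F j x) \<in> borel_measurable lborel"
      using g has_partialsD(2)[OF f] by (auto intro!: borel_measurable_continuous_onI continuous_intros)
    fix n show "(\<lambda>x. g x * diff_quot j (t n) f x) \<in> borel_measurable lborel"
      using g has_partialsD(1)[OF f]
      by (auto intro!: borel_measurable_continuous_onI continuous_intros continuous_on_diff_quot)
    show "integrable lborel (\<lambda>x::real^3. B2 * B1 * indicator (cball 0 (R + 1)) x :: real)"
      by (auto intro!: emeasure_bounded_finite)
    show "AE x in lborel. (\<lambda>n. g x * diff_quot j (t n) f x) \<longlonglongrightarrow> g x * F j x"
      by (intro AE_I2 tendsto_intros diff_quot_tendsto[OF f] t)
    show "AE x in lborel. norm (g x * diff_quot j (t n) f x) \<le> B2 * B1 * indicator (cball 0 (R + 1)) x"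
      using bound by simp
  qed
qed

text \<open>Both signs are provided because moving a quotient from one factor to the other reverses
  the step.\<close>

lemma null_step_seq:
  defines "t \<equiv> \<lambda>n::nat. 1 / real (Suc n)"
  shows "t \<longlonglongrightarrow> 0" "t n \<noteq> 0" "\<bar>t n\<bar> \<le> 1"
    "(\<lambda>n. - t n) \<longlonglongrightarrow> 0" "- t n \<noteq> 0" "\<bar>- t n\<bar> \<le> 1"
proof -
  show t: "t \<longlonglongrightarrow> 0" unfolding t_def using LIMSEQ_Suc[OF lim_1_over_n[where 'a=real]] by simp
  show "(\<lambda>n. - t n) \<longlonglongrightarrow> 0" using tendsto_minus[OF t] by simp
qed (auto simp: t_def)

text \<open>Translation invariance makes the integral of each difference quotient zero, and the
  quotients converge under the integral.\<close>

lemma integral_partial_eq_0: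
  fixes f :: "real^3 \<Rightarrow> 'b::{real_normed_field, euclidean_space}"
  assumes f: "has_partials f F" and cs: "compactly_supported f"
  shows "(LBINT x. F j x) = 0"
proof -
  let ?t = "\<lambda>n::nat. 1 / real (Suc n)"
  have "(\<lambda>n. LBINT x. 1 * diff_quot j (?t n) f x) \<longlonglongrightarrow> (LBINT x. 1 * F j x)"
    by (rule integral_diff_quot_tendsto[OF f]) (use cs null_step_seq in auto)
  moreover have "(LBINT x. 1 * diff_quot j t f x) = 0" for t
  proof -
    note c = has_partialsD(1)[OF f]
    have i: "integrable lborel f" using c cs by (rule integrable_compactly_supported)
    have "(LBINT x. 1 * diff_quot j t f x) = (1 / t) *\<^sub>R ((LBINT x. f (x + t *\<^sub>R axis j 1)) - (LBINT x. f x))"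
      unfolding diff_quot_def using i lborel_integrable_translation[OF i] by simp
    also have "\<dots> = 0"
      using c by (subst lborel_integral_translation) (auto intro: borel_measurable_continuous_onI)
    finally show ?thesis .
  qed
  ultimately show ?thesis by (simp add: LIMSEQ_const_iff)
qed

lemma integration_by_parts:
  fixes f g :: "real^3 \<Rightarrow> 'b::{real_normed_field, euclidean_space}"
  assumes f: "has_partials f F" and g: "has_partials g G" and cs: "compactly_supported g"
  shows "(LBINT x. F j x * g x) = - (LBINT x. f x * G j x)"
proof -
  note c = has_partialsD[OF f] has_partialsD[OF g]
  have i1: "integrable lborel (\<lambda>x. f x * G j x)"
    by (intro integrable_compactly_supported continuous_intros c compactly_supported_mult
        has_partials_compactly_supported[OF g cs])
  have i2: "integrable lborel (\<lambda>x. F j x * g x)"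
    by (intro integrable_compactly_supported continuous_intros c compactly_supported_mult cs)
  have "(LBINT x. f x * G j x + F j x * g x) = 0"
    by (rule integral_partial_eq_0[OF has_partials_mult[OF f g]]) (intro compactly_supported_mult cs)
  then show ?thesis using i1 i2 by (simp add: eq_neg_iff_add_eq_0 add.commute)
qed

text \<open>Moving a difference quotient from one factor to the other replaces the symmetry of
  second derivatives, which do not exist here.\<close>

lemma integral_partials_swap:
  fixes u v :: "real^3 \<Rightarrow> 'b::{real_normed_field, euclidean_space}"
  assumes u: "has_partials u U" and v: "has_partials v V" and cs: "compactly_supported v"
  shows "(LBINT x. U i x * V j x) = (LBINT x. U j x * V i x)"
proof -
  let ?t = "\<lambda>n::nat. 1 / real (Suc n)"
  note c = has_partialsD[OF u] has_partialsD[OF v]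
  have csV: "compactly_supported (V i)" by (rule has_partials_compactly_supported[OF v cs])
  \<comment> \<open>Under the integral, the adjoint of the quotient with step \<open>t\<close> is
    minus the quotient with step \<open>- t\<close>; beforehand the derivative in direction i is
    moved from \<open>u\<close> to \<open>v\<close> by parts. Letting the step tend to 0 on both
    sides yields the two orders of the indices.\<close>
  have eq: "(LBINT x. U i x * diff_quot j t v x) = (LBINT x. V i x * diff_quot j (- t) u x)"
    if t: "t \<noteq> 0" "\<bar>t\<bar> \<le> 1" for t
  proof -
    let ?e = "t *\<^sub>R axis j 1 :: real^3"
    have cont: "continuous_on UNIV (\<lambda>x. u (x + a))" "continuous_on UNIV (\<lambda>x. V i (x + a))" for a
      by (auto intro!: continuous_on_compose2[OF c(1)] continuous_on_compose2[OF c(5)] continuous_intros)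
    have cs': "compactly_supported (diff_quot j t v)"
    proof -
      obtain R where R: "\<And>x. R < norm x \<Longrightarrow> v x = 0" using cs unfolding compactly_supported_def by blast
      show ?thesis unfolding compactly_supported_def
        by (intro exI[of _ "R + 1"] allI impI diff_quot_support[OF R t(2)])
    qed
    have i1: "integrable lborel (\<lambda>x. u x * V i x)"
      by (intro integrable_compactly_supported continuous_intros c compactly_supported_mult csV)
    have i2: "integrable lborel (\<lambda>x. u (x + - ?e) * V i x)"
      by (intro integrable_compactly_supported continuous_intros c cont compactly_supported_mult csV)
    have i3: "integrable lborel (\<lambda>x. u x * V i (x + ?e))"
      using lborel_integrable_translation[OF i2, of "?e"] by simp
    have "(LBINT x. U i x * diff_quot j t v x) = - (LBINT x. u x * diff_quot j t (V i) x)"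
      by (rule integration_by_parts[OF u has_partials_diff_quot[OF v] cs'])
    also have "(LBINT x. u x * diff_quot j t (V i) x)
        = (LBINT x. (1 / t) *\<^sub>R (u x * V i (x + ?e) - u x * V i x))"
      by (simp add: diff_quot_def right_diff_distrib)
    also have "\<dots> = (1 / t) *\<^sub>R ((LBINT x. u x * V i (x + ?e)) - (LBINT x. u x * V i x))"
      using i1 i3 by simp
    also have "(LBINT x. u x * V i (x + ?e)) = (LBINT x. u (x + - ?e) * V i x)"
      using lborel_integral_translation[OF borel_measurable_integrable[OF i2, simplified], of "?e"] by simp
    also have "(1 / t) *\<^sub>R ((LBINT x. u (x + - ?e) * V i x) - (LBINT x. u x * V i x))
        = (LBINT x. (1 / t) *\<^sub>R (u (x + - ?e) * V i x - u x * V i x))"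
      using i1 i2 by simp
    also have "- \<dots> = (LBINT x. V i x * diff_quot j (- t) u x)"
      unfolding integral_minus[symmetric]
      by (rule Bochner_Integration.integral_cong) (auto simp: diff_quot_def right_diff_distrib mult.commute)
    finally show ?thesis .
  qed
  have "(\<lambda>n. LBINT x. U i x * diff_quot j (?t n) v x) \<longlonglongrightarrow> (LBINT x. U i x * V j x)"
    by (rule integral_diff_quot_tendsto[OF v c(2)]) (use cs null_step_seq in auto)
  moreover have "(\<lambda>n. LBINT x. V i x * diff_quot j (- ?t n) u x) \<longlonglongrightarrow> (LBINT x. V i x * U j x)"
    by (rule integral_diff_quot_tendsto[OF u c(5)]) (use csV null_step_seq in auto)
  ultimately have "(LBINT x. U i x * V j x) = (LBINT x. V i x * U j x)"
    unfolding eq[OF null_step_seq(2,3)] by (rule LIMSEQ_unique)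
  then show ?thesis by (simp add: mult.commute)
qed

section \<open>Smooth bump functions\<close>

text \<open>C^k on the line. The derivative is existentially quantified so that each induction step
  can exhibit it explicitly; continuity is demanded of the last derivative only.\<close>

primrec times_differentiable :: "nat \<Rightarrow> (real \<Rightarrow> real) \<Rightarrow> bool" where
  "times_differentiable 0 h \<longleftrightarrow> continuous_on UNIV h"
| "times_differentiable (Suc k) h \<longleftrightarrow>
     (\<exists>h'. (\<forall>t. (h has_real_derivative h' t) (at t)) \<and> times_differentiable k h')"

lemma times_differentiable_Suc_D: "times_differentiable (Suc k) h \<Longrightarrow> times_differentiable k h"
proof (induction k arbitrary: h)
  case 0
  then show ?case by (auto intro!: continuous_at_imp_continuous_on intro: DERIV_isCont)
next
  case (Suc k)
  then obtain h' where "\<forall>t. (h has_real_derivative h' t) (at t)" "times_differentiable (Suc k) h'"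
    unfolding times_differentiable.simps(2)[of "Suc k"] by blast
  then show ?case using Suc.IH[of h'] unfolding times_differentiable.simps(2)[of k h] by blast
qed

lemma times_differentiable_add:
  "times_differentiable k g \<Longrightarrow> times_differentiable k h \<Longrightarrow> times_differentiable k (\<lambda>t. g t + h t)"
proof (induction k arbitrary: g h)
  case (Suc k)
  then obtain g' h' where "\<forall>t. (g has_real_derivative g' t) (at t)" "times_differentiable k g'"
    "\<forall>t. (h has_real_derivative h' t) (at t)" "times_differentiable k h'" by auto
  then show ?case
    by (auto intro!: exI[of _ "\<lambda>t. g' t + h' t"] Suc.IH derivative_intros)
qed (auto intro: continuous_intros)

lemma times_differentiable_mult:
  "times_differentiable k g \<Longrightarrow> times_differentiable k h \<Longrightarrow> times_differentiable k (\<lambda>t. g t * h t)"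
proof (induction k arbitrary: g h)
  case (Suc k)
  then obtain g' h' where *: "\<forall>t. (g has_real_derivative g' t) (at t)" "times_differentiable k g'"
    "\<forall>t. (h has_real_derivative h' t) (at t)" "times_differentiable k h'" by auto
  have "times_differentiable k (\<lambda>t. g' t * h t + h' t * g t)"
    using Suc.prems[THEN times_differentiable_Suc_D] *
    by (intro times_differentiable_add Suc.IH)
  then show ?case using *
    by (auto intro!: exI[of _ "\<lambda>t. g' t * h t + h' t * g t"] derivative_eq_intros)
qed (auto intro: continuous_intros)

lemma times_differentiable_affine:
  "times_differentiable k h \<Longrightarrow> times_differentiable k (\<lambda>t. c * h (p * t + q))"
proof (induction k arbitrary: h c)
  case 0
  then show ?case
    by (auto intro!: continuous_intros continuous_on_compose2[of UNIV h])
next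
  case (Suc k)
  then obtain h' where *: "\<And>t. (h has_real_derivative h' t) (at t)" "times_differentiable k h'" by auto
  have "((\<lambda>t. c * h (p * t + q)) has_real_derivative (c * p) * h' (p * t + q)) (at t)" for t
    by (rule derivative_eq_intros DERIV_chain2[OF *(1)] refl | simp)+
  with Suc.IH[OF *(2), of "c * p"] show ?case
    by (auto intro!: exI[of _ "\<lambda>t. c * p * h' (p * t + q)"])
qed

text \<open>\<open>flat 1\<close> is the classical exp(-1/t) glued to 0. The polynomial in 1/t
  closes the family under differentiation: with s = 1/t, the derivative of p(s) exp(-s) in t is s^2
  (p - p')(s) exp(-s), so smoothness follows by induction.\<close>

definition flat :: "real poly \<Rightarrow> real \<Rightarrow> real" where
  "flat p t = (if t > 0 then poly p (1 / t) * exp (- (1 / t)) else 0)"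

lemma poly_times_exp_tendsto_0: "((\<lambda>s. s ^ n * poly p s * exp (- s)) \<longlongrightarrow> (0::real)) at_top"
proof (induction p arbitrary: n)
  case (pCons a p)
  have "((\<lambda>s. a * (s ^ n / exp s) + s ^ Suc n * poly p s * exp (- s)) \<longlongrightarrow> a * 0 + 0) at_top"
    by (intro tendsto_intros tendsto_power_div_exp_0 pCons.IH)
  then show ?case by (simp add: field_simps exp_minus)
qed simp

lemma flat_has_derivative:
  "(flat p has_real_derivative flat ([:0, 0, 1:] * (p - pderiv p)) t) (at t)"
proof -
  let ?q = "[:0, 0, 1:] * (p - pderiv p)"
  consider "t > 0" | "t < 0" | "t = 0" by linarith
  then show ?thesis
  proof cases
    case 1
    have "((\<lambda>t. poly p (1 / t) * exp (- (1 / t))) has_real_derivative flat ?q t) (at t)"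
      using 1 by (auto intro!: derivative_eq_intros DERIV_chain2[OF poly_DERIV]
          simp: flat_def field_simps power2_eq_square)
    then show ?thesis
      by (rule has_field_derivative_transform_within_open[of _ _ _ "{0<..}"]) (use 1 in \<open>auto simp: flat_def\<close>)
  next
    case 2
    have "((\<lambda>t. 0) has_real_derivative flat ?q t) (at t)" using 2 by (simp add: flat_def)
    then show ?thesis
      by (rule has_field_derivative_transform_within_open[of _ _ _ "{..<0}"]) (use 2 in \<open>auto simp: flat_def\<close>)
  next
    case 3
    have "((\<lambda>h. (flat p (0 + h) - flat p 0) / h) \<longlongrightarrow> 0) (at 0)"
    proof -
      show "((\<lambda>h. (flat p (0 + h) - flat p 0) / h) \<longlongrightarrow> 0) (at 0)"
      proof (rule filterlim_split_at)
        show "((\<lambda>h. (flat p (0 + h) - flat p 0) / h) \<longlongrightarrow> 0) (at_left 0)"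
          by (rule tendsto_eventually) (auto simp: flat_def eventually_at_filter)
        \<comment> \<open>With s = 1/h this is s p(s) exp(-s) as s tends to infinity.\<close>
        have "((\<lambda>h. (1 / h) ^ 1 * poly p (1 / h) * exp (- (1 / h))) \<longlongrightarrow> 0) (at_right (0::real))"
          by (rule filterlim_compose[OF poly_times_exp_tendsto_0])
             (use filterlim_inverse_at_top_right in \<open>simp add: inverse_eq_divide\<close>)
        then show "((\<lambda>h. (flat p (0 + h) - flat p 0) / h) \<longlongrightarrow> 0) (at_right 0)"
          by (rule Lim_transform_eventually) (auto simp: flat_def eventually_at_filter)
      qed
    qed
    then show ?thesis using 3 by (simp add: DERIV_def flat_def)
  qed
qed

lemma times_differentiable_flat: "times_differentiable k (flat p)"
proof (induction k arbitrary: p)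
  case 0
  show ?case
    using DERIV_isCont[OF flat_has_derivative] by (auto intro!: continuous_at_imp_continuous_on)
next
  case (Suc k)
  then show ?case using flat_has_derivative by auto
qed

section \<open>Smooth functions and test functions on three-dimensional space\<close>

lemma partial_eqI: "has_partials f F \<Longrightarrow> partial j f x = F j x"
  unfolding partial_def by (intro vector_derivative_at has_partialsD)

lemma Ck_Suc_D: "Ck (Suc k) f \<Longrightarrow> Ck k f"
proof (induction k arbitrary: f)
  case 0
  then show ?case
    by (auto intro!: continuous_at_imp_continuous_on differentiable_imp_continuous_within)
qed simp

lemma Ck_1_has_partials:
  assumes "Ck (Suc 0) f"
  shows "has_partials f (\<lambda>j. partial j f)"
  unfolding has_partials_def
proof (intro conjI allI)
  show "continuous_on UNIV f" using Ck_Suc_D[OF assms] by simp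
  fix j show "continuous_on UNIV (partial j f)" using assms by simp
  fix x
  have "f differentiable at (x + 0 *\<^sub>R axis j 1)" using assms by simp
  then have "(f \<circ> (\<lambda>t. x + t *\<^sub>R axis j 1)) differentiable at 0"
    by (intro differentiable_chain_at) auto
  then show "((\<lambda>t. f (x + t *\<^sub>R axis j 1)) has_vector_derivative partial j f x) (at 0)"
    unfolding partial_def o_def by (simp add: vector_derivative_works)
qed

lemma Ck_has_partials: "Ck k f \<Longrightarrow> k > 0 \<Longrightarrow> has_partials f (\<lambda>j. partial j f)"
proof (induction k)
  case (Suc k)
  then show ?case by (cases k) (auto dest: Ck_Suc_D intro: Ck_1_has_partials simp del: Ck.simps)
qed simp

lemma Ck_add:
  "Ck k f \<Longrightarrow> Ck k g \<Longrightarrow> Ck k (\<lambda>x. f x + g x)"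
proof (induction k arbitrary: f g)
  case (Suc k)
  have "partial j (\<lambda>x. f x + g x) = (\<lambda>x. partial j f x + partial j g x)" for j
    using Suc.prems by (intro ext partial_eqI has_partials_add) (auto intro: Ck_has_partials simp del: Ck.simps)
  then show ?case using Suc by (auto intro: differentiable_add)
qed (auto intro: continuous_intros)

lemma Ck_mult:
  fixes f g :: "real^3 \<Rightarrow> 'b::real_normed_field"
  shows "Ck k f \<Longrightarrow> Ck k g \<Longrightarrow> Ck k (\<lambda>x. f x * g x)"
proof (induction k arbitrary: f g)
  case (Suc k)
  have "partial j (\<lambda>x. f x * g x) = (\<lambda>x. f x * partial j g x + partial j f x * g x)" for j
    using Suc.prems by (intro ext partial_eqI has_partials_mult) (auto intro: Ck_has_partials simp del: Ck.simps)
  moreover have "Ck k (\<lambda>x. f x * partial j g x + partial j f x * g x)" for j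
    using Suc.prems Suc.prems[THEN Ck_Suc_D] by (intro Ck_add Suc.IH) auto
  ultimately show ?case using Suc.prems by (auto intro: differentiable_mult)
qed (auto intro: continuous_intros)

lemma test_function_mult:
  assumes "test_function \<phi>" "test_function \<psi>"
  shows "test_function (\<lambda>x. \<phi> x * \<psi> x)"
proof -
  obtain K where "compact K" "\<forall>x. x \<notin> K \<longrightarrow> \<phi> x = 0" using assms by (auto simp: test_function_def)
  moreover have "Ck k (\<lambda>x. \<phi> x * \<psi> x)" for k
    using assms by (intro Ck_mult) (auto simp: test_function_def)
  ultimately show ?thesis unfolding test_function_def by (intro conjI allI exI[of _ K]) auto
qed

lemma test_function_has_partials: "test_function \<phi> \<Longrightarrow> has_partials \<phi> (\<lambda>j. partial j \<phi>)"
  unfolding test_function_def by (auto intro: Ck_has_partials)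

lemma test_function_compactly_supported: 
  assumes "test_function \<phi>" shows "compactly_supported \<phi>"
proof -
  obtain K where K: "compact K" "\<forall>x. x \<notin> K \<longrightarrow> \<phi> x = 0" using assms by (auto simp: test_function_def)
  then obtain R where "\<forall>x\<in>K. norm x \<le> R" using compact_imp_bounded by (metis bounded_pos)
  then show ?thesis using K unfolding compactly_supported_def by (metis linorder_not_le)
qed

text \<open>A partial derivative of such a product only exchanges one factor for its derivative, so
  the C^k property reduces to the line. Values are complex because test functions are.\<close>

definition tensor :: "(3 \<Rightarrow> real \<Rightarrow> real) \<Rightarrow> real^3 \<Rightarrow> complex" where
  "tensor h x = complex_of_real (\<Prod>i\<in>UNIV. h i (x $ i))"

lemma prod_3: "prod f (UNIV::3 set) = f 1 * f 2 * f 3"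
  unfolding UNIV_3 by (simp add: ac_simps)

lemma tensor_3: "tensor h x = of_real (h 1 (x $ 1) * h 2 (x $ 2) * h 3 (x $ 3))"
  by (simp add: tensor_def prod_3)

lemma tensor_has_derivative:
  assumes "\<And>i t. (h i has_real_derivative h' i t) (at t)"
  shows "(tensor h has_derivative (\<lambda>v. \<Sum>j\<in>UNIV. (v $ j) *\<^sub>R tensor (h(j := h' j)) x)) (at x)"
proof -
  have *: "((\<lambda>x::real^3. h i (x $ i)) has_derivative (\<lambda>v. v $ i * h' i (x $ i))) (at x)" for i
  proof -
    have "((\<lambda>x::real^3. x $ i) has_derivative (\<lambda>v. v $ i)) (at x)"
      by (intro bounded_linear.has_derivative[OF bounded_linear_vec_nth] has_derivative_ident)
    from has_derivative_compose[OF this, of "h i" "\<lambda>s. s * h' i (x $ i)"] assms[of i "x $ i"]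
    show ?thesis by (simp add: has_field_derivative_def mult_commute_abs)
  qed
  have "((\<lambda>x. complex_of_real (h 1 (x $ 1) * h 2 (x $ 2) * h 3 (x $ 3))) has_derivative
     (\<lambda>v. of_real (h 1 (x $ 1) * h 2 (x $ 2) * (v $ 3 * h' 3 (x $ 3)) +
         (h 1 (x $ 1) * (v $ 2 * h' 2 (x $ 2)) + (v $ 1 * h' 1 (x $ 1)) * h 2 (x $ 2)) * h 3 (x $ 3)))) (at x)"
    by (intro bounded_linear.has_derivative[OF bounded_linear_of_real] has_derivative_mult *)
  moreover have "(1::3) \<noteq> 2" "(1::3) \<noteq> 3" "(2::3) \<noteq> 3" by auto
  ultimately show ?thesis
    unfolding tensor_3[abs_def] sum_3 by (simp add: scaleR_conv_of_real algebra_simps)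
qed

lemma Ck_tensor: "(\<And>i. times_differentiable k (h i)) \<Longrightarrow> Ck k (tensor h)"
proof (induction k arbitrary: h)
  case 0
  have "continuous_on UNIV (\<lambda>x::real^3. h i (x $ i))" for i
    using 0[of i] by (auto intro!: continuous_on_compose2[of UNIV "h i"] continuous_intros)
  then show ?case unfolding tensor_def[abs_def] by (auto intro!: continuous_intros)
next
  case (Suc k)
  then obtain h' where h': "\<And>i t. (h i has_real_derivative h' i t) (at t)" "\<And>i. times_differentiable k (h' i)"
    by (auto) metis
  have d: "(tensor h has_derivative (\<lambda>v. \<Sum>j\<in>UNIV. (v $ j) *\<^sub>R tensor (h(j := h' j)) x)) (at x)" for x
    by (rule tensor_has_derivative[OF h'(1)])
  have "partial j (tensor h) = tensor (h(j := h' j))" for j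
  proof
    fix x
    have "((\<lambda>t. x + t *\<^sub>R axis j 1) has_derivative (\<lambda>t. t *\<^sub>R axis j 1 :: real^3)) (at 0)"
      by (auto intro!: derivative_eq_intros)
    moreover have "(tensor h has_derivative (\<lambda>v. \<Sum>i\<in>UNIV. (v $ i) *\<^sub>R tensor (h(i := h' i)) x)) (at (x + 0 *\<^sub>R axis j 1))"
      using d by simp
    ultimately have "((\<lambda>t. tensor h (x + t *\<^sub>R axis j 1)) has_derivative
        (\<lambda>t. \<Sum>i\<in>UNIV. ((t *\<^sub>R axis j 1 :: real^3) $ i) *\<^sub>R tensor (h(i := h' i)) x)) (at 0)"
      by (rule has_derivative_compose)
    moreover have "(\<Sum>i\<in>UNIV. ((t *\<^sub>R axis j 1 :: real^3) $ i) *\<^sub>R tensor (h(i := h' i)) x)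
        = t *\<^sub>R tensor (h(j := h' j)) x" for t
      by (subst sum.remove[of _ j]) (auto simp: axis_def intro!: sum.neutral)
    ultimately show "partial j (tensor h) x = tensor (h(j := h' j)) x"
      unfolding partial_def by (intro vector_derivative_at) (simp add: has_vector_derivative_def)
  qed
  moreover have "Ck k (tensor (h(j := h' j)))" for j
    using Suc.prems times_differentiable_Suc_D h'(2) by (intro Suc.IH) auto
  ultimately have "\<forall>j. Ck k (partial j (tensor h))" by simp
  with d show ?case unfolding Ck.simps differentiable_def by blast
qed

text \<open>On (a, b) this is exp(-1/(n(t-a))) exp(-1/(n(b-t))). For positive n the parameter leaves
  the support alone and only sharpens the profile; n to infinity gives the indicator.\<close>

definition bump1 :: "real \<Rightarrow> real \<Rightarrow> real \<Rightarrow> real \<Rightarrow> real" where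
  "bump1 n a b t = flat 1 (n * (t - a)) * flat 1 (n * (b - t))"

definition bump :: "real \<Rightarrow> real^3 \<Rightarrow> real^3 \<Rightarrow> real^3 \<Rightarrow> real" where
  "bump n a b x = (\<Prod>i\<in>UNIV. bump1 n (a $ i) (b $ i) (x $ i))"

lemma times_differentiable_bump1: "times_differentiable k (bump1 n a b)"
proof -
  have "times_differentiable k (\<lambda>t. (1 * flat 1 (n * t + - n * a)) * (1 * flat 1 (- n * t + n * b)))"
    by (intro times_differentiable_mult times_differentiable_affine times_differentiable_flat)
  then show ?thesis by (simp add: bump1_def[abs_def] algebra_simps)
qed

lemma flat_1_bounds: "0 \<le> flat 1 t" "flat 1 t \<le> 1"
  by (simp_all add: flat_def)

lemma bump1_bounds: "0 \<le> bump1 n a b t" "bump1 n a b t \<le> 1"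
  using flat_1_bounds by (auto simp: bump1_def mult_le_one)

lemma bump_bounds: "0 \<le> bump n a b x" "bump n a b x \<le> 1"
  unfolding bump_def by (intro prod_nonneg prod_le_1 ballI conjI bump1_bounds)+

lemma bump_pos_iff:
  assumes "n > 0" shows "bump n a b x \<noteq> 0 \<longleftrightarrow> x \<in> box a b"
proof -
  have "bump1 n (a $ i) (b $ i) (x $ i) \<noteq> 0 \<longleftrightarrow> a $ i < x $ i \<and> x $ i < b $ i" for i
    using assms by (auto simp: bump1_def flat_def zero_less_mult_iff)
  then show ?thesis by (auto simp: bump_def mem_box_cart)
qed

lemma bump_eq_0: "n > 0 \<Longrightarrow> x \<notin> box a b \<Longrightarrow> bump n a b x = 0"
  using bump_pos_iff by blast

lemma test_function_bump: 
  assumes "n > 0" shows "test_function (\<lambda>x. complex_of_real (bump n a b x))"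
proof -
  have "(\<lambda>x. complex_of_real (bump n a b x)) = tensor (\<lambda>i. bump1 n (a $ i) (b $ i))"
    by (simp add: tensor_def bump_def fun_eq_iff)
  moreover have "Ck k (tensor (\<lambda>i. bump1 n (a $ i) (b $ i)))" for k
    by (intro Ck_tensor times_differentiable_bump1)
  moreover have "x \<notin> cbox a b \<Longrightarrow> bump n a b x = 0" for x
    using bump_pos_iff[OF assms] box_subset_cbox by blast
  ultimately show ?thesis unfolding test_function_def by (auto intro!: exI[of _ "cbox a b"])
qed

lemma bump_tendsto_indicator:
  "(\<lambda>n. bump (real (Suc n)) a b x) \<longlonglongrightarrow> indicator (box a b) x"
proof -
  have "(\<lambda>n. flat 1 (real (Suc n) * s)) \<longlonglongrightarrow> (if s > 0 then 1 else 0)" for s :: real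
  proof (cases "s > 0")
    case True
    have "(\<lambda>n. exp (- (1 / s * (1 / real (Suc n))))) \<longlonglongrightarrow> exp (- (1 / s * 0))"
      by (intro tendsto_intros null_step_seq)
    then show ?thesis using True by (simp add: flat_def divide_simps mult.commute)
  next
    case False
    then show ?thesis by (simp add: flat_def zero_less_mult_iff)
  qed
  then have "(\<lambda>n. bump (real (Suc n)) a b x) \<longlonglongrightarrow>
      (\<Prod>i\<in>UNIV. (if x $ i - a $ i > 0 then 1 else 0) * (if b $ i - x $ i > 0 then 1 else 0))"
    unfolding bump_def bump1_def by (intro tendsto_intros)
  also have "(\<Prod>i\<in>UNIV. (if x $ i - a $ i > 0 then 1 else 0) * (if b $ i - x $ i > 0 then 1 else 0)) = (indicator (box a b) x :: real)"
    by (auto simp: indicator_def mem_box_cart)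
  finally show ?thesis .
qed

section \<open>The fundamental lemma of the calculus of variations\<close>

definition locally_integrable :: "(real^3 \<Rightarrow> complex) \<Rightarrow> bool" where
  "locally_integrable h \<longleftrightarrow> h \<in> borel_measurable borel \<and> (\<forall>a b. integrable lborel (\<lambda>x. indicator (box a b) x *\<^sub>R h x))"

text \<open>Bumps converge to indicators of boxes, so every box integral vanishes. Boxes form an
  intersection-stable generator of the Borel sets, so the integral over every Borel subset of a box
  vanishes too, and the function is zero almost everywhere on each box.\<close>

lemma AE_eq_0_if_weakly_0:
  assumes h: "locally_integrable h" and z: "\<And>\<phi>. test_function \<phi> \<Longrightarrow> (LBINT x. h x * \<phi> x) = 0"
  shows "AE x in lborel. h x = 0"
proof -
  have [measurable]: "h \<in> borel_measurable borel" using h by (simp add: locally_integrable_def)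
  have ib: "integrable lborel (\<lambda>x. indicator (box a b) x *\<^sub>R h x)" for a b
    using h by (simp add: locally_integrable_def)
  have box0: "(LBINT x. indicator (box a b) x *\<^sub>R h x) = 0" for a b
  proof -
    have "(\<lambda>n. LBINT x. h x * of_real (bump (real (Suc n)) a b x)) \<longlonglongrightarrow> (LBINT x. h x * of_real (indicator (box a b) x))"
    proof (rule integral_dominated_convergence[where w="\<lambda>x. norm (indicator (box a b) x *\<^sub>R h x)"])
      fix n
      have "continuous_on UNIV (\<lambda>x. complex_of_real (bump (real (Suc n)) a b x))"
        by (rule has_partialsD(1)[OF test_function_has_partials[OF test_function_bump]]) simp
      then have [measurable]: "(\<lambda>x. complex_of_real (bump (real (Suc n)) a b x)) \<in> borel_measurable borel"
        by (rule borel_measurable_continuous_onI)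
      show "(\<lambda>x. h x * of_real (bump (real (Suc n)) a b x)) \<in> borel_measurable lborel" by measurable
      show "AE x in lborel. norm (h x * of_real (bump (real (Suc n)) a b x)) \<le> norm (indicator (box a b) x *\<^sub>R h x)"
        using bump_eq_0[of "real (Suc n)" _ a b] bump_bounds[of "real (Suc n)" a b]
        by (intro AE_I2) (auto simp: norm_mult indicator_def mult_left_le)
      show "integrable lborel (\<lambda>x. norm (indicator (box a b) x *\<^sub>R h x))"
        by (rule integrable_norm[OF ib])
      show "AE x in lborel. (\<lambda>n. h x * of_real (bump (real (Suc n)) a b x)) \<longlonglongrightarrow> h x * of_real (indicator (box a b) x)"
        by (intro AE_I2 tendsto_mult tendsto_const tendsto_of_real bump_tendsto_indicator)
    qed simp
    moreover have "(LBINT x. h x * of_real (bump (real (Suc n)) a b x)) = 0" for n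
      by (intro z test_function_bump) auto
    ultimately show ?thesis by (simp add: LIMSEQ_const_iff scaleR_conv_of_real mult.commute)
  qed
  have "AE x in lborel. indicator (box a b) x *\<^sub>R h x = 0" for a b
  proof (rule sigma_finite_measure.density_zero[OF sigma_finite_lborel ib])
    let ?g = "\<lambda>x. indicator (box a b) x *\<^sub>R h x"
    have si: "set_integrable lborel A ?g" if "A \<in> sets borel" for A
      using integrable_mult_indicator[OF _ ib, of A] that by (simp add: set_integrable_def)
    have UNIV0: "set_lebesgue_integral lborel UNIV ?g = 0" using box0 by (simp add: set_lebesgue_integral_def)
    fix A :: "(real^3) set" assume "A \<in> sets lborel"
    then have A: "A \<in> sigma_sets UNIV (range (\<lambda>(a, b). box a b))" by (simp add: borel_eq_box)
    have stable: "Int_stable (range (\<lambda>(a, b). box a b :: (real^3) set))"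
      by (auto simp: Int_stable_def box_Int_box)
    show "set_lebesgue_integral lborel A ?g = 0"
    \<comment> \<open>Dynkin's argument: intersections of boxes are boxes, complements use that the
      integral over \<open>box a b\<close> itself is zero, disjoint unions use countable
      additivity.\<close>
    proof (rule sigma_sets_induct_disjoint[OF stable _ A, where P="\<lambda>A. set_lebesgue_integral lborel A ?g = 0"])
      fix A :: "(real^3) set" assume "A \<in> range (\<lambda>(a, b). box a b)"
      then obtain c d where A: "A = box c d" by auto
      obtain e f where ef: "box c d \<inter> box a b = (box e f :: (real^3) set)"
        by (rule that[OF box_Int_box])
      have "indicator A x *\<^sub>R ?g x = indicator (box e f) x *\<^sub>R h x" for x
        unfolding A ef[symmetric] indicator_inter_arith by simp
      then show "set_lebesgue_integral lborel A ?g = 0" unfolding set_lebesgue_integral_def by (simp only: box0)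
    next
      fix A :: "(real^3) set" assume "A \<in> sigma_sets UNIV (range (\<lambda>(a, b). box a b))"
        and A0: "set_lebesgue_integral lborel A ?g = 0"
      from this(1) have A: "A \<in> sets borel" by (simp add: borel_eq_box)
      have "set_lebesgue_integral lborel (A \<union> (UNIV - A)) ?g
          = set_lebesgue_integral lborel A ?g + set_lebesgue_integral lborel (UNIV - A) ?g"
        by (rule set_integral_Un[OF _ si[OF A] si]) (use A in auto)
      then show "set_lebesgue_integral lborel (UNIV - A) ?g = 0" unfolding A0 using UNIV0 by simp
    next
      fix A :: "nat \<Rightarrow> (real^3) set"
      assume dj: "disjoint_family A" and rA: "range A \<subseteq> sigma_sets UNIV (range (\<lambda>(a, b). box a b))"
        and A0: "\<And>i. set_lebesgue_integral lborel (A i) ?g = 0"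
      from rA have A: "A i \<in> sets borel" for i by (auto simp: borel_eq_box)
      have "set_lebesgue_integral lborel (\<Union>i. A i) ?g = (\<Sum>i. set_lebesgue_integral lborel (A i) ?g)"
        by (rule lebesgue_integral_countable_add[OF _ _ si]) (use A dj in \<open>auto simp: disjoint_family_on_def\<close>)
      also have "\<dots> = 0" unfolding A0 by simp
      finally show "set_lebesgue_integral lborel (\<Union>i. A i) ?g = 0" .
    qed (auto simp: set_lebesgue_integral_def)
  qed
  then have "AE x in lborel. \<forall>n::nat. indicator (box (- (real n *\<^sub>R One)) (real n *\<^sub>R One)) x *\<^sub>R h x = 0"
    unfolding AE_all_countable by blast
  then show ?thesis
  proof eventually_elim
    case (elim x)
    have "x \<in> (\<Union>n::nat. box (- (real n *\<^sub>R One)) (real n *\<^sub>R One))"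
      using UN_box_eq_UNIV by blast
    then show ?case using elim by (auto simp: indicator_def)
  qed
qed

section \<open>Covariant gradients\<close>

lemma Lp_norm_powr:
  assumes "p > 0" shows "Lp_norm p f powr p = (LBINT x. norm (f x) powr p)"
proof -
  have "0 \<le> (LBINT x. norm (f x) powr p)" by (rule Bochner_Integration.integral_nonneg) auto
  then show ?thesis using assms by (simp add: Lp_norm_def powr_powr)
qed

lemma Lp_2_iff:
  "f \<in> Lp 2 \<longleftrightarrow> f \<in> borel_measurable borel \<and> integrable lborel (\<lambda>x. (norm (f x))\<^sup>2)"
  by (simp add: Lp_def)

lemma Lp_norm_2: "(Lp_norm 2 f)\<^sup>2 = (LBINT x. (norm (f x))\<^sup>2)"
proof -
  have "0 \<le> (LBINT x. (norm (f x))\<^sup>2)" by (rule Bochner_Integration.integral_nonneg) auto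
  then show ?thesis by (simp add: Lp_norm_def powr_half_sqrt)
qed

lemma mass_eq: "mass f = (LBINT x. (norm (f x))\<^sup>2)"
  by (simp add: mass_def Lp_norm_2)

lemma energy_eq:
  assumes "\<alpha> > 0"
  shows "energy b \<alpha> f = 1 / 2 * (LBINT x. (norm (cov_gradient (magnetic_potential b) f x))\<^sup>2)
     - 1 / (\<alpha> + 2) * (LBINT x. norm (f x) powr (\<alpha> + 2))"
  using assms by (simp add: energy_def Lp_norm_2 Lp_norm_powr)

lemma norm_vec_squared: "(norm (v :: 'a::real_normed_vector ^ 'n))\<^sup>2 = (\<Sum>j\<in>UNIV. (norm (v $ j))\<^sup>2)"
  by (simp add: norm_vec_def L2_set_def sum_nonneg)

lemma locally_integrable_continuous:
  assumes "continuous_on UNIV h" shows "locally_integrable h"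
  unfolding locally_integrable_def
proof (intro conjI allI)
  show m: "h \<in> borel_measurable borel" using assms by (rule borel_measurable_continuous_onI)
  fix a b
  have "integrable lborel (\<lambda>x. indicator (box a b) x *\<^sub>R (indicator (cbox a b) x *\<^sub>R h x))"
    using assms by (intro integrable_mult_indicator borel_integrable_compact)
      (auto intro: continuous_on_subset)
  also have "(\<lambda>x. indicator (box a b) x *\<^sub>R (indicator (cbox a b) x *\<^sub>R h x)) = (\<lambda>x. indicator (box a b) x *\<^sub>R h x)"
    using box_subset_cbox[of a b] by (auto simp: fun_eq_iff indicator_def)
  finally show "integrable lborel (\<lambda>x. indicator (box a b) x *\<^sub>R h x)" .
qed

lemma locally_integrable_square:
  assumes [measurable]: "h \<in> borel_measurable borel" and "integrable lborel (\<lambda>x. (norm (h x))\<^sup>2)"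
  shows "locally_integrable h"
  unfolding locally_integrable_def
proof (intro conjI allI assms(1))
  fix a b :: "real^3"
  show "integrable lborel (\<lambda>x. indicator (box a b) x *\<^sub>R h x)"
  proof (rule Bochner_Integration.integrable_bound)
    show "integrable lborel (\<lambda>x. indicator (box a b) x + (norm (h x))\<^sup>2)"
      by (intro Bochner_Integration.integrable_add assms) (auto intro!: emeasure_bounded_finite)
    have "y \<le> 1 + y\<^sup>2" for y :: real
      using sum_squares_ge_zero[of "y - 1/2" "0"] by (simp add: power2_eq_square algebra_simps)
    then show "AE x in lborel. norm (indicator (box a b) x *\<^sub>R h x) \<le> norm (indicator (box a b) x + (norm (h x))\<^sup>2)"
      by (auto simp: indicator_def)
  qed auto
qed

lemma locally_integrable_mult_test:
  assumes h: "locally_integrable h" and c: "continuous_on UNIV \<phi>" and cs: "compactly_supported \<phi>"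
  shows "integrable lborel (\<lambda>x. h x * \<phi> x)"
proof -
  obtain R where R: "R > 0" "\<And>x. R < norm x \<Longrightarrow> \<phi> x = 0" using cs by (rule compactly_supportedE) blast
  obtain B where B: "B > 0" "\<And>x. norm (\<phi> x) \<le> B" using c cs by (rule compactly_supported_bounded) blast
  obtain a where a: "cball 0 R \<subseteq> box (- a) (a :: real^3)" using bounded_subset_box_symmetric[OF bounded_cball] by metis
  have [measurable]: "h \<in> borel_measurable borel" using h by (simp add: locally_integrable_def)
  have [measurable]: "\<phi> \<in> borel_measurable borel" using c by (rule borel_measurable_continuous_onI)
  show ?thesis
  proof (rule Bochner_Integration.integrable_bound)
    show "integrable lborel (\<lambda>x. B * norm (indicator (box (- a) a) x *\<^sub>R h x))"
      using h by (intro integrable_mult_right integrable_norm) (simp add: locally_integrable_def)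
    show "AE x in lborel. norm (h x * \<phi> x) \<le> norm (B * norm (indicator (box (- a) a) x *\<^sub>R h x))"
    proof (intro AE_I2)
      fix x show "norm (h x * \<phi> x) \<le> norm (B * norm (indicator (box (- a) a) x *\<^sub>R h x))"
      proof (cases "norm x \<le> R")
        case True
        then have "x \<in> box (- a) a" using a by auto
        then show ?thesis using B(2)[of x] B(1) by (simp add: norm_mult mult.commute mult_right_mono)
      next
        case False
        then show ?thesis using R(2)[of x] by simp
      qed
    qed
  qed auto
qed

lemma Lp_2_component:
  assumes "g \<in> Lp 2" shows "locally_integrable (\<lambda>x. g x $ j :: complex)"
proof (rule locally_integrable_square)
  have [measurable]: "g \<in> borel_measurable borel" using assms by (simp add: Lp_2_iff)
  show m[measurable]: "(\<lambda>x. g x $ j) \<in> borel_measurable borel"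
    by (rule borel_measurable_continuous_on[of "\<lambda>v. v $ j"]) (auto intro!: continuous_intros)
  show "integrable lborel (\<lambda>x. (norm (g x $ j))\<^sup>2)"
  proof (rule Bochner_Integration.integrable_bound)
    show "integrable lborel (\<lambda>x. (norm (g x))\<^sup>2)" using assms by (simp add: Lp_2_iff)
    show "AE x in lborel. norm ((norm (g x $ j))\<^sup>2) \<le> norm ((norm (g x))\<^sup>2)"
      by (auto intro!: power_mono component_le_norm_cart Finite_Cartesian_Product.norm_nth_le)
  qed simp
qed

text \<open>The weak identity fixes the integrals of each component against test functions in terms
  of \<open>A\<close> and \<open>f\<close> alone, so the difference of two weak gradients is weakly
  zero.\<close>

lemma weak_cov_gradient_unique:
  assumes g: "weak_cov_gradient A f g" and h: "weak_cov_gradient A f h"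
    and lg: "\<And>j. locally_integrable (\<lambda>x. g x $ j)" and lh: "\<And>j. locally_integrable (\<lambda>x. h x $ j)"
  shows "AE x in lborel. g x = h x"
proof -
  have "AE x in lborel. g x $ j - h x $ j = 0" for j
  proof (rule AE_eq_0_if_weakly_0)
    show "locally_integrable (\<lambda>x. g x $ j - h x $ j)"
      using lg[of j] lh[of j] unfolding locally_integrable_def by (auto simp: scaleR_diff_right)
    fix \<phi> :: "real^3 \<Rightarrow> complex" assume t: "test_function \<phi>"
    note c = has_partialsD(1)[OF test_function_has_partials[OF t]]
    have "(LBINT x. (g x $ j - h x $ j) * \<phi> x) = (LBINT x. g x $ j * \<phi> x - h x $ j * \<phi> x)"
      by (simp add: left_diff_distrib)
    also have "\<dots> = (LBINT x. g x $ j * \<phi> x) - (LBINT x. h x $ j * \<phi> x)"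
      by (intro Bochner_Integration.integral_diff locally_integrable_mult_test lg lh c
          test_function_compactly_supported t)
    also have "\<dots> = 0" using g h t by (simp add: weak_cov_gradient_def)
    finally show "(LBINT x. (g x $ j - h x $ j) * \<phi> x) = 0" .
  qed
  then have "AE x in lborel. \<forall>j. g x $ j - h x $ j = 0" by (simp add: AE_all_countable)
  then show ?thesis by eventually_elim (simp add: vec_eq_iff)
qed

section \<open>Classical covariant gradients\<close>

definition classical_cov_gradient ::
    "(real^3 \<Rightarrow> real^3) \<Rightarrow> (real^3 \<Rightarrow> complex) \<Rightarrow> (3 \<Rightarrow> real^3 \<Rightarrow> complex) \<Rightarrow> real^3 \<Rightarrow> complex^3" where
  "classical_cov_gradient A f F x = (\<chi> j. F j x + \<i> * of_real (A x $ j) * f x)"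

lemma classical_cov_gradient_nth [simp]:
  "classical_cov_gradient A f F x $ j = F j x + \<i> * of_real (A x $ j) * f x"
  by (simp add: classical_cov_gradient_def)

lemma magnetic_potential_nth [simp]:
  "magnetic_potential b x $ 1 = - (b / 2 * x $ 2)"
  "magnetic_potential b x $ 2 = b / 2 * x $ 1"
  "magnetic_potential b x $ 3 = 0"
  by (simp_all add: magnetic_potential_def)

lemma continuous_on_magnetic_potential: "continuous_on UNIV (\<lambda>x. magnetic_potential b x $ j)"
proof -
  have "continuous_on UNIV (\<lambda>x. - (b / 2 * x $ 2))" "continuous_on UNIV (\<lambda>x::real^3. b / 2 * x $ 1)"
    by (intro continuous_intros)+
  then show ?thesis using exhaust_3[of j] by auto
qed

lemma continuous_on_classical_cov_gradient:
  assumes f: "has_partials f F" and A: "\<And>j. continuous_on UNIV (\<lambda>x. A x $ j)"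
  shows "continuous_on UNIV (classical_cov_gradient A f F)"
  unfolding classical_cov_gradient_def[abs_def]
  by (intro continuous_on_vec_lambda continuous_intros has_partialsD[OF f] A)

lemma weak_cov_gradient_classical:
  assumes f: "has_partials f F" and A: "\<And>j. continuous_on UNIV (\<lambda>x. A x $ j)"
  shows "weak_cov_gradient A f (classical_cov_gradient A f F)"
  unfolding weak_cov_gradient_def
proof (intro allI impI)
  fix \<phi> :: "real^3 \<Rightarrow> complex" and j assume t: "test_function \<phi>"
  note p = test_function_has_partials[OF t] and cs = test_function_compactly_supported[OF t]
  note c = has_partialsD(1,2)[OF f] has_partialsD(1,2)[OF p] A
  have i: "integrable lborel (\<lambda>x. F j x * \<phi> x)" "integrable lborel (\<lambda>x. f x * partial j \<phi> x)"
    "integrable lborel (\<lambda>x. \<i> * of_real (A x $ j) * f x * \<phi> x)"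
    using cs has_partials_compactly_supported[OF p cs]
    by (auto intro!: integrable_compactly_supported continuous_intros c compactly_supported_mult(2))
  have "(LBINT x. classical_cov_gradient A f F x $ j * \<phi> x)
      = (LBINT x. F j x * \<phi> x + \<i> * of_real (A x $ j) * f x * \<phi> x)"
    by (simp add: ring_distribs)
  also have "\<dots> = - (LBINT x. f x * partial j \<phi> x) + (LBINT x. \<i> * of_real (A x $ j) * f x * \<phi> x)"
    using i integration_by_parts[OF f p cs] by simp
  also have "\<dots> = (LBINT x. - (f x * partial j \<phi> x) + \<i> * of_real (A x $ j) * f x * \<phi> x)"
    using i by simp
  also have "\<dots> = (LBINT x. f x * (- partial j \<phi> x + \<i> * of_real (A x $ j) * \<phi> x))"
    by (simp add: ring_distribs mult_ac)
  finally show "(LBINT x. classical_cov_gradient A f F x $ j * \<phi> x) =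
      (LBINT x. f x * (- partial j \<phi> x + \<i> * of_real (A x $ j) * \<phi> x))" .
qed

lemma cov_gradient_props:
  assumes "f \<in> H1 A" shows "cov_gradient A f \<in> Lp 2" "weak_cov_gradient A f (cov_gradient A f)"
proof -
  have "\<exists>g. g \<in> Lp 2 \<and> weak_cov_gradient A f g" using assms by (auto simp: H1_def)
  from someI_ex[OF this] show "cov_gradient A f \<in> Lp 2" "weak_cov_gradient A f (cov_gradient A f)"
    by (simp_all add: cov_gradient_def)
qed

text \<open>\<open>cov_gradient\<close> is an arbitrary choice among weak gradients; uniqueness ties
  it to the computable expression. This is how energies of trial functions become explicit
  integrals.\<close>

lemma cov_gradient_classical:
  assumes f: "has_partials f F" and A: "\<And>j. continuous_on UNIV (\<lambda>x. A x $ j)" and H: "f \<in> H1 A"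
  shows "AE x in lborel. cov_gradient A f x = classical_cov_gradient A f F x"
proof (rule weak_cov_gradient_unique[where f=f and A=A])
  show "locally_integrable (\<lambda>x. classical_cov_gradient A f F x $ j)" for j
    unfolding classical_cov_gradient_nth
    by (intro locally_integrable_continuous continuous_intros has_partialsD[OF f] A)
  show "locally_integrable (\<lambda>x. cov_gradient A f x $ j)" for j
    by (intro Lp_2_component cov_gradient_props H)
qed (intro cov_gradient_props weak_cov_gradient_classical assms)+

lemma Lp_2_compactly_supported:
  fixes f :: "real^3 \<Rightarrow> 'b::euclidean_space"
  assumes "continuous_on UNIV f" "compactly_supported f" shows "f \<in> Lp 2"
  unfolding Lp_2_iff
proof
  show "f \<in> borel_measurable borel" using assms(1) by (rule borel_measurable_continuous_onI)
  show "integrable lborel (\<lambda>x. (norm (f x))\<^sup>2)"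
    using assms by (intro integrable_compactly_supported continuous_intros)
      (auto elim: compactly_supported_comp)
qed

lemma classical_H1:
  assumes f: "has_partials f F" and A: "\<And>j. continuous_on UNIV (\<lambda>x. A x $ j)" and cs: "compactly_supported f"
  shows "f \<in> H1 A"
proof -
  have "classical_cov_gradient A f F \<in> Lp 2"
  proof (rule Lp_2_compactly_supported)
    obtain R where R: "\<And>x. R < norm x \<Longrightarrow> f x = 0" using cs by (auto simp: compactly_supported_def)
    have "classical_cov_gradient A f F x = 0" if "R < norm x" for x
      using R[OF that] has_partials_support[OF f R that] by (simp add: vec_eq_iff)
    then show "compactly_supported (classical_cov_gradient A f F)" unfolding compactly_supported_def by blast
  qed (rule continuous_on_classical_cov_gradient[OF f A])
  moreover have "f \<in> Lp 2" by (rule Lp_2_compactly_supported[OF has_partialsD(1)[OF f] cs])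
  ultimately show ?thesis using weak_cov_gradient_classical[OF f A] by (auto simp: H1_def)
qed

section \<open>Concentrating trial functions\<close>

lemma has_partials_dilation:
  assumes "has_partials f F"
  shows "has_partials (\<lambda>x. f (c *\<^sub>R x)) (\<lambda>j x. c *\<^sub>R F j (c *\<^sub>R x))"
  unfolding has_partials_def
proof (intro conjI allI)
  show "continuous_on UNIV (\<lambda>x. f (c *\<^sub>R x))"
    by (rule continuous_on_compose2[OF has_partialsD(1)[OF assms]]) (auto intro!: continuous_intros)
  fix j show "continuous_on UNIV (\<lambda>x. c *\<^sub>R F j (c *\<^sub>R x))"
    by (intro continuous_on_scaleR continuous_on_const continuous_on_compose2[OF has_partialsD(2)[OF assms]])
       (auto intro!: continuous_intros)
  fix x
  have "((\<lambda>t. f (c *\<^sub>R x + t *\<^sub>R axis j 1)) has_vector_derivative F j (c *\<^sub>R x)) (at (c * 0))"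
    using has_partialsD(3)[OF assms, of "c *\<^sub>R x" j] by simp
  then have "((\<lambda>t. f (c *\<^sub>R x + t *\<^sub>R axis j 1)) \<circ> (\<lambda>t. c * t) has_vector_derivative c *\<^sub>R F j (c *\<^sub>R x)) (at 0)"
    by (intro vector_diff_chain_at) (auto intro!: derivative_eq_intros)
  then show "((\<lambda>t. f (c *\<^sub>R (x + t *\<^sub>R axis j 1))) has_vector_derivative c *\<^sub>R F j (c *\<^sub>R x)) (at 0)"
    by (simp add: o_def algebra_simps)
qed

lemma compactly_supported_dilation:
  assumes "compactly_supported f" "c > 0"
  shows "compactly_supported (\<lambda>x. f (c *\<^sub>R x))"
proof -
  obtain R where R: "\<And>x. R < norm x \<Longrightarrow> f x = 0" using assms by (auto simp: compactly_supported_def)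
  have "f (c *\<^sub>R x) = 0" if "R / c < norm x" for x
    using that assms(2) by (intro R) (simp add: field_simps)
  then show ?thesis unfolding compactly_supported_def by blast
qed

text \<open>For a real function the gradient is the real part and the potential term the imaginary
  part, so there is no cross term and the potential acts as a confining weight.\<close>

lemma norm_classical_cov_gradient_real:
  "(norm (classical_cov_gradient A (\<lambda>x. complex_of_real (h x)) (\<lambda>j x. complex_of_real (H j x)) x))\<^sup>2
     = (\<Sum>j\<in>UNIV. (H j x)\<^sup>2) + (norm (A x))\<^sup>2 * (h x)\<^sup>2"
  by (simp add: norm_vec_squared cmod_power2 sum.distrib sum_distrib_right power_mult_distrib)

lemma magnetic_potential_scaleR: "magnetic_potential b (c *\<^sub>R x) = c *\<^sub>R magnetic_potential b x"
  by (simp add: vec_eq_iff forall_3)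

lemma energy_classical:
  fixes b :: real
  assumes "\<alpha> > 0" and f: "has_partials f F" and cs: "compactly_supported f"
  defines "A \<equiv> magnetic_potential b"
  shows "f \<in> H1 A" "energy b \<alpha> f = 1 / 2 * (LBINT x. (norm (classical_cov_gradient A f F x))\<^sup>2)
     - 1 / (\<alpha> + 2) * (LBINT x. norm (f x) powr (\<alpha> + 2))"
proof -
  have A: "continuous_on UNIV (\<lambda>x. A x $ j)" for j
    unfolding A_def by (rule continuous_on_magnetic_potential)
  show H: "f \<in> H1 A" by (rule classical_H1[OF f A cs])
  have [measurable]: "cov_gradient A f \<in> borel_measurable borel"
    using cov_gradient_props(1)[OF H] by (simp add: Lp_2_iff)
  have [measurable]: "classical_cov_gradient A f F \<in> borel_measurable borel"
    by (intro borel_measurable_continuous_onI continuous_on_classical_cov_gradient[OF f A])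
  have "(LBINT x. (norm (cov_gradient A f x))\<^sup>2) = (LBINT x. (norm (classical_cov_gradient A f F x))\<^sup>2)"
    by (rule integral_cong_AE) (use cov_gradient_classical[OF f A H] in \<open>auto\<close>)
  then show "energy b \<alpha> f = 1 / 2 * (LBINT x. (norm (classical_cov_gradient A f F x))\<^sup>2)
     - 1 / (\<alpha> + 2) * (LBINT x. norm (f x) powr (\<alpha> + 2))"
    unfolding energy_eq[OF \<open>\<alpha> > 0\<close>] A_def by simp
qed

text \<open>The argument is the family of partial derivatives and not the function, because
  regularity is carried by the pair in \<open>has_partials\<close>.\<close>

definition kinetic :: "(3 \<Rightarrow> real^3 \<Rightarrow> real) \<Rightarrow> real" where
  "kinetic H = (LBINT x. (\<Sum>j\<in>UNIV. (H j x)\<^sup>2))"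

definition confinement :: "real \<Rightarrow> (real^3 \<Rightarrow> real) \<Rightarrow> real" where
  "confinement b h = (LBINT x. (norm (magnetic_potential b x))\<^sup>2 * (h x)\<^sup>2)"

lemma continuous_on_norm_magnetic_potential: "continuous_on UNIV (\<lambda>x. (norm (magnetic_potential b x))\<^sup>2)"
  unfolding norm_vec_squared by (intro continuous_intros continuous_on_magnetic_potential)

text \<open>The trial function is \<open>x \<mapsto> s \<lambda>\<^bsup>3/2\<^esup> h(\<lambda>x)\<close>, with \<open>s\<close> fixed by the mass.\<close>

lemma min_energy_le_concentration:
  assumes "\<alpha> > 0" "c > 0" "l > 0" and h: "has_partials h H" and cs: "compactly_supported h"
    and m: "(LBINT x. (h x)\<^sup>2) > 0"
  defines "S \<equiv> c / (LBINT x. (h x)\<^sup>2)"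
  shows "min_energy b \<alpha> c \<le> ereal (S / 2 * (l\<^sup>2 * kinetic H + confinement b h / l\<^sup>2)
    - S powr ((\<alpha> + 2) / 2) * l powr (3 * \<alpha> / 2) * (LBINT x. \<bar>h x\<bar> powr (\<alpha> + 2)) / (\<alpha> + 2))"
proof -
  let ?M = "LBINT x. (h x)\<^sup>2"
  \<comment> \<open>In the squared amplitude, l^3 offsets the Jacobian of the dilation and S
    rescales the mass of \<open>h\<close> to c.\<close>
  define k where "k = sqrt (S * l ^ 3)"
  have S: "S > 0" using assms by (simp add: S_def)
  have k: "k > 0" "k\<^sup>2 = S * l ^ 3" using S \<open>l > 0\<close> by (auto simp: k_def)
  define f where "f = (\<lambda>x. complex_of_real (k * h (l *\<^sub>R x)))"
  define F where "F = (\<lambda>j x. complex_of_real (k * (l * H j (l *\<^sub>R x))))"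
  note c = has_partialsD(1,2)[OF h]
  have f: "has_partials f F"
    unfolding f_def F_def
    using has_partials_linear[OF bounded_linear_compose[OF bounded_linear_of_real bounded_linear_mult_right]
        has_partials_dilation[OF h, of l], of k] by simp
  have csf: "compactly_supported f"
    by (rule compactly_supported_comp[OF compactly_supported_dilation[OF cs \<open>l > 0\<close>]]) (simp add: f_def)
  note E = energy_classical[OF \<open>\<alpha> > 0\<close> f csf, of b]
  have dil: "(LBINT x. g (l *\<^sub>R x)) = (LBINT x. g x) / l ^ 3"
    if "g \<in> borel_measurable borel" for g :: "real^3 \<Rightarrow> real"
    using lborel_integral_scaleR[OF that, of l] \<open>l > 0\<close> by simp
  have mh[measurable]: "h \<in> borel_measurable borel" "\<And>j. H j \<in> borel_measurable borel"
    by (auto intro!: borel_measurable_continuous_onI c)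
  have mA[measurable]: "(\<lambda>x. (norm (magnetic_potential b x))\<^sup>2) \<in> borel_measurable borel"
    by (rule borel_measurable_continuous_onI[OF continuous_on_norm_magnetic_potential])
  have mass: "mass f = c"
  proof -
    have "mass f = (LBINT x. k\<^sup>2 * (h (l *\<^sub>R x))\<^sup>2)"
      by (simp add: mass_eq f_def norm_mult power_mult_distrib)
    also have "\<dots> = k\<^sup>2 * (?M / l ^ 3)" using dil[of "\<lambda>x. (h x)\<^sup>2"] by simp
    also have "\<dots> = c" using k \<open>l > 0\<close> m by (simp add: S_def)
    finally show ?thesis .
  qed
  have iK: "integrable lborel (\<lambda>x. \<Sum>j\<in>UNIV. (H j x)\<^sup>2)"
    by (intro Bochner_Integration.integrable_sum integrable_compactly_supported continuous_intros c
        compactly_supported_comp[OF has_partials_compactly_supported[OF h cs]]) simp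
  have iW: "integrable lborel (\<lambda>x. (norm (magnetic_potential b x))\<^sup>2 * (h x)\<^sup>2)"
    using cs by (intro integrable_compactly_supported continuous_on_mult continuous_on_power
        continuous_on_norm_magnetic_potential[unfolded power2_eq_square] continuous_on_norm_magnetic_potential c)
       (auto elim: compactly_supported_comp)
  have kin: "(LBINT x. (norm (classical_cov_gradient (magnetic_potential b) f F x))\<^sup>2)
      = S * (l\<^sup>2 * kinetic H + confinement b h / l\<^sup>2)"
  proof -
    have "(norm (classical_cov_gradient (magnetic_potential b) f F x))\<^sup>2
        = k\<^sup>2 * (l\<^sup>2 * (\<Sum>j\<in>UNIV. (H j (l *\<^sub>R x))\<^sup>2)
            + ((norm (magnetic_potential b (l *\<^sub>R x)))\<^sup>2 * (h (l *\<^sub>R x))\<^sup>2) / l\<^sup>2)" for x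
      unfolding f_def F_def norm_classical_cov_gradient_real magnetic_potential_scaleR
      using \<open>l > 0\<close> by (simp add: power_mult_distrib sum_distrib_left distrib_left mult_ac)
    then have "(LBINT x. (norm (classical_cov_gradient (magnetic_potential b) f F x))\<^sup>2)
        = (LBINT x. k\<^sup>2 * (l\<^sup>2 * (\<Sum>j\<in>UNIV. (H j (l *\<^sub>R x))\<^sup>2)
            + ((norm (magnetic_potential b (l *\<^sub>R x)))\<^sup>2 * (h (l *\<^sub>R x))\<^sup>2) / l\<^sup>2))" by simp
    also have "\<dots> = (LBINT x. k\<^sup>2 * (l\<^sup>2 * (\<Sum>j\<in>UNIV. (H j x)\<^sup>2)
            + ((norm (magnetic_potential b x))\<^sup>2 * (h x)\<^sup>2) / l\<^sup>2)) / l ^ 3"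
      by (rule dil[of "\<lambda>x. k\<^sup>2 * (l\<^sup>2 * (\<Sum>j\<in>UNIV. (H j x)\<^sup>2)
            + ((norm (magnetic_potential b x))\<^sup>2 * (h x)\<^sup>2) / l\<^sup>2)"]) measurable
    also have "\<dots> = k\<^sup>2 * (l\<^sup>2 * kinetic H + confinement b h / l\<^sup>2) / l ^ 3"
      using iK iW by (simp add: kinetic_def confinement_def)
    also have "\<dots> = S * (l\<^sup>2 * kinetic H + confinement b h / l\<^sup>2)"
      using k \<open>l > 0\<close> by simp
    finally show ?thesis .
  qed
  have pot: "(LBINT x. norm (f x) powr (\<alpha> + 2))
      = S powr ((\<alpha> + 2) / 2) * l powr (3 * \<alpha> / 2) * (LBINT x. \<bar>h x\<bar> powr (\<alpha> + 2))"
  proof -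
    have "(LBINT x. norm (f x) powr (\<alpha> + 2)) = (LBINT x. k powr (\<alpha> + 2) * \<bar>h (l *\<^sub>R x)\<bar> powr (\<alpha> + 2))"
      using k by (simp add: f_def norm_mult powr_mult)
    also have "\<dots> = k powr (\<alpha> + 2) * (LBINT x. \<bar>h x\<bar> powr (\<alpha> + 2)) / l ^ 3"
      using dil[of "\<lambda>x. \<bar>h x\<bar> powr (\<alpha> + 2)"] by simp
    \<comment> \<open>The power (\<alpha> + 2)/2 falls on l^3; after the Jacobian l^(-3), the power
      3\<alpha>/2 of l remains.\<close>
    also have "k powr (\<alpha> + 2) = S powr ((\<alpha> + 2) / 2) * (l powr (3 * \<alpha> / 2) * l ^ 3)"
    proof -
      have "k = (S * l powr 3) powr (1 / 2)" using \<open>l > 0\<close> S by (simp add: k_def powr_half_sqrt)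
      then have "k powr (\<alpha> + 2) = S powr ((\<alpha> + 2) / 2) * l powr (3 * (\<alpha> + 2) / 2)"
        using S \<open>l > 0\<close> by (simp add: powr_mult powr_powr del: powr_numeral)
      also have "3 * (\<alpha> + 2) / 2 = 3 * \<alpha> / 2 + 3" by (simp add: field_simps)
      also have "l powr (3 * \<alpha> / 2 + 3) = l powr (3 * \<alpha> / 2) * l ^ 3"
        using \<open>l > 0\<close> by (simp add: powr_add)
      finally show ?thesis .
    qed
    finally show ?thesis using \<open>l > 0\<close> by simp
  qed
  have "min_energy b \<alpha> c \<le> ereal (energy b \<alpha> f)"
    unfolding min_energy_def using E(1) mass by (intro INF_lower) (simp add: mass_sphere_def)
  also have "energy b \<alpha> f = S / 2 * (l\<^sup>2 * kinetic H + confinement b h / l\<^sup>2)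
    - S powr ((\<alpha> + 2) / 2) * l powr (3 * \<alpha> / 2) * (LBINT x. \<bar>h x\<bar> powr (\<alpha> + 2)) / (\<alpha> + 2)"
    unfolding E(2) kin pot by simp
  finally show ?thesis .
qed

lemma ereal_eq_MInfty_if_tendsto_at_bot:
  assumes "\<And>l. l > (0::real) \<Longrightarrow> x \<le> ereal (g l)" and "filterlim g at_bot at_top"
  shows "x = -\<infinity>"
proof (rule ereal_bot)
  fix B :: real
  have "\<forall>\<^sub>F l in at_top. g l \<le> B" using assms(2) by (simp add: filterlim_at_bot)
  then have "\<forall>\<^sub>F l in at_top. g l \<le> B \<and> l > 0"
    using eventually_gt_at_top by (rule eventually_conj)
  then obtain l where l: "g l \<le> B" "l > 0"
    using eventually_happens'[OF trivial_limit_at_top_linorder] by blast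
  then have "ereal (g l) \<le> ereal B" by simp
  with assms(1)[OF l(2)] show "x \<le> ereal B" by (rule order_trans)
qed

lemma filterlim_powr_at_top:
  assumes "d > 0" shows "filterlim (\<lambda>l::real. l powr d) at_top at_top"
proof (rule filterlim_mono_eventually[OF _ order_refl order_refl])
  show "filterlim (\<lambda>l::real. exp (d * ln l)) at_top at_top"
    by (intro filterlim_compose[OF exp_at_top] filterlim_tendsto_pos_mult_at_top[OF tendsto_const assms] ln_at_top)
  show "\<forall>\<^sub>F l::real in at_top. exp (d * ln l) = l powr d"
    using eventually_gt_at_top[of 0] by eventually_elim (simp add: powr_def)
qed

text \<open>The nonlinear power 3\<alpha>/2 of l exceeds the kinetic power 2 exactly when \<alpha> >
  4/3, so the bound of \<open>min_energy_le_concentration\<close> tends to minus infinity.\<close>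

lemma min_energy_supercritical:
  assumes "4 / 3 < \<alpha>" "c > 0" and h: "has_partials h H" and cs: "compactly_supported h"
    and m: "(LBINT x. (h x)\<^sup>2) > 0" and P: "(LBINT x. \<bar>h x\<bar> powr (\<alpha> + 2)) > 0"
  shows "min_energy b \<alpha> c = -\<infinity>"
proof (rule ereal_eq_MInfty_if_tendsto_at_bot)
  define S where "S = c / (LBINT x. (h x)\<^sup>2)"
  let ?p = "S powr ((\<alpha> + 2) / 2) * (LBINT x. \<bar>h x\<bar> powr (\<alpha> + 2)) / (\<alpha> + 2)"
  have S: "S > 0" using assms by (simp add: S_def)
  have p: "?p > 0" using S P assms by simp
  define K W where "K = kinetic H" and "W = confinement b h"
  show "min_energy b \<alpha> c \<le> ereal (S / 2 * (l\<^sup>2 * K + W / l\<^sup>2) - ?p * l powr (3 * \<alpha> / 2))" if "l > 0" for l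
    using min_energy_le_concentration[OF _ \<open>c > 0\<close> that h cs m, of \<alpha> b] assms(1)
    by (simp add: S_def K_def W_def mult_ac)
  have "2 < 3 * \<alpha> / 2" using assms(1) by simp
  \<comment> \<open>The excess of the nonlinear power over the kinetic one. Factoring out l^2 leaves
    a convergent part plus a positive multiple of l^d.\<close>
  define d where "d = 3 * \<alpha> / 2 - 2"
  have d: "d > 0" using assms(1) by (simp add: d_def)
  have "filterlim (\<lambda>l. l powr d) at_top at_top"
    using d by (rule filterlim_powr_at_top)
  then have "filterlim (\<lambda>l. ?p * l powr d) at_top at_top"
    by (rule filterlim_tendsto_pos_mult_at_top[OF tendsto_const p])
  moreover have "((\<lambda>l. - (S / 2 * K) - S / 2 * W * (inverse l) ^ 4) \<longlongrightarrow> - (S / 2 * K) - S / 2 * W * 0 ^ 4) at_top"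
    by (intro tendsto_intros tendsto_inverse_0_at_top filterlim_ident)
  ultimately have "filterlim (\<lambda>l. (- (S / 2 * K) - S / 2 * W * (inverse l) ^ 4) + ?p * l powr d) at_top at_top"
    by (rule filterlim_tendsto_add_at_top[rotated])
  moreover have "filterlim (\<lambda>l::real. l\<^sup>2) at_top at_top"
    by (rule filterlim_pow_at_top) (auto intro: filterlim_ident)
  ultimately have "filterlim (\<lambda>l. l\<^sup>2 * ((- (S / 2 * K) - S / 2 * W * (inverse l) ^ 4) + ?p * l powr d)) at_top at_top"
    by (intro filterlim_at_top_mult_at_top)
  then have "filterlim (\<lambda>l. - (S / 2 * (l\<^sup>2 * K + W / l\<^sup>2) - ?p * l powr (3 * \<alpha> / 2))) at_top at_top"
  proof (rule filterlim_mono_eventually[OF _ order_refl order_refl])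
    show "\<forall>\<^sub>F l in at_top. l\<^sup>2 * ((- (S / 2 * K) - S / 2 * W * (inverse l) ^ 4) + ?p * l powr d)
        = - (S / 2 * (l\<^sup>2 * K + W / l\<^sup>2) - ?p * l powr (3 * \<alpha> / 2))"
      using eventually_gt_at_top[of 0]
    proof eventually_elim
      case (elim l)
      have "l powr (3 * \<alpha> / 2) = l powr (2 + d)" by (simp add: d_def)
      also have "\<dots> = l\<^sup>2 * l powr d" using elim by (simp add: powr_add)
      finally have "l powr (3 * \<alpha> / 2) = l\<^sup>2 * l powr d" .
      moreover have "l\<^sup>2 * (inverse l) ^ 4 = 1 / l\<^sup>2" using elim by (simp add: field_simps eval_nat_numeral)
      ultimately show ?case by (simp add: algebra_simps)
    qed
  qed
  then show "filterlim (\<lambda>l. S / 2 * (l\<^sup>2 * K + W / l\<^sup>2) - ?p * l powr (3 * \<alpha> / 2)) at_bot at_top"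
    by (subst filterlim_uminus_at_bot)
qed

text \<open>Raising the mass from that of \<open>h\<close> to c multiplies the quadratic terms by S
  = c/M, which is at least 1, and the nonlinear term by S^(5/3), which is at least S. The
  coefficient of l^2 stays negative, while the confinement fades like l^(-2).\<close>

lemma min_energy_critical_negative:
  assumes "c > 0" and h: "has_partials h H" and cs: "compactly_supported h"
    and m: "(LBINT x. (h x)\<^sup>2) \<le> c"
    and E: "kinetic H / 2 < 3 / 10 * (LBINT x. \<bar>h x\<bar> powr (10 / 3))"
  shows "min_energy b (4 / 3) c = -\<infinity>"
proof (rule ereal_eq_MInfty_if_tendsto_at_bot)
  define M K W P where "M = (LBINT x. (h x)\<^sup>2)" and "K = kinetic H" and "W = confinement b h"
    and "P = (LBINT x. \<bar>h x\<bar> powr (10 / 3))"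
  note c = has_partialsD(1)[OF h]
  have [measurable]: "h \<in> borel_measurable borel" using c by (rule borel_measurable_continuous_onI)
  have K0: "K \<ge> 0" unfolding K_def kinetic_def by (intro Bochner_Integration.integral_nonneg sum_nonneg) auto
  \<comment> \<open>Mass zero would make \<open>h\<close> vanish almost everywhere, hence P = 0, and
    the energy hypothesis would force a negative kinetic integral.\<close>
  have M: "M > 0"
  proof (rule ccontr)
    assume "\<not> M > 0"
    moreover have "M \<ge> 0" unfolding M_def by (intro Bochner_Integration.integral_nonneg) auto
    ultimately have "M = 0" by simp
    moreover have "integrable lborel (\<lambda>x. (h x)\<^sup>2)"
      using cs by (intro integrable_compactly_supported continuous_intros c) (auto elim: compactly_supported_comp)
    ultimately have "AE x in lborel. (h x)\<^sup>2 = 0"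
      unfolding M_def by (subst (asm) integral_nonneg_eq_0_iff_AE) auto
    then have "P = (\<integral>x. 0 \<partial>(lborel :: (real^3) measure))"
      unfolding P_def by (intro integral_cong_AE) auto
    then show False using E K0 by (simp add: P_def K_def)
  qed
  define S where "S = c / M"
  have S: "S \<ge> 1" using m M by (simp add: S_def M_def)
  have neg: "K / 2 - 3 / 10 * P < 0" using E by (simp add: K_def P_def)
  have P0: "P \<ge> 0" unfolding P_def by (intro Bochner_Integration.integral_nonneg) auto
  show "min_energy b (4 / 3) c \<le> ereal (S / 2 * W * (inverse l)\<^sup>2 + S * (K / 2 - 3 / 10 * P) * l\<^sup>2)" if "l > 0" for l
  proof -
    have e: "(4 / 3 + 2) / 2 = (5 / 3 :: real)" "3 * (4 / 3) / 2 = (2 :: real)" "4 / 3 + 2 = (10 / 3 :: real)" by simp_all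
    have "min_energy b (4 / 3) c \<le> ereal (S / 2 * (l\<^sup>2 * K + W / l\<^sup>2) - S powr (5 / 3) * l powr 2 * P / (10 / 3))"
      using min_energy_le_concentration[OF _ \<open>c > 0\<close> that h cs, of "4 / 3" b] M
      unfolding e by (simp add: S_def M_def K_def P_def W_def)
    also have "\<dots> \<le> ereal (S / 2 * (l\<^sup>2 * K + W / l\<^sup>2) - S * l powr 2 * P / (10 / 3))"
    proof -
      have "S powr 1 \<le> S powr (5 / 3)" using S by (intro powr_mono) auto
      then have "S * (l powr 2 * P / (10 / 3)) \<le> S powr (5 / 3) * (l powr 2 * P / (10 / 3))"
        using S P0 by (intro mult_right_mono) auto
      then show ?thesis by simp
    qed
    also have "S / 2 * (l\<^sup>2 * K + W / l\<^sup>2) - S * l powr 2 * P / (10 / 3) = S / 2 * W * (inverse l)\<^sup>2 + S * (K / 2 - 3 / 10 * P) * l\<^sup>2"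
      using that by (simp add: field_simps)
    finally show ?thesis .
  qed
  have "filterlim (\<lambda>l. - (S / 2 * W * (inverse l)\<^sup>2) + (S * (3 / 10 * P - K / 2)) * l\<^sup>2) at_top at_top"
  proof (rule filterlim_tendsto_add_at_top)
    show "((\<lambda>l. - (S / 2 * W * (inverse l)\<^sup>2)) \<longlongrightarrow> - (S / 2 * W * 0\<^sup>2)) at_top"
      by (intro tendsto_intros tendsto_inverse_0_at_top filterlim_ident)
    show "filterlim (\<lambda>l. S * (3 / 10 * P - K / 2) * l\<^sup>2) at_top at_top"
      using S neg by (intro filterlim_tendsto_pos_mult_at_top[OF tendsto_const] filterlim_pow_at_top filterlim_ident) auto
  qed
  then have "filterlim (\<lambda>l. - (S / 2 * W * (inverse l)\<^sup>2 + S * (K / 2 - 3 / 10 * P) * l\<^sup>2)) at_top at_top"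
    by (simp add: algebra_simps)
  then show "filterlim (\<lambda>l. S / 2 * W * (inverse l)\<^sup>2 + S * (K / 2 - 3 / 10 * P) * l\<^sup>2) at_bot at_top"
    by (subst filterlim_uminus_at_bot)
qed

section \<open>A family of cutoff functions\<close>

text \<open>Squaring the positive part makes the function continuously differentiable across the
  sphere of radius R. The partial derivatives are explicit and at most 4/|x| uniformly in R, as
  tests with linearly growing fields require.\<close>

definition cutoff :: "real \<Rightarrow> real^3 \<Rightarrow> real" where
  "cutoff R x = (max 0 (1 - (norm x)\<^sup>2 / R\<^sup>2))\<^sup>2"

definition cutoff_partial :: "real \<Rightarrow> 3 \<Rightarrow> real^3 \<Rightarrow> real" where
  "cutoff_partial R j x = - (4 / R\<^sup>2) * max 0 (1 - (norm x)\<^sup>2 / R\<^sup>2) * x $ j"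

lemma has_partials_norm_squared: "has_partials (\<lambda>x. (norm x)\<^sup>2) (\<lambda>j x. 2 * x $ j)"
proof -
  have "has_partials (\<lambda>x::real^3. x) (\<lambda>j x. axis j 1)"
    unfolding has_partials_def by (auto intro!: continuous_intros derivative_eq_intros)
  from has_partials_bilinear[OF bounded_bilinear_inner this this]
  have *: "has_partials (\<lambda>x::real^3. x \<bullet> x) (\<lambda>j x. x \<bullet> axis j 1 + axis j 1 \<bullet> x)" .
  have "(\<lambda>j x. x \<bullet> axis j 1 + axis j 1 \<bullet> x) = (\<lambda>j (x::real^3). 2 * x $ j)"
    by (intro ext) (simp add: inner_axis inner_axis')
  with * show ?thesis by (simp only: dot_square_norm)
qed

lemma max_squared_has_derivative:
  "((\<lambda>s. (max 0 (1 - s))\<^sup>2) has_real_derivative - 2 * max 0 (1 - s)) (at s)" for s :: real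
proof -
  consider "s < 1" | "s > 1" | "s = 1" by linarith
  then show ?thesis
  proof cases
    case 1
    have "((\<lambda>s. (1 - s)\<^sup>2) has_real_derivative - 2 * max 0 (1 - s)) (at s)"
      using 1 by (auto intro!: derivative_eq_intros)
    then show ?thesis
      by (rule has_field_derivative_transform_within_open[of _ _ _ "{..<1}"]) (use 1 in auto)
  next
    case 2
    have "((\<lambda>s. 0) has_real_derivative - 2 * max 0 (1 - s)) (at s)" using 2 by simp
    then show ?thesis
      by (rule has_field_derivative_transform_within_open[of _ _ _ "{1<..}"]) (use 2 in auto)
  next
    case 3
    have "((\<lambda>h. ((max 0 (1 - (1 + h)))\<^sup>2 - (max 0 (1 - 1))\<^sup>2) / h) \<longlongrightarrow> 0) (at (0::real))"
    proof (rule Lim_null_comparison)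
      show "\<forall>\<^sub>F h in at 0. norm (((max 0 (1 - (1 + h)))\<^sup>2 - (max 0 (1 - 1))\<^sup>2) / h) \<le> \<bar>h::real\<bar>"
        by (auto simp: eventually_at_filter max_def power2_eq_square abs_mult)
      show "((\<lambda>h. \<bar>h\<bar>) \<longlongrightarrow> 0) (at (0::real))" by (rule tendsto_rabs_zero) (rule tendsto_ident_at)
    qed
    then show ?thesis using 3 by (simp add: DERIV_def)
  qed
qed

lemma has_partials_cutoff: "has_partials (cutoff R) (cutoff_partial R)"
proof -
  let ?f = "\<lambda>x::real^3. (norm x)\<^sup>2 / R\<^sup>2"
  have f: "has_partials ?f (\<lambda>j x. 2 * x $ j / R\<^sup>2)"
    using has_partials_linear[OF bounded_linear_divide has_partials_norm_squared] by simp
  have "has_partials (\<lambda>x. (max 0 (1 - ?f x))\<^sup>2) (\<lambda>j x. (- 2 * max 0 (1 - ?f x)) * (2 * x $ j / R\<^sup>2))"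
    by (rule has_partials_chain[OF f, where \<phi>'="\<lambda>s. - 2 * max 0 (1 - s)"])
       (intro max_squared_has_derivative continuous_intros has_partialsD[OF f])+
  moreover have "cutoff R = (\<lambda>x. (max 0 (1 - ?f x))\<^sup>2)"
    "cutoff_partial R = (\<lambda>j x. (- 2 * max 0 (1 - ?f x)) * (2 * x $ j / R\<^sup>2))"
    by (auto simp: cutoff_def cutoff_partial_def fun_eq_iff)
  ultimately show ?thesis by simp
qed

lemma cutoff_eq_0: "R > 0 \<Longrightarrow> R < norm x \<Longrightarrow> cutoff R x = 0"
  "R > 0 \<Longrightarrow> R < norm x \<Longrightarrow> cutoff_partial R j x = 0"
proof -
  assume "R > 0" "R < norm x"
  then have "R\<^sup>2 \<le> (norm x)\<^sup>2" by (intro power_mono) auto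
  then have "1 \<le> (norm x)\<^sup>2 / R\<^sup>2" using \<open>R > 0\<close> by simp
  then show "cutoff R x = 0" "cutoff_partial R j x = 0" by (auto simp: cutoff_def cutoff_partial_def)
qed

lemma compactly_supported_cutoff: "R > 0 \<Longrightarrow> compactly_supported (cutoff R)"
  unfolding compactly_supported_def by (intro exI[of _ R] allI impI cutoff_eq_0)

lemma cutoff_bounds: "0 \<le> cutoff R x" "cutoff R x \<le> 1"
proof -
  show "0 \<le> cutoff R x" by (simp add: cutoff_def)
  show "cutoff R x \<le> 1" unfolding cutoff_def by (rule power_le_one) auto
qed

text \<open>On the ball both |x| and |x_j| are at most R, which cancels the factor 4/R^2. A bound
  uniform in R serves as domination when the test field grows like x.\<close>

lemma norm_times_cutoff_partial:
  assumes "R > 0" shows "norm x * \<bar>cutoff_partial R j x\<bar> \<le> 4"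
proof (cases "norm x \<le> R")
  case True
  have "\<bar>x $ j\<bar> \<le> norm x" by (rule component_le_norm_cart)
  then have "\<bar>x $ j\<bar> \<le> R" using True by linarith
  then have x: "norm x * \<bar>x $ j\<bar> \<le> R * R" by (intro mult_mono) (use True assms in auto)
  have "max 0 (1 - (norm x)\<^sup>2 / R\<^sup>2) \<le> 1" by simp
  from this x have "max 0 (1 - (norm x)\<^sup>2 / R\<^sup>2) * (norm x * \<bar>x $ j\<bar>) \<le> 1 * (R * R)"
    by (rule mult_mono) auto
  then show ?thesis using assms
    by (simp add: cutoff_partial_def abs_mult power2_eq_square field_simps)
qed (use cutoff_eq_0[OF assms] in auto)

lemma cutoff_partial_bound:
  assumes "R \<ge> 1" shows "\<bar>cutoff_partial R j x\<bar> \<le> 4"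
proof (cases "norm x \<le> R")
  case True
  have "\<bar>x $ j\<bar> \<le> norm x" by (rule component_le_norm_cart)
  moreover have "R \<le> R * R" using assms mult_left_mono[of 1 R R] by simp
  ultimately have x: "\<bar>x $ j\<bar> \<le> R * R" using True by linarith
  have "max 0 (1 - (norm x)\<^sup>2 / R\<^sup>2) \<le> 1" by simp
  from this x have "max 0 (1 - (norm x)\<^sup>2 / R\<^sup>2) * \<bar>x $ j\<bar> \<le> 1 * (R * R)"
    by (rule mult_mono) auto
  then show ?thesis using assms
    by (simp add: cutoff_partial_def abs_mult power2_eq_square field_simps)
qed (use cutoff_eq_0 assms in auto)

lemma cutoff_tendsto:
  "(\<lambda>n. cutoff (real (Suc n)) x) \<longlonglongrightarrow> 1" "(\<lambda>n. cutoff_partial (real (Suc n)) j x) \<longlonglongrightarrow> 0"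
proof -
  have l: "(\<lambda>n. (norm x)\<^sup>2 / (real (Suc n))\<^sup>2) \<longlonglongrightarrow> 0" "(\<lambda>n. 4 / (real (Suc n))\<^sup>2) \<longlonglongrightarrow> 0"
  proof -
    have "(\<lambda>n. C * (1 / real (Suc n))\<^sup>2) \<longlonglongrightarrow> C * 0\<^sup>2" for C :: real
      by (intro tendsto_intros null_step_seq)
    from this[of "(norm x)\<^sup>2"] this[of 4] show "(\<lambda>n. (norm x)\<^sup>2 / (real (Suc n))\<^sup>2) \<longlonglongrightarrow> 0"
      "(\<lambda>n. 4 / (real (Suc n))\<^sup>2) \<longlonglongrightarrow> 0" by (simp_all add: power_divide)
  qed
  have "(\<lambda>n. (max 0 (1 - (norm x)\<^sup>2 / (real (Suc n))\<^sup>2))\<^sup>2) \<longlonglongrightarrow> (max 0 (1 - 0))\<^sup>2"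
    by (intro tendsto_intros l)
  then show "(\<lambda>n. cutoff (real (Suc n)) x) \<longlonglongrightarrow> 1" by (simp add: cutoff_def)
  have "(\<lambda>n. - (4 / (real (Suc n))\<^sup>2) * max 0 (1 - (norm x)\<^sup>2 / (real (Suc n))\<^sup>2) * x $ j)
      \<longlonglongrightarrow> - 0 * max 0 (1 - 0) * x $ j"
    by (intro tendsto_intros l)
  then show "(\<lambda>n. cutoff_partial (real (Suc n)) j x) \<longlonglongrightarrow> 0" by (simp add: cutoff_partial_def)
qed

text \<open>Integrability is part of the conclusion: otherwise the integral of the limit could be 0
  by default and the bound empty of content.\<close>

lemma integral_Fatou:
  fixes f :: "'a \<Rightarrow> real"
  assumes [measurable]: "f \<in> borel_measurable M" and u: "\<And>n. integrable M (u n)" "\<And>n x. 0 \<le> u n x"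
    and lim: "AE x in M. (\<lambda>n. u n x) \<longlonglongrightarrow> f x" and C: "\<And>n. (\<integral>x. u n x \<partial>M) \<le> C"
  shows "integrable M f" "(\<integral>x. f x \<partial>M) \<le> C"
proof -
  have nn: "AE x in M. 0 \<le> f x"
    using lim by eventually_elim (auto intro: LIMSEQ_le_const u(2))
  have "0 \<le> (\<integral>x. u 0 x \<partial>M)" by (intro Bochner_Integration.integral_nonneg u(2))
  then have "0 \<le> C" using C[of 0] by linarith
  have "(\<integral>\<^sup>+x. ennreal (f x) \<partial>M) = (\<integral>\<^sup>+x. liminf (\<lambda>n. ennreal (u n x)) \<partial>M)"
  proof (rule nn_integral_cong_AE, use lim in eventually_elim)
    case (elim x)
    then have "(\<lambda>n. ennreal (u n x)) \<longlonglongrightarrow> ennreal (f x)" by (rule tendsto_ennrealI)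
    then show ?case by (intro lim_imp_Liminf[symmetric]) auto
  qed
  also have "\<dots> \<le> liminf (\<lambda>n. \<integral>\<^sup>+x. ennreal (u n x) \<partial>M)"
    using u(1) by (intro nn_integral_liminf) auto
  also have "\<dots> = liminf (\<lambda>n. ennreal (\<integral>x. u n x \<partial>M))"
    using u by (simp add: nn_integral_eq_integral)
  also have "\<dots> \<le> ennreal C"
    using C by (intro Liminf_le) (auto intro!: always_eventually ennreal_leI)
  finally have fin: "(\<integral>\<^sup>+x. ennreal (f x) \<partial>M) \<le> ennreal C" .
  show int: "integrable M f"
    using nn fin by (intro integrableI_nonneg) (auto intro: le_less_trans)
  have "ennreal (\<integral>x. f x \<partial>M) \<le> ennreal C"
    using fin nn_integral_eq_integral[OF int nn] by simp
  then show "(\<integral>x. f x \<partial>M) \<le> C" using \<open>0 \<le> C\<close> by simp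
qed

section \<open>Integral identities for the ground state\<close>

lemma has_partials_sum:
  assumes "finite I" "\<And>k. k \<in> I \<Longrightarrow> has_partials (f k) (F k)"
  shows "has_partials (\<lambda>x. \<Sum>k\<in>I. f k x) (\<lambda>j x. \<Sum>k\<in>I. F k j x)"
  using assms by (induction I) (auto intro: has_partials_const has_partials_add)

lemma has_partials_of_real:
  "has_partials h H \<Longrightarrow> has_partials (\<lambda>x. complex_of_real (h x)) (\<lambda>j x. complex_of_real (H j x))"
  using has_partials_linear[OF bounded_linear_of_real] .

lemma abs_mult_le_sum_squares: "\<bar>a * b\<bar> \<le> a\<^sup>2 + b\<^sup>2" for a b :: real
proof -
  have "0 \<le> \<bar>a\<bar> * \<bar>b\<bar>" by simp
  then show ?thesis
    using sum_squares_bound[of "\<bar>a\<bar>" "\<bar>b\<bar>"] by (simp only: power2_abs abs_mult)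
qed

locale ground_state =
  fixes Q :: "real^3 \<Rightarrow> real"
  assumes Q: "positive_radial_solution Q"
begin

abbreviation "P \<equiv> \<lambda>j. partial j Q"
abbreviation "PP \<equiv> \<lambda>i j. partial i (partial j Q)"
abbreviation "N \<equiv> \<lambda>x. \<Sum>j\<in>UNIV. (P j x)\<^sup>2"
text \<open>Radius n + 1 rather than n keeps the cutoff radius positive, and at least 1 as
  \<open>cutoff_partial_bound\<close> demands.\<close>

abbreviation "Y \<equiv> \<lambda>n::nat. cutoff (real (Suc n))"
abbreviation "X \<equiv> \<lambda>n::nat. cutoff_partial (real (Suc n))"

lemma Q_pos: "Q x > 0" and Q_radial: "norm x = norm y \<Longrightarrow> Q x = Q y"
  and Ck_Q: "Ck 2 Q" and Q_H1: "(\<lambda>x. complex_of_real (Q x)) \<in> H1 (\<lambda>x. 0)"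
  using Q unfolding positive_radial_solution_def by blast+

lemma has_partials_Q: "has_partials Q P"
  using Ck_Q by (rule Ck_has_partials) simp

lemma has_partials_P: "has_partials (P j) (\<lambda>i. PP i j)"
proof -
  have "Ck (Suc 0) (P j)" using Ck_Q by (simp add: numeral_2_eq_2)
  then show ?thesis by (rule Ck_1_has_partials)
qed

lemmas continuous_Q_partials = has_partialsD(1,2)[OF has_partials_Q] has_partialsD(2)[OF has_partials_P]

lemma continuous_Q_powr: "continuous_on UNIV (\<lambda>x. Q x powr p)"
  using Q_pos by (intro continuous_intros continuous_Q_partials) (auto simp: less_imp_neq[symmetric])

lemma Q_equation: "(\<Sum>j\<in>UNIV. PP j j x) = Q x - Q x powr (7 / 3)"
proof -
  have "- laplacian Q x + Q x - \<bar>Q x\<bar> powr (4 / 3) * Q x = 0"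
    using Q unfolding positive_radial_solution_def by blast
  moreover have "\<bar>Q x\<bar> powr (4 / 3) * Q x = Q x powr (7 / 3)"
    using Q_pos[of x] powr_add[of "Q x" "4 / 3" 1] by simp
  ultimately show ?thesis by (simp add: laplacian_def)
qed

lemma Q_powr_10_3: "Q x * Q x powr (7 / 3) = Q x powr (10 / 3)"
  using Q_pos[of x] powr_add[of "Q x" 1 "7 / 3"] by simp

lemma measurable_Q [measurable]: "Q \<in> borel_measurable borel" "P j \<in> borel_measurable borel"
    "PP i j \<in> borel_measurable borel" "cutoff R \<in> borel_measurable borel"
    "cutoff_partial R j \<in> borel_measurable borel"
  by (auto intro!: borel_measurable_continuous_onI continuous_Q_partials has_partialsD(1,2)[OF has_partials_cutoff])

lemma integrable_Q2: "integrable lborel (\<lambda>x. (Q x)\<^sup>2)"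
  using Q_H1 by (simp add: H1_def Lp_2_iff)

text \<open>Membership in \<open>H1\<close> provides some square-integrable weak gradient; for the
  zero potential it agrees almost everywhere with the classical one.\<close>

lemma integrable_N: "integrable lborel N"
proof -
  let ?q = "\<lambda>x. complex_of_real (Q x)" and ?A = "\<lambda>x::real^3. 0 :: real^3"
  let ?g = "classical_cov_gradient ?A ?q (\<lambda>j x. complex_of_real (P j x))"
  have q: "has_partials ?q (\<lambda>j x. complex_of_real (P j x))"
    by (rule has_partials_of_real[OF has_partials_Q])
  have [measurable]: "cov_gradient ?A ?q \<in> borel_measurable borel"
    using cov_gradient_props(1)[OF Q_H1] by (simp add: Lp_2_iff)
  have mg[measurable]: "?g \<in> borel_measurable borel"
    by (intro borel_measurable_continuous_onI continuous_on_classical_cov_gradient[OF q]) simp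
  have "AE x in lborel. cov_gradient ?A ?q x = ?g x"
    by (rule cov_gradient_classical[OF q _ Q_H1]) simp
  then have "AE x in lborel. (norm (cov_gradient ?A ?q x))\<^sup>2 = N x"
  proof eventually_elim
    case (elim x)
    show ?case unfolding elim by (subst norm_classical_cov_gradient_real) simp
  qed
  moreover have "integrable lborel (\<lambda>x. (norm (cov_gradient ?A ?q x))\<^sup>2)"
    using cov_gradient_props(1)[OF Q_H1] by (simp add: Lp_2_iff)
  moreover have "N \<in> borel_measurable lborel" by measurable
  ultimately show ?thesis by (subst integrable_cong_AE[symmetric]) auto
qed

text \<open>Multiply the equation by \<open>w\<close> Q and integrate by parts. The weight
  localises, since of Q and its gradient only square integrability is known at this stage.\<close>

lemma Nehari_test:
  assumes w: "has_partials w W" and cs: "compactly_supported w"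
  shows "(LBINT x. w x * (N x + (Q x)\<^sup>2 - Q x powr (10 / 3))) = - (LBINT x. Q x * (\<Sum>i\<in>UNIV. P i x * W i x))"
proof -
  note c = has_partialsD(1,2)[OF w] continuous_Q_partials
  note csW = has_partials_compactly_supported[OF w cs]
  have i1: "integrable lborel (\<lambda>x. PP i i x * (w x * Q x))" for i
    by (intro integrable_compactly_supported continuous_intros c compactly_supported_mult cs)
  have i2: "integrable lborel (\<lambda>x. P i x * (w x * P i x + W i x * Q x))" for i
  proof (rule integrable_compactly_supported)
    show "compactly_supported (\<lambda>x. P i x * (w x * P i x + W i x * Q x))"
      using has_partials_compactly_supported[OF has_partials_mult[OF w has_partials_Q] compactly_supported_mult(1)[OF cs]]
      by (rule compactly_supported_mult(2))
  qed (intro continuous_intros c)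
  have i3: "integrable lborel (\<lambda>x. w x * N x)"
    by (intro integrable_compactly_supported continuous_intros c compactly_supported_mult cs)
  have i4: "integrable lborel (\<lambda>x. w x * (Q x * (Q x - Q x powr (7 / 3))))"
    by (intro integrable_compactly_supported continuous_intros continuous_Q_powr c compactly_supported_mult cs)
       (simp add: Q_pos less_imp_neq[symmetric])
  have i5: "integrable lborel (\<lambda>x. Q x * (\<Sum>i\<in>UNIV. P i x * W i x))"
  proof (rule integrable_compactly_supported)
    obtain R where "\<And>x. R < norm x \<Longrightarrow> w x = 0" using cs by (auto simp: compactly_supported_def)
    from has_partials_support[OF w this] show "compactly_supported (\<lambda>x. Q x * (\<Sum>i\<in>UNIV. P i x * W i x))"
      unfolding compactly_supported_def by (intro exI[of _ R]) simp
  qed (intro continuous_intros c)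
  have "(LBINT x. PP i i x * (w x * Q x)) = - (LBINT x. P i x * (w x * P i x + W i x * Q x))" for i
    by (rule integration_by_parts[OF has_partials_P has_partials_mult[OF w has_partials_Q]])
       (intro compactly_supported_mult cs)
  then have "(\<Sum>i\<in>UNIV. LBINT x. PP i i x * (w x * Q x))
      = - (\<Sum>i\<in>UNIV. LBINT x. P i x * (w x * P i x + W i x * Q x))" by (simp add: sum_negf)
  then have "(LBINT x. (\<Sum>i\<in>UNIV. PP i i x * (w x * Q x)))
      = - (LBINT x. (\<Sum>i\<in>UNIV. P i x * (w x * P i x + W i x * Q x)))"
    using i1 i2 by (simp add: Bochner_Integration.integral_sum)
  moreover have "(\<Sum>i\<in>UNIV. PP i i x * (w x * Q x)) = w x * (Q x * (Q x - Q x powr (7 / 3)))" for x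
    unfolding sum_distrib_right[symmetric] Q_equation by (simp add: mult_ac)
  moreover have "(\<Sum>i\<in>UNIV. P i x * (w x * P i x + W i x * Q x)) = w x * N x + Q x * (\<Sum>i\<in>UNIV. P i x * W i x)" for x
    by (simp add: sum_3 algebra_simps power2_eq_square)
  ultimately have "(LBINT x. w x * (Q x * (Q x - Q x powr (7 / 3))))
      = - ((LBINT x. w x * N x) + (LBINT x. Q x * (\<Sum>i\<in>UNIV. P i x * W i x)))"
    using i3 i5 by simp
  moreover have "(LBINT x. w x * (N x + (Q x)\<^sup>2 - Q x powr (10 / 3)))
     = (LBINT x. w x * N x + w x * (Q x * (Q x - Q x powr (7 / 3))))"
    by (simp add: Q_powr_10_3[symmetric] algebra_simps power2_eq_square)
  ultimately show ?thesis using i3 i4 by simp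
qed

text \<open>The equation controls its own nonlinearity: \<open>Nehari_test\<close> with cutoffs
  expresses the localised integral through Q and its gradient in L^2, uniformly in n, and Fatou
  removes the cutoffs.\<close>

lemma integrable_Q_powr: "integrable lborel (\<lambda>x. Q x powr (10 / 3))"
proof (rule integral_Fatou(1))
  \<comment> \<open>The 4 bounds the cutoff gradient for radius at least 1; the last bracket is the
    sum of Q^2 + P_i^2 over three directions.\<close>
  have dom: "integrable lborel (\<lambda>x. N x + (Q x)\<^sup>2 + 4 * (3 * (Q x)\<^sup>2 + N x))"
    using integrable_N integrable_Q2 by (intro Bochner_Integration.integrable_add integrable_mult_right)
  fix n
  have pos: "real (Suc n) > 0" by simp
  note cs = compactly_supported_cutoff[OF pos]
  note c = has_partialsD(1,2)[OF has_partials_cutoff] continuous_Q_partials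
  show "integrable lborel (\<lambda>x. Y n x * Q x powr (10 / 3))"
    by (intro integrable_compactly_supported continuous_on_mult continuous_Q_powr c compactly_supported_mult cs)
  have i: "integrable lborel (\<lambda>x. Y n x * (N x + (Q x)\<^sup>2))"
    by (intro integrable_compactly_supported continuous_intros c compactly_supported_mult cs)
  have i5: "integrable lborel (\<lambda>x. Q x * (\<Sum>i\<in>UNIV. P i x * X n i x))"
  proof (rule integrable_compactly_supported)
    show "compactly_supported (\<lambda>x. Q x * (\<Sum>i\<in>UNIV. P i x * X n i x))"
      unfolding compactly_supported_def by (intro exI[of _ "real (Suc n)"]) (simp add: cutoff_eq_0)
  qed (intro continuous_intros c)
  have "(LBINT x. Y n x * (N x + (Q x)\<^sup>2) - Y n x * Q x powr (10 / 3)) = - (LBINT x. Q x * (\<Sum>i\<in>UNIV. P i x * X n i x))"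
    using Nehari_test[OF has_partials_cutoff cs] by (simp add: algebra_simps)
  then have "(LBINT x. Y n x * Q x powr (10 / 3))
      = (LBINT x. Y n x * (N x + (Q x)\<^sup>2) + Q x * (\<Sum>i\<in>UNIV. P i x * X n i x))"
    using i i5 \<open>integrable lborel (\<lambda>x. Y n x * Q x powr (10 / 3))\<close> by simp
  also have "\<dots> \<le> (LBINT x. N x + (Q x)\<^sup>2 + 4 * (3 * (Q x)\<^sup>2 + N x))"
  proof (rule integral_mono[OF _ dom])
    show "integrable lborel (\<lambda>x. Y n x * (N x + (Q x)\<^sup>2) + Q x * (\<Sum>i\<in>UNIV. P i x * X n i x))"
      using i i5 by simp
    fix x
    have "Y n x * (N x + (Q x)\<^sup>2) \<le> 1 * (N x + (Q x)\<^sup>2)"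
      by (intro mult_right_mono cutoff_bounds add_nonneg_nonneg sum_nonneg) auto
    moreover have "Q x * (P i x * X n i x) \<le> 4 * ((Q x)\<^sup>2 + (P i x)\<^sup>2)" for i
    proof -
      have "Q x * (P i x * X n i x) \<le> \<bar>Q x * P i x\<bar> * \<bar>X n i x\<bar>"
        by (simp add: abs_mult[symmetric])
      also have "\<dots> \<le> \<bar>Q x * P i x\<bar> * 4"
        by (intro mult_left_mono cutoff_partial_bound) auto
      also have "\<bar>Q x * P i x\<bar> \<le> (Q x)\<^sup>2 + (P i x)\<^sup>2"
        by (rule abs_mult_le_sum_squares)
      finally show ?thesis by simp
    qed
    then have "Q x * (\<Sum>i\<in>UNIV. P i x * X n i x) \<le> (\<Sum>i\<in>UNIV. 4 * ((Q x)\<^sup>2 + (P i x)\<^sup>2))"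
      unfolding sum_distrib_left by (rule sum_mono)
    then have "Q x * (\<Sum>i\<in>UNIV. P i x * X n i x) \<le> 4 * (3 * (Q x)\<^sup>2 + N x)"
      by (simp add: sum_3 algebra_simps)
    ultimately show "Y n x * (N x + (Q x)\<^sup>2) + Q x * (\<Sum>i\<in>UNIV. P i x * X n i x) \<le> N x + (Q x)\<^sup>2 + 4 * (3 * (Q x)\<^sup>2 + N x)"
      by simp
  qed
  finally show "(LBINT x. Y n x * Q x powr (10 / 3)) \<le> (LBINT x. N x + (Q x)\<^sup>2 + 4 * (3 * (Q x)\<^sup>2 + N x))" .
next
  show "AE x in lborel. (\<lambda>n. Y n x * Q x powr (10 / 3)) \<longlonglongrightarrow> Q x powr (10 / 3)"
  proof (rule AE_I2)
    fix x
    have "(\<lambda>n. Y n x * Q x powr (10 / 3)) \<longlonglongrightarrow> 1 * Q x powr (10 / 3)"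
      by (intro tendsto_mult cutoff_tendsto tendsto_const)
    then show "(\<lambda>n. Y n x * Q x powr (10 / 3)) \<longlonglongrightarrow> Q x powr (10 / 3)" by simp
  qed
qed (auto simp: cutoff_bounds)

text \<open>One derivative moves by parts onto the test function, and
  \<open>integral_partials_swap\<close> exchanges the indices. Symmetry almost everywhere is enough
  for \<open>Pohozaev_test\<close>, where it enters under an integral.\<close>

lemma second_partials_symmetric: "AE x in lborel. \<forall>i j. PP i j x = PP j i x"
proof -
  have "AE x in lborel. complex_of_real (PP i j x - PP j i x) = 0" for i j
  proof (rule AE_eq_0_if_weakly_0)
    show "locally_integrable (\<lambda>x. complex_of_real (PP i j x - PP j i x))"
      by (intro locally_integrable_continuous continuous_intros continuous_Q_partials)
    fix \<phi> :: "real^3 \<Rightarrow> complex" assume "test_function \<phi>"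
    note p = test_function_has_partials[OF this] and cs = test_function_compactly_supported[OF this]
    let ?c = "complex_of_real"
    have i: "integrable lborel (\<lambda>x. ?c (PP i j x) * \<phi> x)" for i j
      by (intro integrable_compactly_supported compactly_supported_mult cs continuous_intros continuous_Q_partials has_partialsD[OF p])
    have e: "(LBINT x. ?c (PP i j x) * \<phi> x) = - (LBINT x. ?c (P j x) * partial i \<phi> x)" for i j
      by (rule integration_by_parts[OF has_partials_of_real[OF has_partials_P] p cs])
    have "(LBINT x. ?c (P j x) * partial i \<phi> x) = (LBINT x. ?c (P i x) * partial j \<phi> x)"
      by (rule integral_partials_swap[OF has_partials_of_real[OF has_partials_Q] p cs])
    then have "(LBINT x. ?c (PP i j x) * \<phi> x) = (LBINT x. ?c (PP j i x) * \<phi> x)"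
      by (simp only: e)
    then show "(LBINT x. ?c (PP i j x - PP j i x) * \<phi> x) = 0"
      using i by (simp add: left_diff_distrib)
  qed
  then have "AE x in lborel. \<forall>i j. complex_of_real (PP i j x - PP j i x) = 0"
    by (simp add: AE_all_countable)
  then show ?thesis by eventually_elim (simp add: complex_eq_iff)
qed

text \<open>\<open>D\<close> is the generator of dilations applied to Q, and \<open>L\<close> below
  is the Lagrangian density of the equation: the ingredients of the Pohozaev vector field.\<close>

abbreviation "D \<equiv> \<lambda>x. \<Sum>j\<in>UNIV. x $ j * P j x"
abbreviation "L \<equiv> \<lambda>x. 1 / 2 * N x + 1 / 2 * (Q x)\<^sup>2 - 3 / 10 * Q x powr (10 / 3)"

lemma has_partials_D: "has_partials D (\<lambda>i x. \<Sum>j\<in>UNIV. x $ j * PP i j x + (if j = i then 1 else 0) * P j x)"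
  by (intro has_partials_sum has_partials_mult has_partials_component has_partials_P) simp

lemma has_partials_square: "has_partials h H \<Longrightarrow> has_partials (\<lambda>x. (h x)\<^sup>2) (\<lambda>i x. 2 * h x * H i x)"
  for h :: "real^3 \<Rightarrow> real"
  using has_partials_mult[of h H h H] by (simp add: power2_eq_square algebra_simps)

lemma has_partials_Q_powr: "has_partials (\<lambda>x. Q x powr (10 / 3)) (\<lambda>i x. 10 / 3 * Q x powr (7 / 3) * P i x)"
proof (rule has_partials_chain[OF has_partials_Q, where \<phi>'="\<lambda>s. 10 / 3 * s powr (7 / 3)"])
  show "((\<lambda>s. s powr (10 / 3)) has_real_derivative 10 / 3 * Q x powr (7 / 3)) (at (Q x))" for x
    using has_real_derivative_powr[OF Q_pos[of x], of "10 / 3"] by simp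
qed (intro continuous_intros continuous_Q_powr)

lemma has_partials_L: "has_partials L (\<lambda>i x. (\<Sum>j\<in>UNIV. P j x * PP i j x) + Q x * P i x - Q x powr (7 / 3) * P i x)"
proof -
  have "has_partials (\<lambda>x. (1 / 2 * N x + 1 / 2 * (Q x)\<^sup>2) + (- (3 / 10)) * Q x powr (10 / 3))
     (\<lambda>i x. (1 / 2 * (\<Sum>j\<in>UNIV. 2 * P j x * PP i j x) + 1 / 2 * (2 * Q x * P i x)) + (- (3 / 10)) * (10 / 3 * Q x powr (7 / 3) * P i x))"
    by (intro has_partials_add has_partials_linear[OF bounded_linear_mult_right] has_partials_sum
        has_partials_square has_partials_P has_partials_Q has_partials_Q_powr) simp
  then show ?thesis by (simp add: sum_distrib_left mult_ac)
qed

abbreviation "G \<equiv> \<lambda>x. 9 / 10 * Q x powr (10 / 3) - 1 / 2 * N x - 3 / 2 * (Q x)\<^sup>2"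

text \<open>\<open>G\<close> is the divergence of the field D grad Q - x L. Writing it out gives D
  lap Q + |grad Q|^2 - 3 L - D (Q - Q^(7/3)) and two Hessian terms that cancel by symmetry. The
  equation cancels the multiples of D, leaving |grad Q|^2 - 3 L.\<close>

lemma Pohozaev_test:
  assumes w: "has_partials w W" and cs: "compactly_supported w"
  shows "(LBINT x. w x * G x) = - (LBINT x. (\<Sum>i\<in>UNIV. W i x * (D x * P i x - x $ i * L x)))"
proof -
  define Z where "Z = (\<lambda>i x. D x * P i x + (- 1) * (x $ i * L x))"
  \<comment> \<open>Diagonal entries of the derivative of the field; the literal
    \<open>i = i\<close> keeps the term identical to the instance k = i of \<open>Z\<close>
    below.\<close>
  define dZ where "dZ = (\<lambda>i x. (D x * PP i i x + (\<Sum>j\<in>UNIV. x $ j * PP i j x + (if j = i then 1 else 0) * P j x) * P i x)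
      + (- 1) * (x $ i * ((\<Sum>j\<in>UNIV. P j x * PP i j x) + Q x * P i x - Q x powr (7 / 3) * P i x) + (if i = i then 1 else 0) * L x))"
  note c = has_partialsD(1,2)[OF w] has_partialsD(1,2)[OF has_partials_D] has_partialsD(1,2)[OF has_partials_L]
     continuous_Q_partials continuous_Q_powr
  have Z: "has_partials (Z i) (\<lambda>k x. (D x * PP k i x + (\<Sum>j\<in>UNIV. x $ j * PP k j x + (if j = k then 1 else 0) * P j x) * P i x)
      + (- 1) * (x $ i * ((\<Sum>j\<in>UNIV. P j x * PP k j x) + Q x * P k x - Q x powr (7 / 3) * P k x) + (if i = k then 1 else 0) * L x))" for i
    unfolding Z_def
    by (intro has_partials_add has_partials_linear[OF bounded_linear_mult_right] has_partials_mult
        has_partials_D has_partials_L has_partials_P has_partials_component)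
  have wZ: "has_partials (\<lambda>x. w x * Z i x) (\<lambda>k x. w x * ((D x * PP k i x + (\<Sum>j\<in>UNIV. x $ j * PP k j x + (if j = k then 1 else 0) * P j x) * P i x)
      + (- 1) * (x $ i * ((\<Sum>j\<in>UNIV. P j x * PP k j x) + Q x * P k x - Q x powr (7 / 3) * P k x) + (if i = k then 1 else 0) * L x)) + W k x * Z i x)" for i
    by (rule has_partials_mult[OF w Z])
  have cZ: "continuous_on UNIV (Z i)" for i by (rule has_partialsD(1)[OF Z])
  have cdZ: "continuous_on UNIV (dZ i)" for i using has_partialsD(2)[OF Z, of i i] unfolding dZ_def .
  have zero: "(LBINT x. w x * dZ i x + W i x * Z i x) = 0" for i
    using integral_partial_eq_0[OF wZ[of i] compactly_supported_mult(1)[OF cs], of i] unfolding dZ_def .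
  have i1: "integrable lborel (\<lambda>x. w x * dZ i x)" for i
    by (intro integrable_compactly_supported continuous_on_mult c cdZ compactly_supported_mult cs)
  have i2: "integrable lborel (\<lambda>x. W i x * Z i x)" for i
    by (intro integrable_compactly_supported continuous_on_mult c cZ compactly_supported_mult has_partials_compactly_supported[OF w cs])
  have "(LBINT x. (\<Sum>i\<in>UNIV. w x * dZ i x + W i x * Z i x)) = (\<Sum>i\<in>UNIV. LBINT x. w x * dZ i x + W i x * Z i x)"
    using i1 i2 by (intro Bochner_Integration.integral_sum Bochner_Integration.integrable_add)
  also have "\<dots> = 0" unfolding zero by simp
  finally have "(LBINT x. (\<Sum>i\<in>UNIV. w x * dZ i x) + (\<Sum>i\<in>UNIV. W i x * Z i x)) = 0"
    by (simp add: sum.distrib)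
  then have "(LBINT x. (\<Sum>i\<in>UNIV. w x * dZ i x)) = - (LBINT x. (\<Sum>i\<in>UNIV. W i x * Z i x))"
    using i1 i2 by (simp add: eq_neg_iff_add_eq_0)
  moreover have "(LBINT x. w x * G x) = (LBINT x. (\<Sum>i\<in>UNIV. w x * dZ i x))"
  proof (rule integral_cong_AE)
    show "AE x in lborel. w x * G x = (\<Sum>i\<in>UNIV. w x * dZ i x)"
      using second_partials_symmetric
    proof eventually_elim
      case (elim x)
      have sym: "PP 2 1 x = PP 1 2 x" "PP 3 1 x = PP 1 3 x" "PP 3 2 x = PP 2 3 x" using elim by blast+
      \<comment> \<open>The equation eliminates one pure second derivative; together with symmetry
        the claim becomes an algebraic identity.\<close>
      have eq: "PP 3 3 x = Q x - Q x powr (7 / 3) - PP 1 1 x - PP 2 2 x"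
        using Q_equation[of x] by (simp add: sum_3)
      have ne: "(1::3) \<noteq> 2" "(1::3) \<noteq> 3" "(2::3) \<noteq> 3" "(2::3) \<noteq> 1" "(3::3) \<noteq> 1" "(3::3) \<noteq> 2" by auto
      have "(\<Sum>i\<in>UNIV. dZ i x) = G x"
        unfolding dZ_def sum_3 sym eq
        by (simp add: ne algebra_simps power2_eq_square)
      then show ?case by (simp add: sum_distrib_left[symmetric])
    qed
  next
    show "(\<lambda>x. w x * G x) \<in> borel_measurable lborel" "(\<lambda>x. \<Sum>i\<in>UNIV. w x * dZ i x) \<in> borel_measurable lborel"
      by (auto intro!: borel_measurable_continuous_onI continuous_intros c cdZ)
  qed
  ultimately show ?thesis by (simp add: Z_def)
qed

text \<open>Let K, M, T be the integrals of |grad Q|^2, Q^2, Q^(10/3). As the cutoffs grow, Nehari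
  gives K + M = T and Pohozaev gives 9T/10 = K/2 + 3M/2. Eliminating M leaves K = 3T/5, which says
  that the nonmagnetic energy K/2 - 3T/10 vanishes.\<close>

lemma kinetic_P: "kinetic P = 3 / 5 * (LBINT x. Q x powr (10 / 3))"
proof -
  note int = integrable_N integrable_Q2 integrable_Q_powr
  note c = has_partialsD(1,2)[OF has_partials_D] has_partialsD(1,2)[OF has_partials_L] continuous_Q_partials continuous_Q_powr
     has_partialsD(1,2)[OF has_partials_cutoff]
  have pos: "real (Suc n) > 0" for n by simp
  have cut_lim: "(\<lambda>n. LBINT x. Y n x * g x) \<longlonglongrightarrow> (LBINT x. g x)"
    if g: "integrable lborel g" for g
  proof (rule integral_dominated_convergence[where w="\<lambda>x. norm (g x)"])
    show "AE x in lborel. (\<lambda>n. Y n x * g x) \<longlonglongrightarrow> g x"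
    proof (rule AE_I2)
      fix x
      have "(\<lambda>n. Y n x * g x) \<longlonglongrightarrow> 1 * g x" by (intro tendsto_mult cutoff_tendsto tendsto_const)
      then show "(\<lambda>n. Y n x * g x) \<longlonglongrightarrow> g x" by simp
    qed
    show "AE x in lborel. norm (Y n x * g x) \<le> norm (g x)" for n
      by (intro AE_I2) (simp add: abs_mult cutoff_bounds mult_left_le_one_le)
    have [measurable]: "g \<in> borel_measurable borel" using g by auto
    show "(\<lambda>x. Y n x * g x) \<in> borel_measurable lborel" for n by measurable
  qed (use g in auto)
  have "(LBINT x. N x + (Q x)\<^sup>2 - Q x powr (10 / 3)) = 0"
  proof (rule LIMSEQ_unique[OF cut_lim])
    have "(\<lambda>n. LBINT x. Q x * (\<Sum>i\<in>UNIV. P i x * X n i x)) \<longlonglongrightarrow> (\<integral>x. 0 \<partial>(lborel :: (real^3) measure))"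
    proof (rule integral_dominated_convergence[where w="\<lambda>x. 4 * (3 * (Q x)\<^sup>2 + N x)"])
      show "AE x in lborel. (\<lambda>n. Q x * (\<Sum>i\<in>UNIV. P i x * X n i x)) \<longlonglongrightarrow> 0"
      proof (rule AE_I2)
        fix x
        have "(\<lambda>n. Q x * (\<Sum>i\<in>UNIV. P i x * X n i x)) \<longlonglongrightarrow> Q x * (\<Sum>i\<in>UNIV. P i x * 0)"
          by (intro tendsto_intros cutoff_tendsto)
        then show "(\<lambda>n. Q x * (\<Sum>i\<in>UNIV. P i x * X n i x)) \<longlonglongrightarrow> 0" by simp
      qed
      fix n
      show "AE x in lborel. norm (Q x * (\<Sum>i\<in>UNIV. P i x * X n i x)) \<le> 4 * (3 * (Q x)\<^sup>2 + N x)"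
      proof (rule AE_I2)
        fix x
        have "norm (Q x * (\<Sum>i\<in>UNIV. P i x * X n i x)) \<le> (\<Sum>i\<in>UNIV. \<bar>Q x * (P i x * X n i x)\<bar>)"
          unfolding sum_distrib_left real_norm_def by (rule sum_abs)
        also have "\<dots> \<le> (\<Sum>i\<in>UNIV. ((Q x)\<^sup>2 + (P i x)\<^sup>2) * 4)"
          unfolding mult.assoc[symmetric] abs_mult[of _ "X n _ x"]
          by (intro sum_mono mult_mono abs_mult_le_sum_squares cutoff_partial_bound) auto
        also have "\<dots> = 4 * (3 * (Q x)\<^sup>2 + N x)" by (simp add: sum_3 algebra_simps)
        finally show "norm (Q x * (\<Sum>i\<in>UNIV. P i x * X n i x)) \<le> 4 * (3 * (Q x)\<^sup>2 + N x)" .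
      qed
    qed (use int in \<open>auto intro!: Bochner_Integration.integrable_add integrable_mult_right\<close>)
    from tendsto_minus[OF this]
    show "(\<lambda>n. LBINT x. Y n x * (N x + (Q x)\<^sup>2 - Q x powr (10 / 3))) \<longlonglongrightarrow> 0"
      unfolding Nehari_test[OF has_partials_cutoff compactly_supported_cutoff[OF pos]] by simp
  qed (use int in auto)
  then have 1: "kinetic P + (LBINT x. (Q x)\<^sup>2) = (LBINT x. Q x powr (10 / 3))"
    using int by (simp add: kinetic_def)
  have "(LBINT x. G x) = 0"
  proof (rule LIMSEQ_unique[OF cut_lim])
    let ?L = "\<lambda>x. 1 / 2 * N x + 1 / 2 * (Q x)\<^sup>2 + 3 / 10 * Q x powr (10 / 3)"
    \<comment> \<open>Each of the three components is at most 4(3 P_i^2 + N) plus 4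
      \<open>?L\<close>; the sum is 24 N + 12 \<open>?L\<close>.\<close>
    let ?w = "\<lambda>x. 24 * N x + 12 * ?L x"
    have "(\<lambda>n. LBINT x. (\<Sum>i\<in>UNIV. X n i x * (D x * P i x - x $ i * L x))) \<longlonglongrightarrow> (\<integral>x. 0 \<partial>(lborel :: (real^3) measure))"
    proof (rule integral_dominated_convergence[where w="?w"])
      show "AE x in lborel. (\<lambda>n. \<Sum>i\<in>UNIV. X n i x * (D x * P i x - x $ i * L x)) \<longlonglongrightarrow> 0"
      proof (rule AE_I2)
        fix x
        have "(\<lambda>n. \<Sum>i\<in>UNIV. X n i x * (D x * P i x - x $ i * L x)) \<longlonglongrightarrow> (\<Sum>i\<in>UNIV. 0 * (D x * P i x - x $ i * L x))"
          by (intro tendsto_sum tendsto_mult tendsto_const cutoff_tendsto)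
        then show "(\<lambda>n. \<Sum>i\<in>UNIV. X n i x * (D x * P i x - x $ i * L x)) \<longlonglongrightarrow> 0" by simp
      qed
      show "integrable lborel ?w"
        using int by (intro Bochner_Integration.integrable_add integrable_mult_right)
      fix n
      show "AE x in lborel. norm (\<Sum>i\<in>UNIV. X n i x * (D x * P i x - x $ i * L x)) \<le> ?w x"
      proof (rule AE_I2)
        fix x :: "real^3"
        have comp: "\<bar>X n i x\<bar> * \<bar>x $ j\<bar> \<le> 4" for i j
        proof -
          have "\<bar>X n i x\<bar> * \<bar>x $ j\<bar> \<le> \<bar>X n i x\<bar> * norm x"
            by (intro mult_left_mono component_le_norm_cart) auto
          also have "\<dots> \<le> 4" using norm_times_cutoff_partial[OF pos, of x n i] by (simp add: mult.commute)
          finally show ?thesis .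
        qed
        have L: "\<bar>L x\<bar> \<le> ?L x"
        proof -
          have "0 \<le> N x" by (intro sum_nonneg) auto
          then show ?thesis using zero_le_power2[of "Q x"] powr_ge_zero[of "Q x" "10 / 3"] by (simp only: abs_le_iff) linarith
        qed
        have b: "\<bar>X n i x * (D x * P i x - x $ i * L x)\<bar> \<le> 4 * (3 * (P i x)\<^sup>2 + N x) + 4 * ?L x" for i
        proof -
          have "\<bar>X n i x * (D x * P i x - x $ i * L x)\<bar> \<le> \<bar>X n i x * (D x * P i x)\<bar> + \<bar>X n i x * (x $ i * L x)\<bar>"
            unfolding right_diff_distrib by (rule abs_triangle_ineq4)
          also have "\<bar>X n i x * (x $ i * L x)\<bar> = (\<bar>X n i x\<bar> * \<bar>x $ i\<bar>) * \<bar>L x\<bar>" by (simp only: abs_mult mult.assoc)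
          also have "\<dots> \<le> 4 * ?L x" by (intro mult_mono comp L) auto
          also have "\<bar>X n i x * (D x * P i x)\<bar> = \<bar>\<Sum>j\<in>UNIV. (X n i x * x $ j) * (P j x * P i x)\<bar>"
            by (simp add: sum_distrib_left sum_distrib_right mult_ac)
          also have "\<dots> \<le> (\<Sum>j\<in>UNIV. \<bar>(X n i x * x $ j) * (P j x * P i x)\<bar>)" by (rule sum_abs)
          also have "\<dots> \<le> (\<Sum>j\<in>UNIV. 4 * ((P j x)\<^sup>2 + (P i x)\<^sup>2))"
            unfolding abs_mult[of "X n i x * _"] abs_mult[of "X n i x"]
            by (intro sum_mono mult_mono comp abs_mult_le_sum_squares) auto
          also have "\<dots> = 4 * (3 * (P i x)\<^sup>2 + N x)" by (simp add: sum_3 algebra_simps)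
          finally show ?thesis by simp
        qed
        have "norm (\<Sum>i\<in>UNIV. X n i x * (D x * P i x - x $ i * L x)) \<le> (\<Sum>i\<in>UNIV. \<bar>X n i x * (D x * P i x - x $ i * L x)\<bar>)"
          unfolding real_norm_def by (rule sum_abs)
        also have "\<dots> \<le> (\<Sum>i\<in>UNIV. 4 * (3 * (P i x)\<^sup>2 + N x) + 4 * ?L x)" by (intro sum_mono b)
        also have "\<dots> = ?w x" by (simp add: sum_3 algebra_simps)
        finally show "norm (\<Sum>i\<in>UNIV. X n i x * (D x * P i x - x $ i * L x)) \<le> ?w x" .
      qed
      show "(\<lambda>x. \<Sum>i\<in>UNIV. X n i x * (D x * P i x - x $ i * L x)) \<in> borel_measurable lborel"
        by (auto intro!: borel_measurable_continuous_onI continuous_intros c)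
    qed simp
    from tendsto_minus[OF this]
    show "(\<lambda>n. LBINT x. Y n x * G x) \<longlonglongrightarrow> 0"
      unfolding Pohozaev_test[OF has_partials_cutoff compactly_supported_cutoff[OF pos]] by simp
  qed (use int in auto)
  then have 2: "9 / 10 * (LBINT x. Q x powr (10 / 3)) = 1 / 2 * kinetic P + 3 / 2 * (LBINT x. (Q x)\<^sup>2)"
    using int by (simp add: kinetic_def)
  from 1 2 show ?thesis by linarith
qed

end

section \<open>Decay of the ground state\<close>

context ground_state
begin

abbreviation "e \<equiv> axis 1 1 :: real^3"
text \<open>The radial profile along the first axis. It makes sense for negative r too, so
  derivatives at 0 are two-sided.\<close>

abbreviation "q \<equiv> \<lambda>r. Q (r *\<^sub>R e)"
abbreviation "q' \<equiv> \<lambda>r. P 1 (r *\<^sub>R e)"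

lemma Q_eq_q: "Q x = q (norm x)"
  by (rule Q_radial) simp

lemma q_has_derivative: "(q has_real_derivative q' r) (at r)"
  using has_partials_line[OF has_partials_Q, of 0 1 r]
  by (simp add: has_real_derivative_iff_has_vector_derivative)

lemma q'_has_derivative: "(q' has_real_derivative PP 1 1 (r *\<^sub>R e)) (at r)"
  using has_partials_line[OF has_partials_P[of 1], of 0 1 r]
  by (simp add: has_real_derivative_iff_has_vector_derivative)

text \<open>The angular part of the Laplacian: on the ray through \<open>e\<close> the function \<open>Q\<close> is
  \<open>q(\<surd>(r\<^sup>2 + t\<^sup>2))\<close> at distance \<open>t\<close> in an orthogonal direction.\<close>

lemma orthogonal_second_partial:
  assumes "k \<noteq> 1" "r > 0" shows "PP k k (r *\<^sub>R e) = q' r / r"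
proof -
  let ?s = "\<lambda>t. sqrt (r\<^sup>2 + t\<^sup>2)"
  let ?x = "\<lambda>t. r *\<^sub>R e + t *\<^sub>R axis k 1"
  have pos: "r\<^sup>2 + t\<^sup>2 > 0" for t using \<open>r > 0\<close> by (simp add: add_pos_nonneg)
  have nrm: "norm (?x t) = ?s t" for t
  proof -
    have "?x t \<bullet> ?x t = r\<^sup>2 + t\<^sup>2"
      using \<open>k \<noteq> 1\<close> by (simp add: inner_simps inner_axis_axis power2_eq_square)
    then show ?thesis by (simp add: norm_eq_sqrt_inner)
  qed
  have Pk: "P k (?x t) = q' (?s t) * (t / ?s t)" for t
  proof -
    have "((\<lambda>t. Q (?x t)) has_real_derivative P k (?x t)) (at t)"
      using has_partials_line[OF has_partials_Q, of "r *\<^sub>R e" k t]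
      by (simp add: has_real_derivative_iff_has_vector_derivative)
    moreover have "((\<lambda>t. q (?s t)) has_real_derivative q' (?s t) * (t / ?s t)) (at t)"
    proof (rule DERIV_chain2[OF q_has_derivative])
      show "(?s has_real_derivative t / ?s t) (at t)"
        using pos[of t] by (auto intro!: derivative_eq_intros simp: divide_simps)
    qed
    moreover have "(\<lambda>t. Q (?x t)) = (\<lambda>t. q (?s t))"
      using Q_eq_q nrm by metis
    ultimately show ?thesis by (metis DERIV_unique)
  qed
  have s0: "?s 0 = r" using \<open>r > 0\<close> by simp
  have "((\<lambda>t. P k (?x t)) has_real_derivative PP k k (?x 0)) (at 0)"
    using has_partials_line[OF has_partials_P[of k], of "r *\<^sub>R e" k 0]
    by (simp add: has_real_derivative_iff_has_vector_derivative)
  moreover have "((\<lambda>t. q' (?s t) * (t / ?s t)) has_real_derivative q' r / r) (at 0)"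
  proof -
    have ds: "(?s has_real_derivative 0) (at 0)"
      using pos[of 0] by (auto intro!: derivative_eq_intros)
    have "((\<lambda>t. q' (?s t)) has_real_derivative PP 1 1 (?s 0 *\<^sub>R e) * 0) (at 0)"
      by (rule DERIV_chain2[OF q'_has_derivative ds])
    moreover have "((\<lambda>t. t / ?s t) has_real_derivative 1 / r) (at 0)"
      using \<open>r > 0\<close> by (auto intro!: derivative_eq_intros ds simp: s0 power2_eq_square)
    ultimately have "((\<lambda>t. q' (?s t) * (t / ?s t)) has_real_derivative
        PP 1 1 (?s 0 *\<^sub>R e) * 0 * (0 / ?s 0) + 1 / r * q' (?s 0)) (at 0)"
      by (rule DERIV_mult)
    then show ?thesis using s0 by simp
  qed
  ultimately show ?thesis unfolding Pk by (simp add: DERIV_unique)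
qed

lemma q_equation:
  assumes "r > 0" shows "PP 1 1 (r *\<^sub>R e) = q r - q r powr (7 / 3) - 2 * q' r / r"
  using Q_equation[of "r *\<^sub>R e"] orthogonal_second_partial[of 2 r] orthogonal_second_partial[of 3 r] assms
  by (simp add: sum_3)

text \<open>Mechanical energy of the radial equation q'' + 2q'/r = q - q^(7/3), with potential
  -q^2/2 + 3q^(10/3)/10; the term 2q'/r acts as friction.\<close>

abbreviation "En \<equiv> \<lambda>r. 1 / 2 * (q' r)\<^sup>2 - 1 / 2 * (q r)\<^sup>2 + 3 / 10 * q r powr (10 / 3)"

lemma En_has_derivative:
  "(En has_real_derivative q' r * (PP 1 1 (r *\<^sub>R e) - q r + q r powr (7 / 3))) (at r)"
proof -
  have "((\<lambda>r. q r powr (10 / 3)) has_real_derivative (10 / 3 * q r powr (7 / 3)) * q' r) (at r)"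
    using DERIV_chain2[OF has_real_derivative_powr[OF Q_pos] q_has_derivative, of "10 / 3" r] by simp
  then show ?thesis
    by (auto intro!: derivative_eq_intros q_has_derivative q'_has_derivative simp: Q_pos algebra_simps)
qed

text \<open>By friction the derivative on r > 0 is -2q'^2/r. The singular point 0 is reached by
  continuity only.\<close>

lemma En_le: assumes "0 \<le> r" shows "En r \<le> En 0"
proof (rule DERIV_nonpos_imp_decreasing_open[where f=En, OF assms])
  show "continuous_on {0..r} En"
    by (rule continuous_at_imp_continuous_on) (use En_has_derivative DERIV_isCont in blast)
  fix s :: real assume s: "0 < s" "s < r"
  have "q' s * (PP 1 1 (s *\<^sub>R e) - q s + q s powr (7 / 3)) = - 2 * (q' s)\<^sup>2 / s"
    unfolding q_equation[OF s(1)] by (simp add: power2_eq_square)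
  then have "(En has_real_derivative - 2 * (q' s)\<^sup>2 / s) (at s)" using En_has_derivative[of s] by simp
  then show "\<exists>y. (En has_real_derivative y) (at s) \<and> y \<le> 0"
    using s by (intro exI[of _ "- 2 * (q' s)\<^sup>2 / s"]) auto
qed

text \<open>The energy bounds q'^2 by 2 En(0) + q^2 - 3q^(10/3)/5, and q^2 - 3q^(10/3)/5 is at most
  4 because the nonlinearity wins for large q.\<close>

lemma q'_bounded: obtains B where "B > 0" "\<And>r. r \<ge> 0 \<Longrightarrow> \<bar>q' r\<bar> \<le> B"
proof -
  define h where "h = 2 * En 0 + 4"
  have "\<bar>q' r\<bar> \<le> \<bar>h\<bar> + 1" if "r \<ge> 0" for r
  proof -
  have "1 / 2 * s\<^sup>2 - 3 / 10 * s powr (10 / 3) \<le> 2" if "s > 0" for s :: real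
  proof (cases "s \<le> 2")
    case True
    then have "s\<^sup>2 \<le> 2\<^sup>2" using that by (intro power_mono) auto
    moreover have "0 \<le> s powr (10 / 3)" by simp
    ultimately show ?thesis by (simp only: power2_eq_square)
  next
    case False
    \<comment> \<open>For s > 2 the factor s^(4/3) is at least 2, so 3s^(10/3)/10 already exceeds
      s^2/2.\<close>
    then have "2 powr 1 \<le> s powr (4 / 3)"
      by (intro order_trans[OF powr_mono powr_mono2]) auto
    then have "s\<^sup>2 * 2 \<le> s\<^sup>2 * s powr (4 / 3)" by (intro mult_left_mono) auto
    also have "\<dots> = s powr (10 / 3)"
      using that powr_add[of s 2 "4 / 3"] by simp
    finally show ?thesis using zero_le_power2[of s] by linarith
  qed
  from this[OF Q_pos[of "r *\<^sub>R e"]] have "(q' r)\<^sup>2 \<le> h"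
    using En_le[OF \<open>r \<ge> 0\<close>] by (simp add: h_def)
  also have "h \<le> (\<bar>h\<bar> + 1)\<^sup>2"
  proof -
    have "(\<bar>h\<bar> + 1)\<^sup>2 = h\<^sup>2 + 2 * \<bar>h\<bar> + 1" by (simp add: power2_sum)
    then show ?thesis using abs_ge_self[of h] zero_le_power2[of h] abs_ge_zero[of h] by linarith
  qed
  finally show ?thesis by (intro power2_le_imp_le[of "\<bar>q' r\<bar>"]) auto
  qed
  then show thesis by (intro that[of "\<bar>h\<bar> + 1"]) auto
qed

text \<open>The derivative bound for the profile transfers to space because the norm is
  1-Lipschitz.\<close>

lemma Q_Lipschitz: obtains B where "B > 0" "\<And>x y. \<bar>Q x - Q y\<bar> \<le> B * norm (x - y)"
proof -
  obtain B where B: "B > 0" "\<And>r. r \<ge> 0 \<Longrightarrow> \<bar>q' r\<bar> \<le> B" by (rule q'_bounded) blast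
  have "\<bar>Q x - Q y\<bar> \<le> B * norm (x - y)" for x y
  proof -
    have "norm (q (norm x) - q (norm y)) \<le> B * norm (norm x - norm y)"
    proof (rule field_differentiable_bound[of "{0..}"])
      show "(q has_field_derivative q' r) (at r within {0..})" for r
        using q_has_derivative by (rule has_field_derivative_at_within)
    qed (use B in auto)
    also have "\<dots> \<le> B * norm (x - y)"
      using B(1) norm_triangle_ineq3[of x y] by (intro mult_left_mono) auto
    finally show ?thesis using Q_eq_q[of x] Q_eq_q[of y] by simp
  qed
  then show thesis using that B(1) by blast
qed

text \<open>If Q were at least \<epsilon> at some point far out, the Lipschitz bound would keep it
  above \<epsilon>/2 on a ball of fixed radius, and that ball would carry more mass than the whole
  tail of the L^2 integral.\<close>

lemma Q_decay:
  assumes "\<epsilon> > 0" obtains R where "R > 0" "\<And>x. R < norm x \<Longrightarrow> Q x < \<epsilon>"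
proof -
  obtain B where B: "B > 0" "\<And>x y. \<bar>Q x - Q y\<bar> \<le> B * norm (x - y)" by (rule Q_Lipschitz) blast
  \<comment> \<open>Chosen so that Q drops by at most \<epsilon>/2 from the centre of a ball of
    radius \<rho>; \<open>v\<close> is the volume of that ball.\<close>
  define \<rho> where "\<rho> = \<epsilon> / (2 * B)"
  have \<rho>: "\<rho> > 0" using assms B by (simp add: \<rho>_def)
  define v where "v = unit_ball_vol 3 * \<rho> ^ 3"
  have v: "v > 0" using \<rho> by (simp add: v_def)
  let ?T = "\<lambda>n::nat. \<lambda>x. indicator {x. real n < norm x} x * (Q x)\<^sup>2"
  have "(\<lambda>n. LBINT x. ?T n x) \<longlonglongrightarrow> (\<integral>x. 0 \<partial>(lborel :: (real^3) measure))"
  proof (rule integral_dominated_convergence[where w="\<lambda>x. (Q x)\<^sup>2"])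
    show "AE x in lborel. (\<lambda>n. ?T n x) \<longlonglongrightarrow> 0"
    proof (rule AE_I2)
      fix x :: "real^3"
      obtain m :: nat where m: "norm x \<le> real m" using real_arch_simple by blast
      have "\<forall>\<^sub>F n in sequentially. ?T n x = 0"
        using eventually_ge_at_top[of m] by eventually_elim (use m in \<open>auto simp: indicator_def\<close>)
      then show "(\<lambda>n. ?T n x) \<longlonglongrightarrow> 0" by (rule tendsto_eventually)
    qed
  qed (auto simp: integrable_Q2 indicator_def)
  then have "(\<lambda>n. LBINT x. ?T n x) \<longlonglongrightarrow> 0" by simp
  moreover have "(\<epsilon> / 2)\<^sup>2 * v > 0" using assms v by simp
  ultimately have "\<forall>\<^sub>F n in sequentially. (LBINT x. ?T n x) < (\<epsilon> / 2)\<^sup>2 * v"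
    by (rule order_tendstoD(2))
  then obtain n where n: "(LBINT x. ?T n x) < (\<epsilon> / 2)\<^sup>2 * v"
    using eventually_happens'[OF trivial_limit_sequentially] by blast
  show thesis
  proof (rule that[of "real n + \<rho>"])
    fix x :: "real^3" assume x: "real n + \<rho> < norm x"
    show "Q x < \<epsilon>"
    proof (rule ccontr)
      assume "\<not> Q x < \<epsilon>"
      have lower: "(\<epsilon> / 2)\<^sup>2 * indicator (ball x \<rho>) y \<le> ?T n y" for y
      proof (cases "y \<in> ball x \<rho>")
        case True
        then have d: "norm (x - y) < \<rho>" by (simp add: dist_norm)
        then have "B * norm (x - y) \<le> B * \<rho>" using B(1) by simp
        also have "\<dots> = \<epsilon> / 2" using B(1) by (simp add: \<rho>_def)
        finally have "Q y \<ge> \<epsilon> / 2" using B(2)[of x y] \<open>\<not> Q x < \<epsilon>\<close> by linarith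
        then have "(\<epsilon> / 2)\<^sup>2 \<le> (Q y)\<^sup>2" using assms by (intro power_mono) auto
        moreover have "real n < norm y" using d x norm_triangle_ineq2[of x y] by linarith
        ultimately show ?thesis using True by (simp add: indicator_def)
      next
        case False
        then show ?thesis by (simp add: indicator_def)
      qed
      have "(\<epsilon> / 2)\<^sup>2 * v = (LBINT y. (\<epsilon> / 2)\<^sup>2 * indicator (ball x \<rho>) y)"
        using content_ball[of \<rho> x] \<rho> by (simp add: v_def)
      also have "\<dots> \<le> (LBINT y. ?T n y)"
      proof (rule integral_mono)
        show "integrable lborel (\<lambda>y. (\<epsilon> / 2)\<^sup>2 * indicator (ball x \<rho>) y)"
          by (auto intro!: emeasure_bounded_finite)
        have "integrable lborel (\<lambda>x. indicator {x. real n < norm x} x *\<^sub>R (Q x)\<^sup>2)"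
          by (intro integrable_mult_indicator integrable_Q2) measurable
        then show "integrable lborel (?T n)" by simp
      qed (rule lower)
      finally show False using n by linarith
    qed
  qed (use \<rho> in simp)
qed

end

lemma norm_magnetic_potential_le: "(norm (magnetic_potential b x))\<^sup>2 \<le> (b / 2)\<^sup>2 * (norm x)\<^sup>2"
proof -
  have "(norm (magnetic_potential b x))\<^sup>2 = (b / 2)\<^sup>2 * ((x $ 1)\<^sup>2 + (x $ 2)\<^sup>2)"
    by (simp add: norm_vec_squared sum_3 power_mult_distrib power_divide algebra_simps)
  also have "\<dots> \<le> (b / 2)\<^sup>2 * (norm x)\<^sup>2"
    by (intro mult_left_mono) (auto simp: norm_vec_squared sum_3)
  finally show ?thesis .
qed

context ground_state
begin

text \<open>Test the equation with \<open>|x|\<^sup>2 \<chi>\<^sup>2 Q\<close>: far out \<open>Q\<^bsup>4/3\<^esup> \<le> 1/2\<close>, so that the nonlinear term is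
  absorbed by the mass term.\<close>

lemma integrable_weighted_Q: "integrable lborel (\<lambda>x. (norm x)\<^sup>2 * (Q x)\<^sup>2)"
proof -
  note int = integrable_N integrable_Q2 integrable_Q_powr
  \<comment> \<open>Solves \<epsilon>^(4/3) = 1/2, the threshold below which half of the mass term
    absorbs the nonlinearity.\<close>
  define \<epsilon> where "\<epsilon> = (1 / 2 :: real) powr (3 / 4)"
  have "\<epsilon> > 0" by (simp add: \<epsilon>_def)
  then obtain R where R: "R > 0" "\<And>x. R < norm x \<Longrightarrow> Q x < \<epsilon>" by (rule Q_decay) blast
  have far: "Q x powr (10 / 3) \<le> 1 / 2 * (Q x)\<^sup>2" if "R < norm x" for x
  proof -
    have "Q x powr (4 / 3) \<le> \<epsilon> powr (4 / 3)"
      using R(2)[OF that] Q_pos[of x] by (intro powr_mono2) auto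
    also have "\<dots> = 1 / 2" by (simp add: \<epsilon>_def powr_powr)
    finally have "(Q x)\<^sup>2 * Q x powr (4 / 3) \<le> (Q x)\<^sup>2 * (1 / 2)" by (intro mult_left_mono) auto
    moreover have "(Q x)\<^sup>2 * Q x powr (4 / 3) = Q x powr (10 / 3)"
      using Q_pos[of x] powr_add[of "Q x" 2 "4 / 3"] by simp
    ultimately show ?thesis by simp
  qed
  \<comment> \<open>The cutoff enters squared, so that \<open>W\<close> keeps a factor Y and the
    cross term can be absorbed by w P_i^2.\<close>
  define w where "w = (\<lambda>n x. (norm x)\<^sup>2 * (Y n x)\<^sup>2)"
  define W where "W = (\<lambda>n i x. (norm x)\<^sup>2 * (2 * Y n x * X n i x) + 2 * x $ i * (Y n x)\<^sup>2)"
  have pos: "real (Suc n) > 0" for n by simp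
  have w: "has_partials (w n) (W n)" for n
    unfolding w_def W_def
    by (intro has_partials_mult has_partials_norm_squared has_partials_square has_partials_cutoff)
  have cs: "compactly_supported (w n)" for n
    by (rule compactly_supported_comp[OF compactly_supported_cutoff[OF pos[of n]]]) (simp add: w_def)
  note c = has_partialsD(1,2)[OF w] continuous_Q_partials continuous_Q_powr
  show ?thesis
  \<comment> \<open>Inside radius R the weight is at most R^2. The 75 is three directions times 5^2,
    where 5 = 1 + 4 bounds |Y x_i + |x|^2 X_i| in units of |x|. The factor 2 undoes the absorbed
    half.\<close>
  proof (rule integral_Fatou(1)[where C="2 * (LBINT x. R\<^sup>2 * Q x powr (10 / 3) + 75 * (Q x)\<^sup>2)"])
    show "(\<lambda>x. (norm x)\<^sup>2 * (Q x)\<^sup>2) \<in> borel_measurable lborel" by measurable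
    show "AE x in lborel. (\<lambda>n. w n x * (Q x)\<^sup>2) \<longlonglongrightarrow> (norm x)\<^sup>2 * (Q x)\<^sup>2"
    proof (rule AE_I2)
      fix x
      have "(\<lambda>n. (norm x)\<^sup>2 * (Y n x)\<^sup>2 * (Q x)\<^sup>2) \<longlonglongrightarrow> (norm x)\<^sup>2 * 1\<^sup>2 * (Q x)\<^sup>2"
        by (intro tendsto_intros cutoff_tendsto)
      then show "(\<lambda>n. w n x * (Q x)\<^sup>2) \<longlonglongrightarrow> (norm x)\<^sup>2 * (Q x)\<^sup>2" by (simp add: w_def)
    qed
    fix n
    show wQ: "integrable lborel (\<lambda>x. w n x * (Q x)\<^sup>2)"
      by (intro integrable_compactly_supported continuous_intros c compactly_supported_mult cs)
    show "0 \<le> w n x * (Q x)\<^sup>2" for x by (simp add: w_def)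
    have i1: "integrable lborel (\<lambda>x. w n x * (N x + (Q x)\<^sup>2 - Q x powr (10 / 3)))"
      by (intro integrable_compactly_supported continuous_on_mult continuous_on_add continuous_on_diff
          continuous_on_sum continuous_on_power c compactly_supported_mult cs)
    have i2: "integrable lborel (\<lambda>x. Q x * (\<Sum>i\<in>UNIV. P i x * W n i x))"
    proof (rule integrable_compactly_supported)
      obtain R where "\<And>x. R < norm x \<Longrightarrow> w n x = 0" using cs[of n] by (auto simp: compactly_supported_def)
      from has_partials_support[OF w this] show "compactly_supported (\<lambda>x. Q x * (\<Sum>i\<in>UNIV. P i x * W n i x))"
        unfolding compactly_supported_def by (intro exI[of _ R]) simp
    qed (intro continuous_intros c)
    have "(LBINT x. 1 / 2 * (w n x * (Q x)\<^sup>2))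
        \<le> (LBINT x. (w n x * (N x + (Q x)\<^sup>2 - Q x powr (10 / 3)) + Q x * (\<Sum>i\<in>UNIV. P i x * W n i x))
              + (R\<^sup>2 * Q x powr (10 / 3) + 75 * (Q x)\<^sup>2))"
    proof (rule integral_mono)
      show "integrable lborel (\<lambda>x. 1 / 2 * (w n x * (Q x)\<^sup>2))" using wQ by (rule integrable_mult_right)
      show "integrable lborel (\<lambda>x. (w n x * (N x + (Q x)\<^sup>2 - Q x powr (10 / 3)) + Q x * (\<Sum>i\<in>UNIV. P i x * W n i x))
              + (R\<^sup>2 * Q x powr (10 / 3) + 75 * (Q x)\<^sup>2))"
        using i1 i2 int by (intro Bochner_Integration.integrable_add integrable_mult_right)
      fix x :: "real^3"
      have b: "- (w n x * (P i x)\<^sup>2 + 25 * (Q x)\<^sup>2) \<le> Q x * (P i x * W n i x)" for i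
      proof -
        let ?u = "Y n x * x $ i + (norm x)\<^sup>2 * X n i x"
        have "\<bar>?u\<bar> \<le> \<bar>Y n x * x $ i\<bar> + \<bar>(norm x)\<^sup>2 * X n i x\<bar>" by (rule abs_triangle_ineq)
        also have "\<bar>Y n x * x $ i\<bar> \<le> 1 * norm x"
          unfolding abs_mult by (intro mult_mono component_le_norm_cart) (auto simp: cutoff_bounds)
        also have "\<bar>(norm x)\<^sup>2 * X n i x\<bar> = norm x * (norm x * \<bar>X n i x\<bar>)"
          by (simp add: abs_mult power2_eq_square)
        also have "\<dots> \<le> norm x * 4" by (intro mult_left_mono norm_times_cutoff_partial pos) auto
        finally have u: "\<bar>?u\<bar> \<le> 5 * norm x" by simp
        have "\<bar>Q x * (P i x * W n i x)\<bar> = 2 * (\<bar>Y n x * P i x\<bar> * \<bar>Q x\<bar>) * \<bar>?u\<bar>"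
        proof -
          have "Q x * (P i x * W n i x) = 2 * ((Y n x * P i x) * Q x) * ?u"
            by (simp add: W_def power2_eq_square algebra_simps)
          then show ?thesis by (simp only: abs_mult abs_numeral)
        qed
        also have "\<dots> \<le> 2 * (\<bar>Y n x * P i x\<bar> * \<bar>Q x\<bar>) * (5 * norm x)"
          using u by (intro mult_left_mono) auto
        also have "\<dots> = 2 * (norm x * \<bar>Y n x * P i x\<bar>) * (5 * \<bar>Q x\<bar>)" by simp
        also have "\<dots> \<le> (norm x * \<bar>Y n x * P i x\<bar>)\<^sup>2 + (5 * \<bar>Q x\<bar>)\<^sup>2" by (rule sum_squares_bound)
        also have "\<dots> = w n x * (P i x)\<^sup>2 + 25 * (Q x)\<^sup>2" by (simp add: w_def power_mult_distrib)
        finally show ?thesis by linarith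
      qed
      have "(\<Sum>i\<in>UNIV. - (w n x * (P i x)\<^sup>2 + 25 * (Q x)\<^sup>2)) \<le> (\<Sum>i\<in>UNIV. Q x * (P i x * W n i x))"
        by (intro sum_mono b)
      then have 1: "- (w n x * N x) - 75 * (Q x)\<^sup>2 \<le> Q x * (\<Sum>i\<in>UNIV. P i x * W n i x)"
        by (simp add: sum_3 algebra_simps)
      have w0: "0 \<le> w n x" by (simp add: w_def)
      have 2: "w n x * Q x powr (10 / 3) \<le> 1 / 2 * (w n x * (Q x)\<^sup>2) + R\<^sup>2 * Q x powr (10 / 3)"
      proof (cases "R < norm x")
        case True
        have "w n x * Q x powr (10 / 3) \<le> w n x * (1 / 2 * (Q x)\<^sup>2)"
          by (intro mult_left_mono far[OF True] w0)
        moreover have "0 \<le> R\<^sup>2 * Q x powr (10 / 3)" by simp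
        ultimately show ?thesis by linarith
      next
        case False
        have "w n x \<le> R\<^sup>2 * 1\<^sup>2"
          unfolding w_def using False cutoff_bounds by (intro mult_mono power_mono) auto
        then have "w n x * Q x powr (10 / 3) \<le> R\<^sup>2 * Q x powr (10 / 3)" by (intro mult_right_mono) auto
        moreover have "0 \<le> w n x * (Q x)\<^sup>2" using w0 by simp
        ultimately show ?thesis by linarith
      qed
      from 1 2 show "1 / 2 * (w n x * (Q x)\<^sup>2) \<le> (w n x * (N x + (Q x)\<^sup>2 - Q x powr (10 / 3)) + Q x * (\<Sum>i\<in>UNIV. P i x * W n i x))
              + (R\<^sup>2 * Q x powr (10 / 3) + 75 * (Q x)\<^sup>2)"
        unfolding ring_distribs by linarith
    qed
    also have "\<dots> = (LBINT x. R\<^sup>2 * Q x powr (10 / 3) + 75 * (Q x)\<^sup>2)"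
      using i1 i2 int Nehari_test[OF w cs, of n] by simp
    finally show "(LBINT x. w n x * (Q x)\<^sup>2) \<le> 2 * (LBINT x. R\<^sup>2 * Q x powr (10 / 3) + 75 * (Q x)\<^sup>2)"
      by simp
  qed
qed

section \<open>Upper bound for the minimal energy at or above the mass of the ground state\<close>

lemma mass_Q: "mass (\<lambda>x. complex_of_real (Q x)) = (LBINT x. (Q x)\<^sup>2)"
  by (simp add: mass_eq)

lemma mass_Q_pos: "(LBINT x. (Q x)\<^sup>2) > 0"
  by (rule integral_pos_on_box[OF integrable_Q2, of 1]) (use Q_pos in \<open>auto simp: less_imp_neq[symmetric]\<close>)

text \<open>Trial functions are dilated, cut off copies of Q; the cutoff is removed at fixed scale l
  before l tends to infinity. By \<open>kinetic_P\<close> the l^2 terms contribute at most zero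
  since S is at least 1, and by the finite second moment the remaining confinement term vanishes
  like l^(-2).\<close>

lemma min_energy_nonpos:
  assumes "mass (\<lambda>x. complex_of_real (Q x)) \<le> c"
  shows "min_energy b (4 / 3) c \<le> 0"
proof -
  note int = integrable_N integrable_Q2 integrable_Q_powr
  define M K W T where "M = (LBINT x. (Q x)\<^sup>2)" and "K = kinetic P" and "W = confinement b Q"
    and "T = (LBINT x. Q x powr (10 / 3))"
  define h where "h = (\<lambda>n x. Y n x * Q x)"
  define H where "H = (\<lambda>n i x. Y n x * P i x + X n i x * Q x)"
  define Mn where "Mn = (\<lambda>n. LBINT x. (h n x)\<^sup>2)"
  have pos: "real (Suc n) > 0" for n by simp
  have M: "M > 0" "M \<le> c" using mass_Q_pos assms by (simp_all add: M_def mass_Q)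
  then have "c > 0" by simp
  have h: "has_partials (h n) (H n)" for n
    unfolding h_def H_def by (intro has_partials_mult has_partials_cutoff has_partials_Q)
  have cs: "compactly_supported (h n)" for n
    unfolding h_def by (intro compactly_supported_mult compactly_supported_cutoff pos)
  note c = has_partialsD(1,2)[OF h] continuous_Q_partials continuous_Q_powr
  have [measurable]: "h n \<in> borel_measurable borel" "H n i \<in> borel_measurable borel" for n i
    by (auto intro!: borel_measurable_continuous_onI c)
  have mA[measurable]: "(\<lambda>x. (norm (magnetic_potential b x))\<^sup>2) \<in> borel_measurable borel"
    by (rule borel_measurable_continuous_onI[OF continuous_on_norm_magnetic_potential])
  have h_lim: "(\<lambda>n. h n x) \<longlonglongrightarrow> Q x" for x
  proof -
    have "(\<lambda>n. Y n x * Q x) \<longlonglongrightarrow> 1 * Q x" by (intro tendsto_mult tendsto_const cutoff_tendsto)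
    then show ?thesis by (simp add: h_def)
  qed
  have H_lim: "(\<lambda>n. H n i x) \<longlonglongrightarrow> P i x" for i x
  proof -
    have "(\<lambda>n. Y n x * P i x + X n i x * Q x) \<longlonglongrightarrow> 1 * P i x + 0 * Q x"
      by (intro tendsto_add tendsto_mult tendsto_const cutoff_tendsto)
    then show ?thesis by (simp add: H_def)
  qed
  have h_le: "0 \<le> h n x" "h n x \<le> Q x" for n x
    using cutoff_bounds Q_pos[of x] by (auto simp: h_def mult_left_le_one_le)
  have Mn_lim: "Mn \<longlonglongrightarrow> M"
    unfolding Mn_def M_def
  proof (rule integral_dominated_convergence[where w="\<lambda>x. (Q x)\<^sup>2"])
    show "AE x in lborel. (\<lambda>n. (h n x)\<^sup>2) \<longlonglongrightarrow> (Q x)\<^sup>2" by (intro AE_I2 tendsto_power h_lim)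
    show "AE x in lborel. norm ((h n x)\<^sup>2) \<le> (Q x)\<^sup>2" for n
      using h_le by (intro AE_I2) (auto intro: power_mono)
  qed (use int in auto)
  have T_lim: "(\<lambda>n. LBINT x. \<bar>h n x\<bar> powr (10 / 3)) \<longlonglongrightarrow> T"
    unfolding T_def
  proof (rule integral_dominated_convergence[where w="\<lambda>x. Q x powr (10 / 3)"])
    show "AE x in lborel. (\<lambda>n. \<bar>h n x\<bar> powr (10 / 3)) \<longlonglongrightarrow> Q x powr (10 / 3)"
    proof (rule AE_I2)
      fix x
      have "(\<lambda>n. \<bar>h n x\<bar> powr (10 / 3)) \<longlonglongrightarrow> \<bar>Q x\<bar> powr (10 / 3)"
        using Q_pos[of x] by (intro tendsto_powr tendsto_rabs h_lim tendsto_const) auto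
      then show "(\<lambda>n. \<bar>h n x\<bar> powr (10 / 3)) \<longlonglongrightarrow> Q x powr (10 / 3)" using Q_pos[of x] by simp
    qed
    show "AE x in lborel. norm (\<bar>h n x\<bar> powr (10 / 3)) \<le> Q x powr (10 / 3)" for n
      using h_le by (intro AE_I2) (auto intro: powr_mono2)
  qed (use int in auto)
  have K_lim: "(\<lambda>n. kinetic (H n)) \<longlonglongrightarrow> K"
    unfolding K_def kinetic_def
  \<comment> \<open>Two summands cost a factor 2 under the square, and the cutoff gradient is at
    most 4: this gives 2 times 16 = 32 per direction, 96 in all.\<close>
  proof (rule integral_dominated_convergence[where w="\<lambda>x. 2 * N x + 96 * (Q x)\<^sup>2"])
    show "AE x in lborel. (\<lambda>n. \<Sum>j\<in>UNIV. (H n j x)\<^sup>2) \<longlonglongrightarrow> N x"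
      by (intro AE_I2 tendsto_sum tendsto_power H_lim)
    show "AE x in lborel. norm (\<Sum>j\<in>UNIV. (H n j x)\<^sup>2) \<le> 2 * N x + 96 * (Q x)\<^sup>2" for n
    proof (rule AE_I2)
      fix x
      have "(H n j x)\<^sup>2 \<le> 2 * (P j x)\<^sup>2 + 32 * (Q x)\<^sup>2" for j
      proof -
        have "(Y n x * P j x)\<^sup>2 \<le> 1 * (P j x)\<^sup>2"
          unfolding power_mult_distrib using cutoff_bounds by (intro mult_right_mono power_le_one) auto
        moreover have "(X n j x * Q x)\<^sup>2 \<le> 4\<^sup>2 * (Q x)\<^sup>2"
        proof -
          have "(X n j x)\<^sup>2 \<le> 4\<^sup>2"
            using cutoff_partial_bound[of "real (Suc n)" j x] by (intro abs_le_square_iff[THEN iffD1]) simp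
          then show ?thesis unfolding power_mult_distrib by (intro mult_right_mono) auto
        qed
        moreover have "(H n j x)\<^sup>2 \<le> 2 * (Y n x * P j x)\<^sup>2 + 2 * (X n j x * Q x)\<^sup>2"
          using sum_squares_bound[of "Y n x * P j x" "X n j x * Q x"] by (simp add: H_def power2_sum)
        ultimately show ?thesis by simp
      qed
      then have "(\<Sum>j\<in>UNIV. (H n j x)\<^sup>2) \<le> (\<Sum>j\<in>UNIV. 2 * (P j x)\<^sup>2 + 32 * (Q x)\<^sup>2)" by (rule sum_mono)
      then show "norm (\<Sum>j\<in>UNIV. (H n j x)\<^sup>2) \<le> 2 * N x + 96 * (Q x)\<^sup>2"
        by (simp add: sum_3 sum_nonneg)
    qed
  qed (use int in \<open>auto intro!: Bochner_Integration.integrable_add integrable_mult_right\<close>)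
  have W_lim: "(\<lambda>n. confinement b (h n)) \<longlonglongrightarrow> W"
    unfolding W_def confinement_def
  proof (rule integral_dominated_convergence[where w="\<lambda>x. (b / 2)\<^sup>2 * ((norm x)\<^sup>2 * (Q x)\<^sup>2)"])
    show "AE x in lborel. (\<lambda>n. (norm (magnetic_potential b x))\<^sup>2 * (h n x)\<^sup>2) \<longlonglongrightarrow> (norm (magnetic_potential b x))\<^sup>2 * (Q x)\<^sup>2"
      by (intro AE_I2 tendsto_mult tendsto_const tendsto_power h_lim)
    show "AE x in lborel. norm ((norm (magnetic_potential b x))\<^sup>2 * (h n x)\<^sup>2) \<le> (b / 2)\<^sup>2 * ((norm x)\<^sup>2 * (Q x)\<^sup>2)" for n
    proof (rule AE_I2)
      fix x
      have "(norm (magnetic_potential b x))\<^sup>2 * (h n x)\<^sup>2 \<le> ((b / 2)\<^sup>2 * (norm x)\<^sup>2) * (Q x)\<^sup>2"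
        using h_le by (intro mult_mono norm_magnetic_potential_le power_mono) auto
      then show "norm ((norm (magnetic_potential b x))\<^sup>2 * (h n x)\<^sup>2) \<le> (b / 2)\<^sup>2 * ((norm x)\<^sup>2 * (Q x)\<^sup>2)"
        by (simp add: mult.assoc)
    qed
    show "integrable lborel (\<lambda>x. (b / 2)\<^sup>2 * ((norm x)\<^sup>2 * (Q x)\<^sup>2))"
      by (intro integrable_mult_right integrable_weighted_Q)
  qed auto
  define S where "S = c / M"
  have S: "S \<ge> 1" using M by (simp add: S_def)
  have T0: "T \<ge> 0" unfolding T_def by (intro Bochner_Integration.integral_nonneg) auto
  have bound: "min_energy b (4 / 3) c \<le> ereal (S / 2 * W * (inverse l)\<^sup>2)" if "l > 0" for l
  proof -
    let ?a = "\<lambda>n. c / Mn n / 2 * (l\<^sup>2 * kinetic (H n) + confinement b (h n) / l\<^sup>2)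
        - (c / Mn n) powr (5 / 3) * l powr 2 * (LBINT x. \<bar>h n x\<bar> powr (10 / 3)) / (10 / 3)"
    have "\<forall>\<^sub>F n in sequentially. min_energy b (4 / 3) c \<le> ereal (?a n)"
      using order_tendstoD(1)[OF Mn_lim M(1)]
    proof eventually_elim
      case (elim n)
      have e: "(4 / 3 + 2) / 2 = (5 / 3 :: real)" "3 * (4 / 3) / 2 = (2 :: real)" "4 / 3 + 2 = (10 / 3 :: real)" by simp_all
      show ?case
        using min_energy_le_concentration[OF _ \<open>c > 0\<close> that h cs, of "4 / 3" n b] elim
        unfolding e by (simp add: Mn_def)
    qed
    moreover have "(\<lambda>n. ereal (?a n)) \<longlonglongrightarrow> ereal (S / 2 * (l\<^sup>2 * K + W / l\<^sup>2) - S powr (5 / 3) * l powr 2 * T / (10 / 3))"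
      unfolding S_def using M \<open>c > 0\<close> that
      by (intro tendsto_intros tendsto_ereal Mn_lim K_lim W_lim T_lim) auto
    ultimately have "min_energy b (4 / 3) c \<le> ereal (S / 2 * (l\<^sup>2 * K + W / l\<^sup>2) - S powr (5 / 3) * l powr 2 * T / (10 / 3))"
      by (intro tendsto_lowerbound[of _ _ sequentially]) auto
    also have "\<dots> \<le> ereal (S / 2 * (l\<^sup>2 * K + W / l\<^sup>2) - S * l powr 2 * T / (10 / 3))"
    proof -
      have "S powr 1 \<le> S powr (5 / 3)" using S by (intro powr_mono) auto
      then have "S * (l powr 2 * T / (10 / 3)) \<le> S powr (5 / 3) * (l powr 2 * T / (10 / 3))"
        using S T0 by (intro mult_right_mono) auto
      then show ?thesis by simp
    qed
    also have "S / 2 * (l\<^sup>2 * K + W / l\<^sup>2) - S * l powr 2 * T / (10 / 3) = S / 2 * W * (inverse l)\<^sup>2"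
    proof -
      have "K = 3 / 5 * T" using kinetic_P by (simp only: K_def T_def)
      moreover have "l powr 2 = l\<^sup>2" using that by simp
      moreover have "W / l\<^sup>2 = W * (inverse l)\<^sup>2" by (simp add: power_inverse divide_inverse)
      ultimately show ?thesis by (simp only:) (simp add: algebra_simps)
    qed
    finally show ?thesis .
  qed
  have "((\<lambda>l. ereal (S / 2 * W * (inverse l)\<^sup>2)) \<longlongrightarrow> ereal (S / 2 * W * 0\<^sup>2)) at_top"
    by (intro tendsto_intros tendsto_ereal tendsto_inverse_0_at_top filterlim_ident)
  moreover have "\<forall>\<^sub>F l in at_top. min_energy b (4 / 3) c \<le> ereal (S / 2 * W * (inverse l)\<^sup>2)"
    using eventually_gt_at_top[of 0] by eventually_elim (rule bound)
  ultimately have "min_energy b (4 / 3) c \<le> ereal (S / 2 * W * 0\<^sup>2)"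
    by (intro tendsto_lowerbound[of _ _ "at_top :: real filter"]) auto
  then show ?thesis by (simp add: zero_ereal_def)
qed

end

section \<open>A strict diamagnetic inequality\<close>

text \<open>In the phase of \<open>z\<close>, write \<open>d j\<close> as r_j + i m_j. The loss in
  the diamagnetic inequality is at least the sum of the m_j^2, and regularising by \<epsilon> only
  increases it. The quantity Im(d_1 conj d_2) = m_1 r_2 - r_1 m_2 is phase invariant and has a
  factor m in each product, so Young's inequality with weight \<open>t\<close> charges
  \<open>t\<close> to the loss and 1/t to the rest.\<close>

lemma diamagnetic_pointwise:
  fixes z :: complex and d :: "3 \<Rightarrow> complex"
  assumes "t > 0" "\<epsilon> > 0"
  defines "s \<equiv> sqrt ((norm z)\<^sup>2 + \<epsilon>\<^sup>2)" and "S \<equiv> \<Sum>j\<in>UNIV. (norm (d j))\<^sup>2"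
  shows "2 * \<bar>Im (d 1 * cnj (d 2))\<bar> \<le> t * (S - (\<Sum>j\<in>UNIV. (Re (cnj z * d j) / s)\<^sup>2)) + S / t"
proof -
  have s: "s > 0" "s\<^sup>2 = (norm z)\<^sup>2 + \<epsilon>\<^sup>2"
    using assms(2) by (auto simp: s_def add_nonneg_pos)
  \<comment> \<open>The inverse phase of \<open>z\<close>; where \<open>z\<close> vanishes any unit
    number works, since the modulus gradient is then zero.\<close>
  define u where "u = (if z = 0 then 1 else cnj z / of_real (norm z))"
  have u: "norm u = 1" "cnj z = of_real (norm z) * u" by (auto simp: u_def norm_divide)
  define r m where "r = (\<lambda>j. Re (u * d j))" and "m = (\<lambda>j. Im (u * d j))"
  have nrm: "(norm (d j))\<^sup>2 = (r j)\<^sup>2 + (m j)\<^sup>2" for j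
  proof -
    have "norm (d j) = norm (u * d j)" using u by (simp add: norm_mult)
    then show ?thesis by (simp add: r_def m_def cmod_power2)
  qed
  have h: "(Re (cnj z * d j) / s)\<^sup>2 \<le> (r j)\<^sup>2" for j
  proof -
    have "Re (cnj z * d j) = norm z * r j" unfolding u(2) r_def by (simp add: mult.assoc)
    then have "(Re (cnj z * d j) / s)\<^sup>2 = ((norm z)\<^sup>2 / s\<^sup>2) * (r j)\<^sup>2"
      by (simp add: power_mult_distrib power_divide)
    also have "\<dots> \<le> 1 * (r j)\<^sup>2"
    proof (intro mult_right_mono)
      have "(norm z)\<^sup>2 \<le> s\<^sup>2" by (simp add: s(2))
      then show "(norm z)\<^sup>2 / s\<^sup>2 \<le> 1" using s(1) by (subst divide_le_eq_1_pos) auto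
    qed simp
    finally show ?thesis by simp
  qed
  have "(u * d 1) * cnj (u * d 2) = (u * cnj u) * (d 1 * cnj (d 2))" by simp
  also have "u * cnj u = 1" using u(1) by (simp add: complex_norm_square[symmetric])
  finally have "Im (d 1 * cnj (d 2)) = Im ((u * d 1) * cnj (u * d 2))" by (simp only: mult_1_left)
  also have "\<dots> = m 1 * r 2 - r 1 * m 2"
  proof -
    have "Im (v * cnj w) = Im v * Re w - Re v * Im w" for v w by simp
    then show ?thesis by (simp only: r_def m_def)
  qed
  finally have im: "Im (d 1 * cnj (d 2)) = m 1 * r 2 - r 1 * m 2" .
  have young: "2 * \<bar>x * y\<bar> \<le> t * x\<^sup>2 + y\<^sup>2 / t" for x y :: real
  proof -
    have "0 \<le> (t * \<bar>x\<bar> - \<bar>y\<bar>)\<^sup>2 / t" using \<open>t > 0\<close> by simp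
    also have "\<dots> = t * x\<^sup>2 + y\<^sup>2 / t - 2 * \<bar>x * y\<bar>"
      using \<open>t > 0\<close> by (simp add: power2_eq_square field_simps abs_mult)
    finally show ?thesis by simp
  qed
  have "2 * \<bar>Im (d 1 * cnj (d 2))\<bar> \<le> 2 * \<bar>m 1 * r 2\<bar> + 2 * \<bar>m 2 * r 1\<bar>"
    unfolding im using abs_triangle_ineq4[of "m 1 * r 2" "r 1 * m 2"] by (simp add: mult.commute)
  also have "\<dots> \<le> t * ((m 1)\<^sup>2 + (m 2)\<^sup>2) + ((r 1)\<^sup>2 + (r 2)\<^sup>2) / t"
    using young[of "m 1" "r 2"] young[of "m 2" "r 1"] by (simp add: algebra_simps add_divide_distrib)
  also have "\<dots> \<le> t * (S - (\<Sum>j\<in>UNIV. (Re (cnj z * d j) / s)\<^sup>2)) + S / t"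
  proof (intro add_mono mult_left_mono divide_right_mono)
    have "S - (\<Sum>j\<in>UNIV. (r j)\<^sup>2) = (\<Sum>j\<in>UNIV. (m j)\<^sup>2)" by (simp add: S_def nrm sum.distrib)
    moreover have "(\<Sum>j\<in>UNIV. (Re (cnj z * d j) / s)\<^sup>2) \<le> (\<Sum>j\<in>UNIV. (r j)\<^sup>2)" by (intro sum_mono h)
    moreover have "(m 1)\<^sup>2 + (m 2)\<^sup>2 \<le> (\<Sum>j\<in>UNIV. (m j)\<^sup>2)" by (simp add: sum_3)
    ultimately show "(m 1)\<^sup>2 + (m 2)\<^sup>2 \<le> S - (\<Sum>j\<in>UNIV. (Re (cnj z * d j) / s)\<^sup>2)" by linarith
    show "(r 1)\<^sup>2 + (r 2)\<^sup>2 \<le> S" by (simp add: S_def nrm sum_3)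
  qed (use \<open>t > 0\<close> in auto)
  finally show ?thesis .
qed

lemma has_partials_cnj: "has_partials f F \<Longrightarrow> has_partials (\<lambda>x. cnj (f x)) (\<lambda>j x. cnj (F j x))"
  by (rule has_partials_linear[OF bounded_linear_cnj])

lemma has_partials_norm_power2:
  fixes f :: "real^3 \<Rightarrow> complex"
  assumes "has_partials f F"
  shows "has_partials (\<lambda>x. (norm (f x))\<^sup>2) (\<lambda>j x. 2 * Re (cnj (f x) * F j x))"
proof -
  have "has_partials (\<lambda>x. Re (f x * cnj (f x))) (\<lambda>j x. Re (f x * cnj (F j x) + F j x * cnj (f x)))"
    by (intro has_partials_linear[OF bounded_linear_Re] has_partials_mult has_partials_cnj assms)
  moreover have "(\<lambda>x. Re (f x * cnj (f x))) = (\<lambda>x. (norm (f x))\<^sup>2)"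
    by (simp add: fun_eq_iff complex_norm_square[symmetric] cmod_power2 power2_eq_square)
  moreover have "(\<lambda>j x. Re (f x * cnj (F j x) + F j x * cnj (f x))) = (\<lambda>j x. 2 * Re (cnj (f x) * F j x))"
    by (simp add: fun_eq_iff mult.commute)
  ultimately show ?thesis by simp
qed

text \<open>Differentiable also at zeros of f; subtracting \<epsilon> preserves compact support and
  keeps the value at most |f|.\<close>

definition regularized_modulus :: "real \<Rightarrow> (real^3 \<Rightarrow> complex) \<Rightarrow> real^3 \<Rightarrow> real" where
  "regularized_modulus \<epsilon> f x = sqrt ((norm (f x))\<^sup>2 + \<epsilon>\<^sup>2) - \<epsilon>"

definition regularized_modulus_partial ::
    "real \<Rightarrow> (real^3 \<Rightarrow> complex) \<Rightarrow> (3 \<Rightarrow> real^3 \<Rightarrow> complex) \<Rightarrow> 3 \<Rightarrow> real^3 \<Rightarrow> real" where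
  "regularized_modulus_partial \<epsilon> f F j x = Re (cnj (f x) * F j x) / sqrt ((norm (f x))\<^sup>2 + \<epsilon>\<^sup>2)"

lemma has_partials_regularized_modulus:
  assumes f: "has_partials f F" and "\<epsilon> > 0"
  shows "has_partials (regularized_modulus \<epsilon> f) (regularized_modulus_partial \<epsilon> f F)"
proof -
  let ?\<phi>' = "\<lambda>s. 1 / (2 * sqrt (s + \<epsilon>\<^sup>2))"
  have pos: "(norm (f x))\<^sup>2 + \<epsilon>\<^sup>2 > 0" for x using assms(2) by (simp add: add_nonneg_pos)
  have "has_partials (\<lambda>x. sqrt ((norm (f x))\<^sup>2 + \<epsilon>\<^sup>2) - \<epsilon>)
      (\<lambda>j x. ?\<phi>' ((norm (f x))\<^sup>2) * (2 * Re (cnj (f x) * F j x)))"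
  proof (rule has_partials_chain[OF has_partials_norm_power2[OF f], where \<phi>="\<lambda>s. sqrt (s + \<epsilon>\<^sup>2) - \<epsilon>" and \<phi>'="?\<phi>'"])
    show "((\<lambda>s. sqrt (s + \<epsilon>\<^sup>2) - \<epsilon>) has_real_derivative ?\<phi>' ((norm (f x))\<^sup>2)) (at ((norm (f x))\<^sup>2))" for x
      using pos[of x] by (auto intro!: derivative_eq_intros simp: divide_simps)
    show "continuous_on UNIV (\<lambda>x. ?\<phi>' ((norm (f x))\<^sup>2))"
      using pos by (intro continuous_intros has_partialsD[OF f]) (auto simp: less_imp_neq[symmetric])
  qed
  moreover have "1 / (2 * s) * (2 * r) = r / s" for r s :: real by simp
  ultimately show ?thesis
    by (simp only: regularized_modulus_def[abs_def] regularized_modulus_partial_def[abs_def])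
qed

lemma regularized_modulus_bounds:
  assumes "\<epsilon> > 0"
  shows "0 \<le> regularized_modulus \<epsilon> f x" "regularized_modulus \<epsilon> f x \<le> norm (f x)"
    "norm (f x) - \<epsilon> \<le> regularized_modulus \<epsilon> f x"
proof -
  have "\<epsilon> \<le> sqrt ((norm (f x))\<^sup>2 + \<epsilon>\<^sup>2)" using assms by (intro real_le_rsqrt) simp
  then show "0 \<le> regularized_modulus \<epsilon> f x" by (simp add: regularized_modulus_def)
  have "sqrt ((norm (f x))\<^sup>2 + \<epsilon>\<^sup>2) \<le> norm (f x) + \<epsilon>"
    using assms by (intro real_le_lsqrt) (auto simp: power2_sum)
  then show "regularized_modulus \<epsilon> f x \<le> norm (f x)" by (simp add: regularized_modulus_def)
  have "norm (f x) \<le> sqrt ((norm (f x))\<^sup>2 + \<epsilon>\<^sup>2)" by (intro real_le_rsqrt) simp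
  then show "norm (f x) - \<epsilon> \<le> regularized_modulus \<epsilon> f x" by (simp add: regularized_modulus_def)
qed

lemma compactly_supported_regularized_modulus:
  assumes "compactly_supported f" "\<epsilon> > 0" shows "compactly_supported (regularized_modulus \<epsilon> f)"
  by (rule compactly_supported_comp[OF assms(1)]) (use assms(2) in \<open>simp add: regularized_modulus_def\<close>)

text \<open>The commutator \<open>[\<partial>\<^sub>1 + \<i>A\<^sub>1, \<partial>\<^sub>2 + \<i>A\<^sub>2] = \<i>b\<close> in integrated form.\<close>

lemma commutator_identity:
  fixes b :: real
  assumes f: "has_partials f F" and cs: "compactly_supported f"
  defines "D \<equiv> classical_cov_gradient (magnetic_potential b) f F"
  shows "(LBINT x. Im (D x $ 1 * cnj (D x $ 2))) = b / 2 * (LBINT x. (norm (f x))\<^sup>2)"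
proof -
  let ?\<rho> = "\<lambda>x. (norm (f x))\<^sup>2" and ?R = "\<lambda>j x. 2 * Re (cnj (f x) * F j x)"
  note \<rho> = has_partials_norm_power2[OF f]
  have cs\<rho>: "compactly_supported ?\<rho>" by (rule compactly_supported_comp[OF cs]) simp
  note csF = has_partials_compactly_supported[OF f cs] has_partials_compactly_supported[OF \<rho> cs\<rho>]
  note c = has_partialsD(1,2)[OF f] has_partialsD(2)[OF \<rho>]
  have iF: "integrable lborel (\<lambda>x. F 1 x * cnj (F 2 x))"
    by (intro integrable_compactly_supported continuous_intros c compactly_supported_mult csF)
  \<comment> \<open>Exchanging the indices is the same as conjugating, so the nonmagnetic part of
    the integral is real.\<close>
  have swap: "(LBINT x. F 1 x * cnj (F 2 x)) = (LBINT x. F 2 x * cnj (F 1 x))"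
    by (rule integral_partials_swap[OF f has_partials_cnj[OF f]])
       (rule compactly_supported_comp[OF cs], simp)
  have "cnj (LBINT x. F 1 x * cnj (F 2 x)) = (LBINT x. F 2 x * cnj (F 1 x))"
    using integral_bounded_linear[OF bounded_linear_cnj iF] by (simp add: mult.commute)
  with swap have "Im (LBINT x. F 1 x * cnj (F 2 x)) = 0"
    by (simp add: complex_eq_iff)
  then have im0: "(LBINT x. Im (F 1 x * cnj (F 2 x))) = 0"
    using integral_Im[OF iF] by simp
  have div: "(LBINT x. x $ j * ?R j x) = - (LBINT x. ?\<rho> x)" for j
    using integration_by_parts[OF has_partials_component \<rho> cs\<rho>, of j j] by simp
  have iR: "integrable lborel (\<lambda>x. x $ j * ?R j x)" for j
    by (intro integrable_compactly_supported continuous_on_mult c compactly_supported_mult csF)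
       (intro continuous_intros)
  \<comment> \<open>Each cross term is -b/4 times x_j times a derivative of |f|^2 and integrates by
    parts to b/4 of the mass. The term quadratic in the potential is real and drops out.\<close>
  have "Im (D x $ 1 * cnj (D x $ 2))
      = Im (F 1 x * cnj (F 2 x)) - b / 4 * (x $ 1 * ?R 1 x) - b / 4 * (x $ 2 * ?R 2 x)" for x
    unfolding D_def by (simp add: field_simps)
  then have "(LBINT x. Im (D x $ 1 * cnj (D x $ 2)))
      = (LBINT x. Im (F 1 x * cnj (F 2 x)) - b / 4 * (x $ 1 * ?R 1 x) - b / 4 * (x $ 2 * ?R 2 x))" by simp
  also have "\<dots> = (LBINT x. Im (F 1 x * cnj (F 2 x))) - b / 4 * (LBINT x. x $ 1 * ?R 1 x)
      - b / 4 * (LBINT x. x $ 2 * ?R 2 x)"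
  proof -
    have "(LBINT x. p x - k * q x - k * r x) = (LBINT x. p x) - k * (LBINT x. q x) - k * (LBINT x. r x)"
      if "integrable lborel p" "integrable lborel q" "integrable lborel r" for k :: real and p q r :: "real^3 \<Rightarrow> real"
      using that by simp
    from this[OF integrable_Im[OF iF] iR iR] show ?thesis .
  qed
  also have "\<dots> = b / 2 * (LBINT x. ?\<rho> x)" unfolding im0 div by simp
  finally show ?thesis .
qed

text \<open>The pointwise bound integrated, with the commutator identity on the left. Once
  \<open>t\<close> is so large that G/t falls below the left side, a definite gap between the
  magnetic kinetic energy and that of the modulus follows, independent of \<epsilon>.\<close>

lemma strict_diamagnetic:
  fixes b :: real
  assumes f: "has_partials f F" and cs: "compactly_supported f" and "t > 0" "\<epsilon> > 0"
  defines "G \<equiv> LBINT x. (norm (classical_cov_gradient (magnetic_potential b) f F x))\<^sup>2"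
  shows "\<bar>b\<bar> * (LBINT x. (norm (f x))\<^sup>2) \<le> t * (G - kinetic (regularized_modulus_partial \<epsilon> f F)) + G / t"
proof -
  let ?D = "classical_cov_gradient (magnetic_potential b) f F"
  let ?H = "regularized_modulus_partial \<epsilon> f F"
  let ?M = "LBINT x. (norm (f x))\<^sup>2"
  note h = has_partials_regularized_modulus[OF f \<open>\<epsilon> > 0\<close>]
  note csH = has_partials_compactly_supported[OF h compactly_supported_regularized_modulus[OF cs \<open>\<epsilon> > 0\<close>]]
  have cD: "continuous_on UNIV ?D"
    by (rule continuous_on_classical_cov_gradient[OF f continuous_on_magnetic_potential])
  have csD: "compactly_supported ?D"
  proof -
    obtain R where R: "\<And>x. R < norm x \<Longrightarrow> f x = 0" using cs by (auto simp: compactly_supported_def)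
    have "?D x = 0" if "R < norm x" for x
      using R[OF that] has_partials_support[OF f R that] by (simp add: vec_eq_iff)
    then show ?thesis unfolding compactly_supported_def by blast
  qed
  have iD: "integrable lborel (\<lambda>x. (norm (?D x))\<^sup>2)"
    by (intro integrable_compactly_supported continuous_intros cD compactly_supported_comp[OF csD]) simp
  have iH: "integrable lborel (\<lambda>x. \<Sum>j\<in>UNIV. (?H j x)\<^sup>2)"
    by (intro Bochner_Integration.integrable_sum integrable_compactly_supported continuous_intros
        has_partialsD(2)[OF h] compactly_supported_comp[OF csH]) simp
  have iI: "integrable lborel (\<lambda>x. \<bar>Im (?D x $ 1 * cnj (?D x $ 2))\<bar>)"
    by (intro integrable_compactly_supported continuous_intros cD compactly_supported_comp[OF csD]) simp
  \<comment> \<open>The potential contributes i A_j |f|^2, whose real part is zero, so ordinary and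
    covariant derivatives give the same modulus gradient.\<close>
  have H: "?H j x = Re (cnj (f x) * ?D x $ j) / sqrt ((norm (f x))\<^sup>2 + \<epsilon>\<^sup>2)" for j x
    by (simp add: regularized_modulus_partial_def algebra_simps)
  have "0 \<le> ?M" by (intro Bochner_Integration.integral_nonneg) auto
  then have "\<bar>b\<bar> * ?M = 2 * \<bar>LBINT x. Im (?D x $ 1 * cnj (?D x $ 2))\<bar>"
    unfolding commutator_identity[OF f cs] by (simp add: abs_mult)
  also have "\<dots> \<le> 2 * (LBINT x. \<bar>Im (?D x $ 1 * cnj (?D x $ 2))\<bar>)"
    by (intro mult_left_mono integral_abs_bound) auto
  also have "\<dots> = (LBINT x. 2 * \<bar>Im (?D x $ 1 * cnj (?D x $ 2))\<bar>)" by simp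
  also have "\<dots> \<le> (LBINT x. t * ((norm (?D x))\<^sup>2 - (\<Sum>j\<in>UNIV. (?H j x)\<^sup>2)) + (norm (?D x))\<^sup>2 / t)"
  proof (rule integral_mono)
    show "2 * \<bar>Im (?D x $ 1 * cnj (?D x $ 2))\<bar> \<le> t * ((norm (?D x))\<^sup>2 - (\<Sum>j\<in>UNIV. (?H j x)\<^sup>2)) + (norm (?D x))\<^sup>2 / t" for x
      unfolding H norm_vec_squared by (rule diamagnetic_pointwise[OF \<open>t > 0\<close> \<open>\<epsilon> > 0\<close>])
  qed (use iI iD iH in auto)
  also have "\<dots> = t * (G - kinetic ?H) + G / t"
    using iD iH by (simp add: G_def kinetic_def)
  finally show ?thesis .
qed

section \<open>Mollification\<close>

text \<open>Induction over integrable functions. For an indicator, outer regularity replaces the set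
  by an open one, at whose points small shifts stay inside; sums and dominated limits follow by the
  triangle inequality.\<close>

lemma L1_translation_continuous:
  fixes f :: "real^3 \<Rightarrow> 'b::{banach, second_countable_topology}"
  assumes "integrable lborel f" and "z \<longlonglongrightarrow> 0"
  shows "(\<lambda>n. LBINT x. norm (f (x + z n) - f x)) \<longlonglongrightarrow> 0"
  using assms(1)
proof (induction f)
  case (base A c)
  have [measurable]: "A \<in> sets borel" using base by simp
  have fin: "emeasure lborel A < \<infinity>" by fact
  have "(\<lambda>n. LBINT x. \<bar>indicator A (x + z n) - indicator A x :: real\<bar>) \<longlonglongrightarrow> 0"
  proof (rule LIMSEQ_I)
    fix r :: real assume "r > 0"
    \<comment> \<open>Two copies of the set difference and twice the overlap deficit of U cost less
      than 4r/6.\<close>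
    obtain U where U: "open U" "A \<subseteq> U" "emeasure lborel (U - A) < ennreal (r / 6)"
      using outer_regular_lborel[of A "r / 6"] \<open>r > 0\<close> by auto
    have [measurable]: "U \<in> sets borel" using U(1) by simp
    have finUA: "emeasure lborel (U - A) < \<infinity>" using U(3) by (rule less_trans) simp
    have "emeasure lborel U = emeasure lborel A + emeasure lborel (U - A)"
      using U(2) by (subst plus_emeasure) (auto simp: Un_absorb1)
    then have finU: "emeasure lborel U < \<infinity>" using fin finUA by simp
    have iA: "integrable lborel (\<lambda>x. indicator A x :: real)" using fin by simp
    have iU: "integrable lborel (\<lambda>x. indicator U x :: real)" using finU by simp
    have iUz: "integrable lborel (\<lambda>x. indicator U (x + w) :: real)" for w
      by (rule lborel_integrable_translation[OF iU])
    have iAz: "integrable lborel (\<lambda>x. indicator A (x + w) :: real)" for w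
      by (rule lborel_integrable_translation[OF iA])
    have iUUz: "integrable lborel (\<lambda>x. indicator U x * indicator U (x + w) :: real)" for w
    proof (rule Bochner_Integration.integrable_bound[OF iU])
      show "(\<lambda>x. indicator U x * indicator U (x + w) :: real) \<in> borel_measurable lborel" by measurable
    qed (auto simp: indicator_def)
    have "(\<lambda>n. LBINT x. indicator U x * indicator U (x + z n)) \<longlonglongrightarrow> (LBINT x. indicator U x :: real)"
    proof (rule integral_dominated_convergence[where w="indicator U"])
      show "AE x in lborel. (\<lambda>n. indicator U x * indicator U (x + z n) :: real) \<longlonglongrightarrow> indicator U x"
      proof (rule AE_I2)
        fix x :: "real^3"
        show "(\<lambda>n. indicator U x * indicator U (x + z n) :: real) \<longlonglongrightarrow> indicator U x"
        proof (cases "x \<in> U")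
          case True
          have "(\<lambda>n. x + z n) \<longlonglongrightarrow> x + 0" using assms(2) by (intro tendsto_intros)
          then have "\<forall>\<^sub>F n in sequentially. x + z n \<in> U"
            using U(1) True topological_tendstoD by fastforce
          then have "\<forall>\<^sub>F n in sequentially. indicator U x * indicator U (x + z n) = (indicator U x :: real)"
            by eventually_elim (use True in simp)
          then show ?thesis by (rule tendsto_eventually)
        qed simp
      qed
      show "integrable lborel (indicator U :: real^3 \<Rightarrow> real)" using iU .
      show "(\<lambda>x. indicator U x * indicator U (x + z n) :: real) \<in> borel_measurable lborel" for n by measurable
      show "AE x in lborel. norm (indicator U x * indicator U (x + z n) :: real) \<le> indicator U x" for n
        by (auto simp: indicator_def)
    qed measurable
    then have "\<forall>\<^sub>F n in sequentially. (LBINT x. indicator U x :: real) - r / 6 < (LBINT x. indicator U x * indicator U (x + z n))"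
      using \<open>r > 0\<close> by (intro order_tendstoD) auto
    then obtain n0 where n0: "\<And>n. n \<ge> n0 \<Longrightarrow> (LBINT x. indicator U x :: real) - r / 6 < (LBINT x. indicator U x * indicator U (x + z n))"
      by (auto simp: eventually_sequentially)
    have UA: "(LBINT x. indicator U x - indicator A x :: real) < r / 6"
    proof -
      have "(LBINT x. indicator U x - indicator A x :: real) = (LBINT x. indicator (U - A) x)"
        using U(2) by (intro Bochner_Integration.integral_cong) (auto simp: indicator_def)
      also have "\<dots> = measure lborel (U - A)" by simp
      also have "\<dots> < r / 6"
      proof -
        have "ennreal (measure lborel (U - A)) < ennreal (r / 6)"
          using U(3) finUA by (subst emeasure_eq_ennreal_measure[symmetric]) auto
        then show ?thesis by (rule ennreal_less_iff[THEN iffD1, rotated]) simp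
      qed
      finally show ?thesis .
    qed
    show "\<exists>n0. \<forall>n\<ge>n0. norm ((LBINT x. \<bar>indicator A (x + z n) - indicator A x :: real\<bar>) - 0) < r"
    proof (intro exI allI impI)
      fix n assume n: "n \<ge> n0"
      \<comment> \<open>The last bracket equals |1_U(x + z) - 1_U(x)|, expanded so that it can be
        integrated term by term.\<close>
      have "(LBINT x. \<bar>indicator A (x + z n) - indicator A x :: real\<bar>)
          \<le> (LBINT x. (indicator U (x + z n) - indicator A (x + z n)) + (indicator U x - indicator A x)
              + ((indicator U x + indicator U (x + z n)) - 2 * (indicator U x * indicator U (x + z n))))"
      proof (rule integral_mono)
        show "integrable lborel (\<lambda>x. \<bar>indicator A (x + z n) - indicator A x :: real\<bar>)"
          using iA iAz by auto
        show "integrable lborel (\<lambda>x. (indicator U (x + z n) - indicator A (x + z n)) + (indicator U x - indicator A x)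
              + ((indicator U x + indicator U (x + z n)) - 2 * (indicator U x * indicator U (x + z n))) :: real)"
          using iA iAz iU iUz iUUz
          by (intro Bochner_Integration.integrable_add Bochner_Integration.integrable_diff integrable_mult_right)
        fix x
        show "\<bar>indicator A (x + z n) - indicator A x :: real\<bar> \<le> (indicator U (x + z n) - indicator A (x + z n)) + (indicator U x - indicator A x)
              + ((indicator U x + indicator U (x + z n)) - 2 * (indicator U x * indicator U (x + z n)))"
          using U(2) by (auto simp: indicator_def)
      qed
      also have "\<dots> = (LBINT x. indicator U (x + z n) - indicator A (x + z n)) + (LBINT x. indicator U x - indicator A x)
           + (((LBINT x. indicator U x) + (LBINT x. indicator U (x + z n))) - 2 * (LBINT x. indicator U x * indicator U (x + z n)))"
        using iA iAz iU iUz iUUz by (simp del: integral_indicator)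
      also have "(LBINT x. indicator U (x + z n) - indicator A (x + z n) :: real) = (LBINT x. indicator U x - indicator A x)"
        by (rule lborel_integral_translation) measurable
      also have "(LBINT x. indicator U (x + z n) :: real) = (LBINT x. indicator U x)"
        by (rule lborel_integral_translation) measurable
      finally have "(LBINT x. \<bar>indicator A (x + z n) - indicator A x :: real\<bar>) < r"
        using UA n0[OF n] \<open>r > 0\<close> by linarith
      moreover have "0 \<le> (LBINT x. \<bar>indicator A (x + z n) - indicator A x :: real\<bar>)"
        by (intro Bochner_Integration.integral_nonneg) auto
      ultimately show "norm ((LBINT x. \<bar>indicator A (x + z n) - indicator A x :: real\<bar>) - 0) < r" by simp
    qed
  qed
  then have "(\<lambda>n. (LBINT x. \<bar>indicator A (x + z n) - indicator A x :: real\<bar>) * norm c) \<longlonglongrightarrow> 0 * norm c"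
    by (intro tendsto_mult tendsto_const)
  moreover have "norm (indicator A (x + w) *\<^sub>R c - indicator A x *\<^sub>R c) = \<bar>indicator A (x + w) - indicator A x :: real\<bar> * norm c" for x w
    by (simp add: scaleR_diff_left[symmetric])
  ultimately show ?case by simp
next
  case (add f g)
  have int: "integrable lborel (\<lambda>x. norm (f (x + w) - f x))" if "integrable lborel f" for f :: "real^3 \<Rightarrow> 'b" and w
    using lborel_integrable_translation[OF that] that by auto
  show ?case
  proof (rule tendsto_sandwich[OF _ _ tendsto_const])
    show "\<forall>\<^sub>F n in sequentially. 0 \<le> (LBINT x. norm (f (x + z n) + g (x + z n) - (f x + g x)))"
      by (intro always_eventually allI Bochner_Integration.integral_nonneg) auto
    show "\<forall>\<^sub>F n in sequentially. (LBINT x. norm (f (x + z n) + g (x + z n) - (f x + g x)))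
        \<le> (LBINT x. norm (f (x + z n) - f x)) + (LBINT x. norm (g (x + z n) - g x))"
    proof (intro always_eventually allI)
      fix n
      have "(LBINT x. norm (f (x + z n) + g (x + z n) - (f x + g x)))
          \<le> (LBINT x. norm (f (x + z n) - f x) + norm (g (x + z n) - g x))"
        using int[OF add.hyps(1)] int[OF add.hyps(2)] int[of "\<lambda>x. f x + g x"] add.hyps
        by (intro integral_mono) (auto simp: norm_diff_triangle_ineq)
      then show "(LBINT x. norm (f (x + z n) + g (x + z n) - (f x + g x)))
        \<le> (LBINT x. norm (f (x + z n) - f x)) + (LBINT x. norm (g (x + z n) - g x))"
        using int[OF add.hyps(1)] int[OF add.hyps(2)] by simp
    qed
    show "(\<lambda>n. (LBINT x. norm (f (x + z n) - f x)) + (LBINT x. norm (g (x + z n) - g x))) \<longlonglongrightarrow> 0"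
      using tendsto_add[OF add.IH] by simp
  qed
next
  case (lim f s)
  have sf: "(\<lambda>i. LBINT x. norm (s i x - f x)) \<longlonglongrightarrow> (\<integral>x. 0 \<partial>(lborel :: (real^3) measure))"
  \<comment> \<open>The approximants satisfy |s_i| at most 2|f|, hence the factor 3.\<close>
  proof (rule integral_dominated_convergence[where w="\<lambda>x. 3 * norm (f x)"])
    show "AE x in lborel. (\<lambda>i. norm (s i x - f x)) \<longlonglongrightarrow> 0"
    proof (rule AE_I2)
      fix x :: "real^3"
      have "(\<lambda>i. s i x) \<longlonglongrightarrow> f x" using lim.hyps(2) by simp
      then show "(\<lambda>i. norm (s i x - f x)) \<longlonglongrightarrow> 0" by (intro tendsto_norm_zero) (simp add: LIM_zero)
    qed
    show "AE x in lborel. norm (norm (s i x - f x)) \<le> 3 * norm (f x)" for i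
    proof (rule AE_I2)
      fix x show "norm (norm (s i x - f x)) \<le> 3 * norm (f x)"
        using lim.hyps(3)[of x i] norm_triangle_ineq4[of "s i x" "f x"] by simp
    qed
    show "(\<lambda>x. norm (s i x - f x)) \<in> borel_measurable lborel" for i
      using lim.hyps(1)[of i] lim.hyps(4) by auto
  qed (use lim.hyps(4) in auto)
  show ?case
  proof (rule LIMSEQ_I)
    fix r :: real assume "r > 0"
    have "\<forall>\<^sub>F i in sequentially. (LBINT x. norm (s i x - f x)) < r / 3"
      using sf \<open>r > 0\<close> by (intro order_tendstoD) auto
    then obtain i where i: "(LBINT x. norm (s i x - f x)) < r / 3"
      using eventually_happens'[OF trivial_limit_sequentially] by blast
    have "\<forall>\<^sub>F n in sequentially. (LBINT x. norm (s i (x + z n) - s i x)) < r / 3"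
      using lim.IH[of i] \<open>r > 0\<close> by (intro order_tendstoD) auto
    then obtain n0 where n0: "\<And>n. n \<ge> n0 \<Longrightarrow> (LBINT x. norm (s i (x + z n) - s i x)) < r / 3"
      by (auto simp: eventually_sequentially)
    show "\<exists>n0. \<forall>n\<ge>n0. norm ((LBINT x. norm (f (x + z n) - f x)) - 0) < r"
    proof (intro exI allI impI)
      fix n assume n: "n \<ge> n0"
      have i1: "integrable lborel (\<lambda>x. norm (s i x - f x))" using lim.hyps(1)[of i] lim.hyps(4) by auto
      have i2: "integrable lborel (\<lambda>x. norm (s i (x + z n) - f (x + z n)))"
        using lborel_integrable_translation[OF i1] .
      have i3: "integrable lborel (\<lambda>x. norm (s i (x + z n) - s i x))"
        using lborel_integrable_translation[OF lim.hyps(1)[of i]] lim.hyps(1)[of i] by auto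
      have i4: "integrable lborel (\<lambda>x. norm (f (x + z n) - f x))"
        using lborel_integrable_translation[OF lim.hyps(4)] lim.hyps(4) by auto
      have "(LBINT x. norm (f (x + z n) - f x))
          \<le> (LBINT x. norm (s i (x + z n) - f (x + z n)) + norm (s i (x + z n) - s i x) + norm (s i x - f x))"
      proof (rule integral_mono[OF i4])
        show "integrable lborel (\<lambda>x. norm (s i (x + z n) - f (x + z n)) + norm (s i (x + z n) - s i x) + norm (s i x - f x))"
          using i1 i2 i3 by auto
        fix x
        have "f (x + z n) - f x = - (s i (x + z n) - f (x + z n)) + (s i (x + z n) - s i x) + (s i x - f x)" by simp
        then show "norm (f (x + z n) - f x) \<le> norm (s i (x + z n) - f (x + z n)) + norm (s i (x + z n) - s i x) + norm (s i x - f x)"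
          by (metis norm_minus_cancel norm_triangle_mono norm_triangle_ineq order_refl)
      qed
      also have "\<dots> = (LBINT x. norm (s i (x + z n) - f (x + z n))) + (LBINT x. norm (s i (x + z n) - s i x))
          + (LBINT x. norm (s i x - f x))" using i1 i2 i3 by simp
      also have "(LBINT x. norm (s i (x + z n) - f (x + z n))) = (LBINT x. norm (s i x - f x))"
        by (rule lborel_integral_translation) (use i1 in auto)
      finally have "(LBINT x. norm (f (x + z n) - f x)) < r"
        using i n0[OF n] by linarith
      moreover have "0 \<le> (LBINT x. norm (f (x + z n) - f x))"
        by (intro Bochner_Integration.integral_nonneg) auto
      ultimately show "norm ((LBINT x. norm (f (x + z n) - f x)) - 0) < r" by simp
    qed
  qed
qed

text \<open>\<open>test\<close> concerns the reflected translates because these are what is inserted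
  into the weak gradient identity. The radius \<delta> bounds how far the potential varies under the
  average.\<close>

locale mollifier =
  fixes \<eta> :: "real^3 \<Rightarrow> real" and H :: "3 \<Rightarrow> real^3 \<Rightarrow> real" and \<delta> :: real
  assumes \<delta>: "\<delta> > 0"
    and \<eta>: "has_partials \<eta> H"
    and nonneg: "\<And>x. 0 \<le> \<eta> x"
    and integral_1: "(LBINT x. \<eta> x) = 1"
    and support: "\<And>x. \<delta> < norm x \<Longrightarrow> \<eta> x = 0"
    and test: "\<And>x. test_function (\<lambda>y. complex_of_real (\<eta> (x - y)))"
begin

definition conv :: "(real^3 \<Rightarrow> complex) \<Rightarrow> real^3 \<Rightarrow> complex" where
  "conv f x = (LBINT y. \<eta> (x - y) *\<^sub>R f y)"

definition conv_partial :: "(real^3 \<Rightarrow> complex) \<Rightarrow> 3 \<Rightarrow> real^3 \<Rightarrow> complex" where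
  "conv_partial f j x = (LBINT y. H j (x - y) *\<^sub>R f y)"

lemma kernel_compactly_supported: "compactly_supported \<eta>" "compactly_supported (H j)"
proof -
  show "compactly_supported \<eta>" using support unfolding compactly_supported_def by blast
  then show "compactly_supported (H j)" by (rule has_partials_compactly_supported[OF \<eta>])
qed

lemma measurable_\<eta> [measurable]: "\<eta> \<in> borel_measurable borel" "H j \<in> borel_measurable borel"
  using has_partialsD(1,2)[OF \<eta>] by (auto intro: borel_measurable_continuous_onI)

lemma integrable_\<eta>: "integrable lborel \<eta>"
  by (rule integrable_compactly_supported[OF has_partialsD(1)[OF \<eta>] kernel_compactly_supported(1)])

lemma reflect:
  fixes x :: "real^3"
  assumes "integrable lborel g"
  shows "integrable lborel (\<lambda>y. g (x - y) :: real)" "(LBINT y. g (x - y)) = (LBINT y. g y)"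
proof -
  have [measurable]: "g \<in> borel_measurable borel" using assms by auto
  have eq: "lborel = distr lborel borel (\<lambda>y::real^3. x - y)"
  proof -
    have "lborel = density (distr lborel borel (\<lambda>y. x + (-1) *\<^sub>R y)) (\<lambda>_. ennreal (\<bar>-1\<bar> ^ DIM(real^3)))"
      using lborel_affine[of "-1" x] by (simp flip: ennreal_power)
    then show ?thesis by (simp add: density_1)
  qed
  have "integrable (distr lborel borel (\<lambda>y::real^3. x - y)) g" using assms eq by simp
  then show "integrable lborel (\<lambda>y. g (x - y))" by (subst (asm) integrable_distr_eq) auto
  have "(LBINT y. g y) = (\<integral>y. g y \<partial>(distr lborel borel (\<lambda>y::real^3. x - y)))" using eq by simp
  also have "\<dots> = (LBINT y. g (x - y))" by (rule integral_distr) auto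
  finally show "(LBINT y. g (x - y)) = (LBINT y. g y)" by simp
qed

lemma bounded_times_integrable:
  fixes f :: "real^3 \<Rightarrow> complex"
  assumes f: "integrable lborel f" and [measurable]: "g \<in> borel_measurable borel" and "\<And>y. \<bar>g y\<bar> \<le> B"
  shows "integrable lborel (\<lambda>y. g y *\<^sub>R f y)"
proof (rule Bochner_Integration.integrable_bound)
  show "integrable lborel (\<lambda>y. B * norm (f y))" using f by auto
  have [measurable]: "f \<in> borel_measurable borel" using f by auto
  show "(\<lambda>y. g y *\<^sub>R f y) \<in> borel_measurable lborel" by measurable
  show "AE y in lborel. norm (g y *\<^sub>R f y) \<le> norm (B * norm (f y))"
  proof (rule AE_I2)
    fix y
    have "\<bar>g y\<bar> * norm (f y) \<le> \<bar>B\<bar> * norm (f y)"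
      using assms(3)[of y] by (intro mult_right_mono) auto
    then show "norm (g y *\<^sub>R f y) \<le> norm (B * norm (f y))" by (simp add: abs_mult)
  qed
qed

lemma tendsto_conv:
  fixes f :: "real^3 \<Rightarrow> complex"
  assumes f: "integrable lborel f" and [measurable]: "\<And>n. k n \<in> borel_measurable borel" "k0 \<in> borel_measurable borel"
    and B: "\<And>n y. \<bar>k n y\<bar> \<le> B" and lim: "\<And>y. (\<lambda>n. k n y) \<longlonglongrightarrow> k0 y"
  shows "(\<lambda>n. LBINT y. k n y *\<^sub>R f y) \<longlonglongrightarrow> (LBINT y. k0 y *\<^sub>R f y)"
proof (rule integral_dominated_convergence[where w="\<lambda>y. B * norm (f y)"])
  have [measurable]: "f \<in> borel_measurable borel" using f by auto
  show "integrable lborel (\<lambda>y. B * norm (f y))" using f by auto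
  show "(\<lambda>y. k0 y *\<^sub>R f y) \<in> borel_measurable lborel" by measurable
  show "(\<lambda>y. k n y *\<^sub>R f y) \<in> borel_measurable lborel" for n by measurable
  show "AE y in lborel. (\<lambda>n. k n y *\<^sub>R f y) \<longlonglongrightarrow> k0 y *\<^sub>R f y"
    by (intro AE_I2 tendsto_scaleR lim tendsto_const)
  show "AE y in lborel. norm (k n y *\<^sub>R f y) \<le> B * norm (f y)" for n
    by (intro AE_I2) (simp add: B mult_right_mono)
qed

lemma continuous_conv:
  fixes f :: "real^3 \<Rightarrow> complex"
  assumes f: "integrable lborel f" and g: "continuous_on UNIV g" "compactly_supported g"
  shows "continuous_on UNIV (\<lambda>x. LBINT y. g (x - y) *\<^sub>R f y)"
  unfolding continuous_on_sequentially
proof (intro ballI allI impI)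
  fix x :: "nat \<Rightarrow> real^3" and a assume xa: "(\<forall>n. x n \<in> UNIV) \<and> x \<longlonglongrightarrow> a"
  obtain B where B: "\<And>y. norm (g y) \<le> B" using compactly_supported_bounded[OF g] by metis
  have [measurable]: "g \<in> borel_measurable borel" using g(1) by (rule borel_measurable_continuous_onI)
  have "(\<lambda>n. LBINT y. g (x n - y) *\<^sub>R f y) \<longlonglongrightarrow> (LBINT y. g (a - y) *\<^sub>R f y)"
  proof (rule tendsto_conv[OF f])
    show "\<bar>g (x n - y)\<bar> \<le> B" for n y using B[of "x n - y"] by simp
    show "(\<lambda>n. g (x n - y)) \<longlonglongrightarrow> g (a - y)" for y
    proof (rule continuous_on_tendsto_compose[OF g(1)])
      show "(\<lambda>n. x n - y) \<longlonglongrightarrow> a - y" using xa by (intro tendsto_intros) auto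
    qed auto
  qed measurable
  then show "((\<lambda>x. LBINT y. g (x - y) *\<^sub>R f y) \<circ> x) \<longlonglongrightarrow> (LBINT y. g (a - y) *\<^sub>R f y)"
    by (simp add: o_def)
qed

text \<open>Derivatives fall on the kernel: its difference quotients are bounded by the supremum of
  \<open>H j\<close>, which dominates uniformly in the step.\<close>

lemma has_partials_conv:
  assumes f: "integrable lborel f"
  shows "has_partials (conv f) (conv_partial f)"
  unfolding has_partials_def
proof (intro conjI allI)
  show "continuous_on UNIV (conv f)"
    unfolding conv_def[abs_def] by (rule continuous_conv[OF f has_partialsD(1)[OF \<eta>] kernel_compactly_supported(1)])
  fix j
  show "continuous_on UNIV (conv_partial f j)"
    unfolding conv_partial_def[abs_def] by (rule continuous_conv[OF f has_partialsD(2)[OF \<eta>] kernel_compactly_supported(2)])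
  fix x
  obtain B where B: "\<And>y. norm (H j y) \<le> B"
    using compactly_supported_bounded[OF has_partialsD(2)[OF \<eta>] kernel_compactly_supported(2)] by metis
  obtain B' where B': "\<And>y. norm (\<eta> y) \<le> B'"
    using compactly_supported_bounded[OF has_partialsD(1)[OF \<eta>] kernel_compactly_supported(1)] by metis
  have i: "integrable lborel (\<lambda>y. \<eta> (v - y) *\<^sub>R f y)" for v
    by (rule bounded_times_integrable[OF f, of _ B']) (use B' in auto)
  have "((\<lambda>t. diff_quot j t (conv f) x) \<longlongrightarrow> conv_partial f j x) (at 0)"
    unfolding tendsto_at_iff_sequentially
  proof (intro allI impI)
    fix t :: "nat \<Rightarrow> real" assume t0: "\<forall>i. t i \<in> UNIV - {0}" and tl: "t \<longlonglongrightarrow> 0"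
    have "(\<lambda>n. LBINT y. diff_quot j (t n) \<eta> (x - y) *\<^sub>R f y) \<longlonglongrightarrow> (LBINT y. H j (x - y) *\<^sub>R f y)"
    proof (rule tendsto_conv[OF f])
      show "\<bar>diff_quot j (t n) \<eta> (x - y)\<bar> \<le> B" for n y
        using has_partials_increment_bound[OF \<eta>, of "x - y" "t n" j B] B t0
        by (simp add: diff_quot_def abs_mult divide_simps)
      show "(\<lambda>n. diff_quot j (t n) \<eta> (x - y)) \<longlonglongrightarrow> H j (x - y)" for y
        using t0 by (intro diff_quot_tendsto[OF \<eta> tl]) auto
      have "diff_quot j (t n) \<eta> \<in> borel_measurable borel" for n
        by (intro borel_measurable_continuous_onI continuous_on_diff_quot has_partialsD(1)[OF \<eta>])
      then show "(\<lambda>y. diff_quot j (t n) \<eta> (x - y)) \<in> borel_measurable borel" for n by measurable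
    qed measurable
    moreover have "(LBINT y. diff_quot j s \<eta> (x - y) *\<^sub>R f y) = diff_quot j s (conv f) x" for s
    proof -
      have "(LBINT y. diff_quot j s \<eta> (x - y) *\<^sub>R f y)
          = (LBINT y. (1 / s) *\<^sub>R (\<eta> (x + s *\<^sub>R axis j 1 - y) *\<^sub>R f y - \<eta> (x - y) *\<^sub>R f y))"
      proof (rule Bochner_Integration.integral_cong[OF refl])
        fix y
        have eq: "x - y + s *\<^sub>R axis j 1 = x + s *\<^sub>R axis j 1 - y" by simp
        show "diff_quot j s \<eta> (x - y) *\<^sub>R f y
          = (1 / s) *\<^sub>R (\<eta> (x + s *\<^sub>R axis j 1 - y) *\<^sub>R f y - \<eta> (x - y) *\<^sub>R f y)"
          unfolding diff_quot_def eq by (simp add: scaleR_diff_left scaleR_diff_right diff_divide_distrib)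
      qed
      also have "\<dots> = diff_quot j s (conv f) x"
        using i by (simp add: diff_quot_def conv_def)
      finally show ?thesis .
    qed
    ultimately show "((\<lambda>t. diff_quot j t (conv f) x) \<circ> t) \<longlonglongrightarrow> conv_partial f j x"
      by (simp add: o_def conv_partial_def)
  qed
  then have "((\<lambda>t. norm (diff_quot j t (conv f) x - conv_partial f j x)) \<longlongrightarrow> 0) (at 0)"
    by (intro tendsto_norm_zero) (simp add: LIM_zero)
  then have "((\<lambda>t. norm (conv f (x + t *\<^sub>R axis j 1) - conv f x - t *\<^sub>R conv_partial f j x) / norm t) \<longlongrightarrow> 0) (at 0)"
  proof (rule Lim_transform_eventually)
    have "norm (diff_quot j t (conv f) x - conv_partial f j x)
        = norm (conv f (x + t *\<^sub>R axis j 1) - conv f x - t *\<^sub>R conv_partial f j x) / norm t" if "t \<noteq> 0" for t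
    proof -
      have "diff_quot j t (conv f) x - conv_partial f j x
          = (1 / t) *\<^sub>R (conv f (x + t *\<^sub>R axis j 1) - conv f x - t *\<^sub>R conv_partial f j x)"
        using that by (simp add: diff_quot_def scaleR_diff_right)
      then show ?thesis by (simp add: divide_inverse mult.commute)
    qed
    then show "\<forall>\<^sub>F t in at 0. norm (diff_quot j t (conv f) x - conv_partial f j x)
        = norm (conv f (x + t *\<^sub>R axis j 1) - conv f x - t *\<^sub>R conv_partial f j x) / norm t"
      by (auto simp: eventually_at_filter)
  qed
  then show "((\<lambda>t. conv f (x + t *\<^sub>R axis j 1)) has_vector_derivative conv_partial f j x) (at 0)"
    by (simp add: has_vector_derivative_def has_derivative_at bounded_linear_scaleR_left)
qed

lemma compactly_supported_conv:
  assumes "compactly_supported f" shows "compactly_supported (conv f)"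
proof -
  obtain R where R: "\<And>x. R < norm x \<Longrightarrow> f x = 0" using assms by (auto simp: compactly_supported_def)
  have "conv f x = 0" if "R + \<delta> < norm x" for x
  proof -
    have "\<eta> (x - y) *\<^sub>R f y = 0" for y
    proof (cases "R < norm y")
      case False
      then have "\<delta> < norm (x - y)" using that norm_triangle_ineq2[of x y] by linarith
      then show ?thesis by (simp add: support)
    qed (simp add: R)
    then have "(\<lambda>y. \<eta> (x - y) *\<^sub>R f y) = (\<lambda>y. 0)" by (rule ext)
    then show ?thesis by (simp only: conv_def Bochner_Integration.integral_zero)
  qed
  then show ?thesis unfolding compactly_supported_def by blast
qed

lemma locally_integrable_weighted:
  assumes "locally_integrable w"
  shows "integrable lborel (\<lambda>y. \<eta> (x - y) *\<^sub>R w y)"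
proof -
  note t = test_function_has_partials[OF test[of x]] test_function_compactly_supported[OF test[of x]]
  show ?thesis
    using locally_integrable_mult_test[OF assms has_partialsD(1)[OF t(1)] t(2)]
    by (simp add: scaleR_conv_of_real mult.commute)
qed

text \<open>Nonnegativity of the variance of |w| under the probability density \<eta>(x - y), with
  \<open>m\<close> the mean.\<close>

lemma Jensen:
  assumes w: "locally_integrable w" and w2: "integrable lborel (\<lambda>y. \<eta> (x - y) * (norm (w y))\<^sup>2)"
  shows "(norm (LBINT y. \<eta> (x - y) *\<^sub>R w y))\<^sup>2 \<le> (LBINT y. \<eta> (x - y) * (norm (w y))\<^sup>2)"
proof -
  define m where "m = (LBINT y. \<eta> (x - y) * norm (w y))"
  have i1: "integrable lborel (\<lambda>y. \<eta> (x - y) * norm (w y))"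
    using integrable_norm[OF locally_integrable_weighted[OF w, of x]] by (simp add: nonneg)
  have i0: "integrable lborel (\<lambda>y. \<eta> (x - y))" "(LBINT y. \<eta> (x - y)) = 1"
    using reflect[OF integrable_\<eta>] integral_1 by auto
  have "norm (LBINT y. \<eta> (x - y) *\<^sub>R w y) \<le> m"
    unfolding m_def using integral_norm_bound[of lborel "\<lambda>y. \<eta> (x - y) *\<^sub>R w y"] by (simp add: nonneg)
  then have "(norm (LBINT y. \<eta> (x - y) *\<^sub>R w y))\<^sup>2 \<le> m\<^sup>2" by (intro power_mono) auto
  moreover have "0 \<le> (LBINT y. \<eta> (x - y) * (norm (w y) - m)\<^sup>2)"
    by (intro Bochner_Integration.integral_nonneg) (simp add: nonneg)
  moreover have "(LBINT y. \<eta> (x - y) * (norm (w y) - m)\<^sup>2)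
      = (LBINT y. \<eta> (x - y) * (norm (w y))\<^sup>2 - 2 * m * (\<eta> (x - y) * norm (w y)) + m\<^sup>2 * \<eta> (x - y))"
    by (simp add: power2_eq_square algebra_simps)
  moreover have "\<dots> = (LBINT y. \<eta> (x - y) * (norm (w y))\<^sup>2) - 2 * m * m + m\<^sup>2 * 1"
    using w2 i1 i0 by (simp add: m_def)
  ultimately show ?thesis by (simp add: power2_eq_square)
qed

lemma integral_conv:
  fixes u :: "real^3 \<Rightarrow> real"
  assumes u: "integrable lborel u" and nn: "\<And>y. 0 \<le> u y"
  shows "integrable lborel (\<lambda>x. LBINT y. \<eta> (x - y) * u y)"
    "(LBINT x. (LBINT y. \<eta> (x - y) * u y)) = (LBINT y. u y)"
proof -
  have [measurable]: "u \<in> borel_measurable borel" using u by auto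
  have i: "integrable lborel (\<lambda>x. \<eta> (x - y))" "(LBINT x. \<eta> (x - y)) = 1" for y
    using lborel_integrable_translation[OF integrable_\<eta>, of "- y"] integral_1
      lborel_integral_translation[of \<eta> "- y"] by auto
  have int: "integrable (lborel \<Otimes>\<^sub>M lborel) (\<lambda>(y, x). \<eta> (x - y) * u y)"
  proof (rule lborel_pair.Fubini_integrable)
    show "(\<lambda>(y, x). \<eta> (x - y) * u y) \<in> borel_measurable (lborel \<Otimes>\<^sub>M lborel)" by measurable
    have "(LBINT x. norm (case (y, x) of (y, x) \<Rightarrow> \<eta> (x - y) * u y)) = u y" for y
      using i by (simp add: abs_mult nonneg nn)
    then show "integrable lborel (\<lambda>y. LBINT x. norm (case (y, x) of (y, x) \<Rightarrow> \<eta> (x - y) * u y))"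
      using u by simp
    show "AE y in lborel. integrable lborel (\<lambda>x. case (y, x) of (y, x) \<Rightarrow> \<eta> (x - y) * u y)"
      using i by (intro AE_I2) auto
  qed
  show "integrable lborel (\<lambda>x. LBINT y. \<eta> (x - y) * u y)"
    using lborel_pair.integrable_snd[OF int] .
  have "(LBINT x. (LBINT y. \<eta> (x - y) * u y)) = (LBINT y. (LBINT x. \<eta> (x - y) * u y))"
    by (rule lborel_pair.Fubini_integral[OF int])
  also have "\<dots> = (LBINT y. u y)" using i by simp
  finally show "(LBINT x. (LBINT y. \<eta> (x - y) * u y)) = (LBINT y. u y)" .
qed

lemma bounded_weight_integrable:
  fixes u :: "real^3 \<Rightarrow> real"
  assumes "integrable lborel u" shows "integrable lborel (\<lambda>y. \<eta> (x - y) * u y)"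
proof -
  obtain B where B: "\<And>y. norm (\<eta> y) \<le> B"
    using compactly_supported_bounded[OF has_partialsD(1)[OF \<eta>] kernel_compactly_supported(1)] by metis
  have [measurable]: "u \<in> borel_measurable borel" using assms by auto
  show ?thesis
  proof (rule Bochner_Integration.integrable_bound)
    show "integrable lborel (\<lambda>y. B * u y)" using assms by auto
    have "\<bar>\<eta> (x - y)\<bar> * \<bar>u y\<bar> \<le> \<bar>B\<bar> * \<bar>u y\<bar>" for y
      using B[of "x - y"] by (intro mult_right_mono) auto
    then show "AE y in lborel. norm (\<eta> (x - y) * u y) \<le> norm (B * u y)" by (simp add: abs_mult)
  qed measurable
qed

lemma mass_conv:
  assumes f: "integrable lborel f" and f2: "integrable lborel (\<lambda>x. (norm (f x))\<^sup>2)"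
  shows "(LBINT x. (norm (conv f x))\<^sup>2) \<le> (LBINT x. (norm (f x))\<^sup>2)"
proof -
  have [measurable]: "f \<in> borel_measurable borel" using f by auto
  have lf: "locally_integrable f" by (rule locally_integrable_square[OF _ f2]) auto
  have le: "(norm (conv f x))\<^sup>2 \<le> (LBINT y. \<eta> (x - y) * (norm (f y))\<^sup>2)" for x
    unfolding conv_def by (rule Jensen[OF lf bounded_weight_integrable[OF f2]])
  have [measurable]: "conv f \<in> borel_measurable borel"
    by (rule borel_measurable_continuous_onI[OF has_partialsD(1)[OF has_partials_conv[OF f]]])
  have i: "integrable lborel (\<lambda>x. (norm (conv f x))\<^sup>2)"
  proof (rule Bochner_Integration.integrable_bound[OF integral_conv(1)[OF f2]])
    show "AE x in lborel. norm ((norm (conv f x))\<^sup>2) \<le> norm (LBINT y. \<eta> (x - y) * (norm (f y))\<^sup>2)"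
      using le by (intro AE_I2) (auto intro: order_trans[OF _ abs_ge_self])
  qed auto
  have "(LBINT x. (norm (conv f x))\<^sup>2) \<le> (LBINT x. (LBINT y. \<eta> (x - y) * (norm (f y))\<^sup>2))"
    by (intro integral_mono i integral_conv(1)[OF f2] le) auto
  also have "\<dots> = (LBINT x. (norm (f x))\<^sup>2)" by (rule integral_conv(2)[OF f2]) auto
  finally show ?thesis .
qed

end

lemma locally_integrable_mult_continuous:
  assumes h: "locally_integrable h" and c: "continuous_on UNIV k"
  shows "locally_integrable (\<lambda>x. k x * h x)"
  unfolding locally_integrable_def
proof (intro conjI allI)
  have [measurable]: "h \<in> borel_measurable borel" using h by (simp add: locally_integrable_def)
  have [measurable]: "k \<in> borel_measurable borel" using c by (rule borel_measurable_continuous_onI)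
  show "(\<lambda>x. k x * h x) \<in> borel_measurable borel" by measurable
  fix a b :: "real^3"
  have "compact (k ` cbox a b)"
    using c by (intro compact_continuous_image) (auto intro: continuous_on_subset)
  then obtain B where B: "B > 0" "\<forall>y\<in>k ` cbox a b. norm y \<le> B"
    using compact_imp_bounded by (metis bounded_pos)
  show "integrable lborel (\<lambda>x. indicator (box a b) x *\<^sub>R (k x * h x))"
  proof (rule Bochner_Integration.integrable_bound)
    show "integrable lborel (\<lambda>x. B * norm (indicator (box a b) x *\<^sub>R h x))"
      using h by (intro integrable_mult_right integrable_norm) (simp add: locally_integrable_def)
    show "AE x in lborel. norm (indicator (box a b) x *\<^sub>R (k x * h x)) \<le> norm (B * norm (indicator (box a b) x *\<^sub>R h x))"
    proof (rule AE_I2)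
      fix x show "norm (indicator (box a b) x *\<^sub>R (k x * h x)) \<le> norm (B * norm (indicator (box a b) x *\<^sub>R h x))"
        using B box_subset_cbox[of a b] by (cases "x \<in> box a b") (auto simp: norm_mult intro!: mult_right_mono)
    qed
  qed measurable
qed

lemma magnetic_potential_diff: "magnetic_potential b (x - y) = magnetic_potential b x - magnetic_potential b y"
  by (simp add: vec_eq_iff forall_3 algebra_simps)

context mollifier
begin

text \<open>Linearity of the potential turns A(x) - A(y) into A(x - y), so the second summand is the
  error from freezing the potential at x while averaging over y.\<close>

definition defect :: "real \<Rightarrow> (real^3 \<Rightarrow> complex) \<Rightarrow> (real^3 \<Rightarrow> complex^3) \<Rightarrow> real^3 \<Rightarrow> 3 \<Rightarrow> real^3 \<Rightarrow> complex" where
  "defect b f g x j y = g y $ j + \<i> * of_real (magnetic_potential b (x - y) $ j) * f y"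

text \<open>The magnetic gradient commutes with the convolution up to the increment of the
  potential, which is of order \<open>\<delta>\<close> on the support of \<open>\<eta>\<close>.\<close>

lemma cov_gradient_conv:
  assumes f: "integrable lborel f" and lf: "locally_integrable f" and lg: "\<And>j. locally_integrable (\<lambda>y. g y $ j)"
    and weak: "weak_cov_gradient (magnetic_potential b) f g"
  shows "classical_cov_gradient (magnetic_potential b) (conv f) (conv_partial f) x $ j
    = (LBINT y. \<eta> (x - y) *\<^sub>R defect b f g x j y)"
proof -
  let ?A = "magnetic_potential b"
  let ?\<phi> = "\<lambda>y. complex_of_real (\<eta> (x - y))"
  have "has_partials (\<lambda>y. \<eta> ((-1) *\<^sub>R y + x)) (\<lambda>j y. (-1) *\<^sub>R H j ((-1) *\<^sub>R y + x))"
    by (rule has_partials_dilation[OF has_partials_shift[OF \<eta>]])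
  then have "has_partials ?\<phi> (\<lambda>j y. complex_of_real (- H j (x - y)))"
    by (intro has_partials_linear[OF bounded_linear_of_real]) simp
  then have part: "partial j ?\<phi> y = - complex_of_real (H j (x - y))" for y
    using partial_eqI by fastforce
  obtain B where B: "\<And>y. norm (H j y) \<le> B"
    using compactly_supported_bounded[OF has_partialsD(2)[OF \<eta>] kernel_compactly_supported(2)] by metis
  have iH: "integrable lborel (\<lambda>y. H j (x - y) *\<^sub>R f y)"
    by (rule bounded_times_integrable[OF f, of _ B]) (use B in auto)
  have i\<eta>: "integrable lborel (\<lambda>y. \<eta> (x - y) *\<^sub>R f y)" by (rule locally_integrable_weighted[OF lf])
  have iA: "integrable lborel (\<lambda>y. \<eta> (x - y) *\<^sub>R (of_real (?A y $ j) * f y))"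
    by (rule locally_integrable_weighted) 
       (intro locally_integrable_mult_continuous lf continuous_intros continuous_on_magnetic_potential)
  have ig: "integrable lborel (\<lambda>y. \<eta> (x - y) *\<^sub>R g y $ j)" by (rule locally_integrable_weighted[OF lg])
  have "(LBINT y. g y $ j * ?\<phi> y) = (LBINT y. f y * (- partial j ?\<phi> y + \<i> * of_real (?A y $ j) * ?\<phi> y))"
    using weak test[of x] unfolding weak_cov_gradient_def by blast
  then have "(LBINT y. \<eta> (x - y) *\<^sub>R g y $ j)
      = (LBINT y. H j (x - y) *\<^sub>R f y + \<i> * (\<eta> (x - y) *\<^sub>R (of_real (?A y $ j) * f y)))"
    unfolding part by (simp add: scaleR_conv_of_real algebra_simps)
  also have "\<dots> = conv_partial f j x + \<i> * (LBINT y. \<eta> (x - y) *\<^sub>R (of_real (?A y $ j) * f y))"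
  proof -
    have "(LBINT y. p y + \<i> * q y) = (LBINT y. p y) + \<i> * (LBINT y. q y)"
      if "integrable lborel p" "integrable lborel q" for p q :: "real^3 \<Rightarrow> complex"
      using that by simp
    from this[OF iH iA] show ?thesis unfolding conv_partial_def .
  qed
  finally have 1: "(LBINT y. \<eta> (x - y) *\<^sub>R g y $ j)
      = conv_partial f j x + \<i> * (LBINT y. \<eta> (x - y) *\<^sub>R (of_real (?A y $ j) * f y))" .
  have "\<eta> (x - y) *\<^sub>R defect b f g x j y = \<eta> (x - y) *\<^sub>R g y $ j
       + (\<i> * of_real (?A x $ j) * (\<eta> (x - y) *\<^sub>R f y) - \<i> * (\<eta> (x - y) *\<^sub>R (of_real (?A y $ j) * f y)))" for y
    by (simp add: defect_def magnetic_potential_diff scaleR_conv_of_real algebra_simps)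
  then have "(LBINT y. \<eta> (x - y) *\<^sub>R defect b f g x j y) = (LBINT y. \<eta> (x - y) *\<^sub>R g y $ j
       + (\<i> * of_real (?A x $ j) * (\<eta> (x - y) *\<^sub>R f y) - \<i> * (\<eta> (x - y) *\<^sub>R (of_real (?A y $ j) * f y))))" by simp
  also have "\<dots> = (LBINT y. \<eta> (x - y) *\<^sub>R g y $ j)
      + (\<i> * of_real (?A x $ j) * conv f x - \<i> * (LBINT y. \<eta> (x - y) *\<^sub>R (of_real (?A y $ j) * f y)))"
  proof -
    have "(LBINT y. p y + (k * q y - \<i> * r y)) = (LBINT y. p y) + (k * (LBINT y. q y) - \<i> * (LBINT y. r y))"
      if "integrable lborel p" "integrable lborel q" "integrable lborel r" for k and p q r :: "real^3 \<Rightarrow> complex"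
      using that by simp
    from this[OF ig i\<eta> iA] show ?thesis unfolding conv_def .
  qed
  finally show ?thesis unfolding 1 classical_cov_gradient_nth by simp
qed

text \<open>Jensen reduces the claim to an average of the squared defects. Young with weight
  \<delta> costs (1 + \<delta>)|g|^2 and (1 + 1/\<delta>)|A(x - y)|^2 |f|^2; on the support of the
  kernel |A(x - y)| is at most |b|\<delta>/2, and (1 + 1/\<delta>)\<delta>^2 = \<delta>^2 +
  \<delta>.\<close>

lemma kinetic_conv:
  assumes f: "integrable lborel f" and f2: "integrable lborel (\<lambda>x. (norm (f x))\<^sup>2)" and g: "g \<in> Lp 2"
    and weak: "weak_cov_gradient (magnetic_potential b) f g"
  shows "(LBINT x. (norm (classical_cov_gradient (magnetic_potential b) (conv f) (conv_partial f) x))\<^sup>2)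
    \<le> (1 + \<delta>) * (LBINT x. (norm (g x))\<^sup>2) + (b / 2)\<^sup>2 * (\<delta>\<^sup>2 + \<delta>) * (LBINT x. (norm (f x))\<^sup>2)"
proof -
  let ?D = "classical_cov_gradient (magnetic_potential b) (conv f) (conv_partial f)"
  let ?u = "\<lambda>y. (1 + \<delta>) * (norm (g y))\<^sup>2 + (b / 2)\<^sup>2 * (\<delta>\<^sup>2 + \<delta>) * (norm (f y))\<^sup>2"
  have [measurable]: "f \<in> borel_measurable borel" using f by auto
  have lf: "locally_integrable f" by (rule locally_integrable_square[OF _ f2]) auto
  have lg: "locally_integrable (\<lambda>y. g y $ j)" for j by (rule Lp_2_component[OF g])
  have mg[measurable]: "(\<lambda>y. g y $ j) \<in> borel_measurable borel" for j
    using lg[of j] by (simp add: locally_integrable_def)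
  have g2: "integrable lborel (\<lambda>x. (norm (g x))\<^sup>2)" using g by (simp add: Lp_2_iff)
  have iu: "integrable lborel ?u" using f2 g2 by auto
  have u0: "0 \<le> ?u y" for y using \<delta> by simp
  have lw: "locally_integrable (defect b f g x j)" for x j
  proof -
    have "locally_integrable (\<lambda>y. \<i> * of_real (magnetic_potential b (x - y) $ j) * f y)"
      unfolding magnetic_potential_diff vector_minus_component
      by (intro locally_integrable_mult_continuous lf continuous_intros continuous_on_magnetic_potential)
    with lg[of j] show ?thesis
      unfolding locally_integrable_def defect_def[abs_def] by (auto simp: scaleR_add_right)
  qed
  have young: "(norm (p + \<i> * of_real a * q))\<^sup>2 \<le> (1 + \<delta>) * (norm p)\<^sup>2 + (1 + 1 / \<delta>) * a\<^sup>2 * (norm q)\<^sup>2" for p q :: complex and a :: real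
  proof -
    have "norm (p + \<i> * of_real a * q) \<le> norm p + \<bar>a\<bar> * norm q"
      using norm_triangle_ineq[of p "\<i> * of_real a * q"] by (simp add: norm_mult)
    then have "(norm (p + \<i> * of_real a * q))\<^sup>2 \<le> (norm p + \<bar>a\<bar> * norm q)\<^sup>2" by (intro power_mono) auto
    moreover have "0 \<le> (\<delta> * norm p - \<bar>a\<bar> * norm q)\<^sup>2 / \<delta>" using \<delta> by simp
    moreover have "(\<delta> * norm p - \<bar>a\<bar> * norm q)\<^sup>2 / \<delta> = (1 + \<delta>) * (norm p)\<^sup>2 + (1 + 1 / \<delta>) * a\<^sup>2 * (norm q)\<^sup>2 - (norm p + \<bar>a\<bar> * norm q)\<^sup>2"
      using \<delta> by (simp add: power2_eq_square field_simps)
    ultimately show ?thesis by linarith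
  qed
  have defect_sum: "\<eta> (x - y) * (\<Sum>j\<in>UNIV. (norm (defect b f g x j y))\<^sup>2) \<le> \<eta> (x - y) * ?u y" for x y
  proof (cases "\<delta> < norm (x - y)")
    case False
    have "(norm (magnetic_potential b (x - y)))\<^sup>2 \<le> (b / 2)\<^sup>2 * (norm (x - y))\<^sup>2" by (rule norm_magnetic_potential_le)
    also have "\<dots> \<le> (b / 2)\<^sup>2 * \<delta>\<^sup>2" using False by (intro mult_left_mono power_mono) auto
    finally have A: "(norm (magnetic_potential b (x - y)))\<^sup>2 \<le> (b / 2)\<^sup>2 * \<delta>\<^sup>2" .
    have "(\<Sum>j\<in>UNIV. (norm (defect b f g x j y))\<^sup>2)
        \<le> (\<Sum>j\<in>UNIV. (1 + \<delta>) * (norm (g y $ j))\<^sup>2 + (1 + 1 / \<delta>) * (magnetic_potential b (x - y) $ j)\<^sup>2 * (norm (f y))\<^sup>2)"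
      unfolding defect_def by (intro sum_mono young)
    also have "\<dots> = (1 + \<delta>) * (norm (g y))\<^sup>2 + (1 + 1 / \<delta>) * (norm (magnetic_potential b (x - y)))\<^sup>2 * (norm (f y))\<^sup>2"
      by (simp add: norm_vec_squared sum.distrib sum_distrib_left sum_distrib_right)
    also have "\<dots> \<le> (1 + \<delta>) * (norm (g y))\<^sup>2 + (1 + 1 / \<delta>) * ((b / 2)\<^sup>2 * \<delta>\<^sup>2) * (norm (f y))\<^sup>2"
      using \<delta> by (intro add_left_mono mult_right_mono mult_left_mono A) auto
    also have "\<dots> = ?u y" using \<delta> by (simp add: power2_eq_square field_simps)
    finally show ?thesis by (intro mult_left_mono nonneg)
  qed (simp add: support)
  have iw: "integrable lborel (\<lambda>y. \<eta> (x - y) * (norm (defect b f g x j y))\<^sup>2)" for x j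
  proof (rule Bochner_Integration.integrable_bound[OF bounded_weight_integrable[OF iu]])
    have [measurable]: "defect b f g x j \<in> borel_measurable borel" using lw[of x j] by (simp add: locally_integrable_def)
    show "(\<lambda>y. \<eta> (x - y) * (norm (defect b f g x j y))\<^sup>2) \<in> borel_measurable lborel" by measurable
    show "AE y in lborel. norm (\<eta> (x - y) * (norm (defect b f g x j y))\<^sup>2) \<le> norm (\<eta> (x - y) * ?u y)"
    proof (rule AE_I2)
      fix y
      have "(norm (defect b f g x j y))\<^sup>2 \<le> (\<Sum>j\<in>UNIV. (norm (defect b f g x j y))\<^sup>2)"
        by (rule member_le_sum) auto
      then have "\<eta> (x - y) * (norm (defect b f g x j y))\<^sup>2 \<le> \<eta> (x - y) * ?u y"
        using order_trans[OF mult_left_mono defect_sum] nonneg by blast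
      moreover have "0 \<le> \<eta> (x - y) * (norm (defect b f g x j y))\<^sup>2" by (simp add: nonneg)
      ultimately show "norm (\<eta> (x - y) * (norm (defect b f g x j y))\<^sup>2) \<le> norm (\<eta> (x - y) * ?u y)" by simp
    qed
  qed
  have le: "(norm (?D x))\<^sup>2 \<le> (LBINT y. \<eta> (x - y) * ?u y)" for x
  proof -
    have "(norm (?D x))\<^sup>2 = (\<Sum>j\<in>UNIV. (norm (LBINT y. \<eta> (x - y) *\<^sub>R defect b f g x j y))\<^sup>2)"
      unfolding norm_vec_squared cov_gradient_conv[OF f lf lg weak] ..
    also have "\<dots> \<le> (\<Sum>j\<in>UNIV. LBINT y. \<eta> (x - y) * (norm (defect b f g x j y))\<^sup>2)"
      by (intro sum_mono Jensen lw iw)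
    also have "\<dots> = (LBINT y. \<eta> (x - y) * (\<Sum>j\<in>UNIV. (norm (defect b f g x j y))\<^sup>2))"
      using iw by (simp add: sum_distrib_left Bochner_Integration.integral_sum)
    also have "\<dots> \<le> (LBINT y. \<eta> (x - y) * ?u y)"
    proof (rule integral_mono[OF _ bounded_weight_integrable[OF iu] defect_sum])
      show "integrable lborel (\<lambda>y. \<eta> (x - y) * (\<Sum>j\<in>UNIV. (norm (defect b f g x j y))\<^sup>2))"
        unfolding sum_distrib_left by (intro Bochner_Integration.integrable_sum iw)
    qed
    finally show ?thesis .
  qed
  have [measurable]: "?D \<in> borel_measurable borel"
    by (intro borel_measurable_continuous_onI continuous_on_classical_cov_gradient[OF has_partials_conv[OF f]]
        continuous_on_magnetic_potential)
  have i: "integrable lborel (\<lambda>x. (norm (?D x))\<^sup>2)"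
  proof (rule Bochner_Integration.integrable_bound[OF integral_conv(1)[OF iu u0]])
    show "AE x in lborel. norm ((norm (?D x))\<^sup>2) \<le> norm (LBINT y. \<eta> (x - y) * ?u y)"
      using le by (intro AE_I2) (auto intro: order_trans[OF _ abs_ge_self])
  qed auto
  have "(LBINT x. (norm (?D x))\<^sup>2) \<le> (LBINT x. (LBINT y. \<eta> (x - y) * ?u y))"
    by (intro integral_mono i integral_conv(1)[OF iu u0] le)
  also have "\<dots> = (LBINT y. ?u y)" by (rule integral_conv(2)[OF iu u0])
  also have "\<dots> = (1 + \<delta>) * (LBINT x. (norm (g x))\<^sup>2) + (b / 2)\<^sup>2 * (\<delta>\<^sup>2 + \<delta>) * (LBINT x. (norm (f x))\<^sup>2)"
    using f2 g2 by simp
  finally show ?thesis .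
qed

text \<open>The error \<open>conv f\<close> - f averages the increments f(x + z) - f(x) with weight
  \<eta>(-z), and Tonelli brings the x integral inside. Working with nonnegative integrals yields
  integrability as a result.\<close>

lemma L1_conv:
  assumes f: "integrable lborel f" and \<omega>: "\<And>z. norm z \<le> \<delta> \<Longrightarrow> (LBINT x. norm (f (x + z) - f x)) \<le> \<epsilon>"
  shows "integrable lborel (\<lambda>x. norm (conv f x - f x))" "(LBINT x. norm (conv f x - f x)) \<le> \<epsilon>"
proof -
  have [measurable]: "f \<in> borel_measurable borel" using f by auto
  have [measurable]: "conv f \<in> borel_measurable borel"
    by (rule borel_measurable_continuous_onI[OF has_partialsD(1)[OF has_partials_conv[OF f]]])
  have "0 \<le> (LBINT x. norm (f (x + 0) - f x))" by simp
  also have "\<dots> \<le> \<epsilon>" using \<delta> by (intro \<omega>) simp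
  finally have \<epsilon>: "0 \<le> \<epsilon>" .
  obtain B where B: "\<And>y. norm (\<eta> y) \<le> B"
    using compactly_supported_bounded[OF has_partialsD(1)[OF \<eta>] kernel_compactly_supported(1)] by metis
  have i\<eta>: "integrable lborel (\<lambda>z. \<eta> (- z))" "(LBINT z. \<eta> (- z)) = 1"
    using reflect[OF integrable_\<eta>, of 0] integral_1 by auto
  have point: "ennreal (norm (conv f x - f x)) \<le> (\<integral>\<^sup>+z. ennreal (\<eta> (- z) * norm (f (x + z) - f x)) \<partial>lborel)" for x
  proof -
    have i1: "integrable lborel (\<lambda>y. \<eta> (x - y) *\<^sub>R f y)"
      by (rule bounded_times_integrable[OF f, of _ B]) (use B in auto)
    have i2: "integrable lborel (\<lambda>y. \<eta> (x - y) *\<^sub>R f x)" "(LBINT y. \<eta> (x - y)) = 1"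
      using reflect[OF integrable_\<eta>, of x] integral_1 by auto
    have "conv f x - f x = (LBINT y. \<eta> (x - y) *\<^sub>R f y) - (LBINT y. \<eta> (x - y) *\<^sub>R f x)"
      using i2 reflect(1)[OF integrable_\<eta>, of x] by (simp add: conv_def)
    also have "\<dots> = (LBINT y. \<eta> (x - y) *\<^sub>R (f y - f x))"
      using i1 i2 by (simp add: scaleR_diff_right)
    also have "\<dots> = (LBINT z. \<eta> (x - (z + x)) *\<^sub>R (f (z + x) - f x))"
      by (rule lborel_integral_translation[symmetric]) measurable
    also have "\<dots> = (LBINT z. \<eta> (- z) *\<^sub>R (f (x + z) - f x))" by (simp add: add.commute)
    finally have eq: "conv f x - f x = (LBINT z. \<eta> (- z) *\<^sub>R (f (x + z) - f x))" .
    have "integrable lborel (\<lambda>z. \<eta> (- z) *\<^sub>R (f (x + z) - f x))"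
    proof -
      have "integrable lborel (\<lambda>y. \<eta> (x - y) *\<^sub>R (f y - f x))" using i1 i2 by (simp add: scaleR_diff_right)
      from lborel_integrable_translation[OF this, of x] show ?thesis by (simp add: add.commute)
    qed
    then have "ennreal (norm (LBINT z. \<eta> (- z) *\<^sub>R (f (x + z) - f x)))
        \<le> (\<integral>\<^sup>+z. ennreal (norm (\<eta> (- z) *\<^sub>R (f (x + z) - f x))) \<partial>lborel)"
      by (rule integral_norm_bound_ennreal)
    then show ?thesis unfolding eq by (simp add: nonneg)
  qed
  have "(\<integral>\<^sup>+x. ennreal (norm (conv f x - f x)) \<partial>lborel)
      \<le> (\<integral>\<^sup>+x. (\<integral>\<^sup>+z. ennreal (\<eta> (- z) * norm (f (x + z) - f x)) \<partial>lborel) \<partial>lborel)"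
    by (intro nn_integral_mono point)
  also have "\<dots> = (\<integral>\<^sup>+z. (\<integral>\<^sup>+x. ennreal (\<eta> (- z) * norm (f (x + z) - f x)) \<partial>lborel) \<partial>lborel)"
    by (rule lborel_pair.Fubini') measurable
  also have "\<dots> \<le> (\<integral>\<^sup>+z. ennreal (\<eta> (- z)) * ennreal \<epsilon> \<partial>lborel)"
  proof (rule nn_integral_mono)
    fix z
    have "(\<integral>\<^sup>+x. ennreal (\<eta> (- z) * norm (f (x + z) - f x)) \<partial>lborel)
        = ennreal (\<eta> (- z)) * (\<integral>\<^sup>+x. ennreal (norm (f (x + z) - f x)) \<partial>lborel)"
      by (simp add: ennreal_mult nonneg nn_integral_cmult)
    also have "(\<integral>\<^sup>+x. ennreal (norm (f (x + z) - f x)) \<partial>lborel) = ennreal (LBINT x. norm (f (x + z) - f x))"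
      using f lborel_integrable_translation[OF f] by (intro nn_integral_eq_integral) auto
    also have "ennreal (\<eta> (- z)) * \<dots> \<le> ennreal (\<eta> (- z)) * ennreal \<epsilon>"
    proof (cases "norm z \<le> \<delta>")
      case True
      then show ?thesis by (intro mult_left_mono ennreal_leI \<omega>) auto
    next
      case False
      then have "\<eta> (- z) = 0" by (intro support) simp
      then show ?thesis by simp
    qed
    finally show "(\<integral>\<^sup>+x. ennreal (\<eta> (- z) * norm (f (x + z) - f x)) \<partial>lborel) \<le> ennreal (\<eta> (- z)) * ennreal \<epsilon>" .
  qed
  also have "\<dots> = (\<integral>\<^sup>+z. ennreal (\<eta> (- z)) \<partial>lborel) * ennreal \<epsilon>"
    by (rule nn_integral_multc) measurable
  also have "(\<integral>\<^sup>+z. ennreal (\<eta> (- z)) \<partial>lborel) = 1"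
    using i\<eta> nonneg by (simp add: nn_integral_eq_integral)
  finally have fin: "(\<integral>\<^sup>+x. ennreal (norm (conv f x - f x)) \<partial>lborel) \<le> ennreal \<epsilon>" by simp
  show int: "integrable lborel (\<lambda>x. norm (conv f x - f x))"
    using fin by (intro integrableI_nonneg) (auto intro: le_less_trans)
  have "ennreal (LBINT x. norm (conv f x - f x)) \<le> ennreal \<epsilon>"
    using fin nn_integral_eq_integral[OF int] by simp
  then show "(LBINT x. norm (conv f x - f x)) \<le> \<epsilon>" using \<epsilon> by simp
qed

end

section \<open>Existence of mollifiers\<close>

lemma Ck_const: "Ck k (\<lambda>x. c)"
proof (induction k arbitrary: c)
  case (Suc k)
  have "partial j (\<lambda>x. c) = (\<lambda>x. 0)" for j by (intro ext partial_eqI has_partials_const)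
  then show ?case using Suc by simp
qed (auto intro: continuous_intros)

lemma test_function_cmult:
  assumes "test_function \<phi>" shows "test_function (\<lambda>x. c * \<phi> x)"
proof -
  obtain K where K: "compact K" "\<forall>x. x \<notin> K \<longrightarrow> \<phi> x = 0" using assms by (auto simp: test_function_def)
  have "Ck k (\<lambda>x. c * \<phi> x)" for k
    using assms by (intro Ck_mult Ck_const) (auto simp: test_function_def)
  then show ?thesis using K unfolding test_function_def by (intro conjI allI exI[of _ K]) auto
qed

lemma has_partials_Re_test:
  assumes "test_function (\<lambda>x. complex_of_real (h x))"
  shows "has_partials h (\<lambda>j x. Re (partial j (\<lambda>x. complex_of_real (h x)) x))"
  using has_partials_linear[OF bounded_linear_Re test_function_has_partials[OF assms]] by simp

lemma compactly_supported_Re_test: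
  assumes "test_function (\<lambda>x. complex_of_real (h x))" shows "compactly_supported h"
  by (rule compactly_supported_comp[OF test_function_compactly_supported[OF assms]]) simp

lemma bump_trial:
  assumes "n > 0"
  obtains H where "has_partials (bump n a b) H" "compactly_supported (bump n a b)"
proof -
  note t = test_function_bump[OF assms, of a b]
  show thesis
    by (rule that[OF has_partials_Re_test[OF t] compactly_supported_Re_test[OF t]])
qed

lemma integral_bump_powr_pos:
  assumes "r > 0" "p > 0" shows "(LBINT x. bump 1 (vec (- r)) (vec r) x powr p) > 0"
proof -
  obtain H where H: "has_partials (bump 1 (vec (- r)) (vec r)) H" and cs: "compactly_supported (bump 1 (vec (- r)) (vec r))"
    by (rule bump_trial[of 1]) simp
  show ?thesis
  proof (rule integral_pos_on_box[OF _ _ \<open>r > 0\<close>])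
    have "continuous_on UNIV (\<lambda>x. bump 1 (vec (- r)) (vec r) x powr p)"
      using \<open>p > 0\<close> by (intro continuous_on_powr' has_partialsD(1)[OF H] continuous_on_const) (auto simp: bump_bounds)
    moreover have "compactly_supported (\<lambda>x. bump 1 (vec (- r)) (vec r) x powr p)"
      by (rule compactly_supported_comp[OF cs]) simp
    ultimately show "integrable lborel (\<lambda>x. bump 1 (vec (- r)) (vec r) x powr p)"
      by (rule integrable_compactly_supported)
    show "0 < bump 1 (vec (- r)) (vec r) x powr p" if "x \<in> box (vec (- r)) (vec r)" for x
      using bump_pos_iff[of 1 "vec (- r)" "vec r" x] that by simp
  qed simp
qed

lemma mollifier_exists:
  assumes "\<delta> > 0" shows "\<exists>\<eta> H. mollifier \<eta> H \<delta>"
proof -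
  \<comment> \<open>A point of the box has l^1 norm at most 3r = \<delta>, so the box lies in the
    ball of radius \<delta>.\<close>
  define r where "r = \<delta> / 3"
  have r: "r > 0" using assms by (simp add: r_def)
  define B where "B = bump 1 (vec (- r)) (vec r)"
  define I where "I = (LBINT x. B x)"
  have I: "I > 0" using integral_bump_powr_pos[OF r, of 1] by (simp add: I_def B_def bump_bounds)
  define \<eta> where "\<eta> = (\<lambda>x. B x / I)"
  have t: "test_function (\<lambda>y. complex_of_real (\<eta> (x - y)))" for x
  proof -
    \<comment> \<open>Reflection swaps the two factors of each \<open>bump1\<close>, so the
      reflected translate is a bump on the box centred at x.\<close>
    have "B (x - y) = bump 1 (x - vec r) (x + vec r) y" for y
      unfolding B_def bump_def bump1_def by (intro prod.cong) (auto simp: mult.commute algebra_simps)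
    then have "(\<lambda>y. complex_of_real (\<eta> (x - y))) = (\<lambda>y. of_real (1 / I) * of_real (bump 1 (x - vec r) (x + vec r) y))"
      by (simp add: \<eta>_def)
    then show ?thesis by (simp only:) (intro test_function_cmult test_function_bump, simp)
  qed
  have tB: "test_function (\<lambda>x. complex_of_real (\<eta> x))"
  proof -
    have "(\<lambda>x. complex_of_real (\<eta> x)) = (\<lambda>x. of_real (1 / I) * of_real (B x))" by (simp add: \<eta>_def)
    then show ?thesis unfolding B_def by (simp only:) (intro test_function_cmult test_function_bump, simp)
  qed
  have "mollifier \<eta> (\<lambda>j x. Re (partial j (\<lambda>x. complex_of_real (\<eta> x)) x)) \<delta>"
  proof
    show "has_partials \<eta> (\<lambda>j x. Re (partial j (\<lambda>x. complex_of_real (\<eta> x)) x))"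
      by (rule has_partials_Re_test[OF tB])
    show "0 \<le> \<eta> x" for x using I bump_bounds by (simp add: \<eta>_def B_def)
    show "(LBINT x. \<eta> x) = 1" using I by (simp add: \<eta>_def I_def)
    show "\<eta> x = 0" if "\<delta> < norm x" for x
    proof -
      have "x \<notin> box (vec (- r)) (vec r)"
      proof
        assume "x \<in> box (vec (- r)) (vec r)"
        then have "\<bar>x $ i\<bar> \<le> r" for i by (auto simp: mem_box_cart abs_le_iff less_imp_le minus_less_iff)
        then have "(\<Sum>i\<in>UNIV. \<bar>x $ i\<bar>) \<le> (\<Sum>i\<in>(UNIV::3 set). r)" by (rule sum_mono)
        also have "\<dots> = \<delta>" by (simp add: r_def)
        finally show False using norm_le_l1_cart[of x] that by linarith
      qed
      then show ?thesis by (simp add: \<eta>_def B_def bump_eq_0)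
    qed
  qed (use assms t in auto)
  then show ?thesis by blast
qed

text \<open>Smooth of all orders, unlike \<open>cutoff\<close>, because it multiplies test
  functions. Each coordinate contributes exp(-2) at the centre, so exp 6 normalises the value there
  to 1; the sharpness 1/R makes all radii dilations of one profile.\<close>

definition smooth_cutoff :: "real \<Rightarrow> real^3 \<Rightarrow> real" where
  "smooth_cutoff R x = exp 6 * bump (1 / R) (vec (- R)) (vec R) x"

lemma exp_6: "exp 6 * exp (- 2) ^ 3 = (1 :: real)"
proof -
  have "exp (- 2) ^ 3 = exp (real 3 * (- 2))" by (rule exp_of_nat_mult[symmetric])
  then show ?thesis by (simp add: exp_add[symmetric])
qed

text \<open>The negated exponents add up to 2/(1 - t^2), which is least at the centre.\<close>

lemma bump1_le: "bump1 1 (- 1) 1 t \<le> exp (- 2)"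
proof (cases "\<bar>t\<bar> < 1")
  case True
  then have p: "1 - t > 0" "1 + t > 0" "1 - t\<^sup>2 > 0" by (auto simp: abs_square_less_1)
  have "1 / (1 + t) + 1 / (1 - t) = 2 / (1 - t\<^sup>2)" using p by (simp add: field_simps power2_eq_square)
  also have "2 / (1 - t\<^sup>2) \<ge> 2" using p by (simp add: pos_le_divide_eq)
  finally have "2 \<le> 1 / (1 + t) + 1 / (1 - t)" .
  then show ?thesis using p by (simp add: bump1_def flat_def exp_add[symmetric] add.commute)
next
  case False
  then have "t \<le> - 1 \<or> 1 \<le> t" by auto
  then show ?thesis by (auto simp: bump1_def flat_def)
qed

lemma smooth_cutoff_dilation:
  assumes "R > 0" shows "smooth_cutoff R x = smooth_cutoff 1 ((1 / R) *\<^sub>R x)"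
proof -
  have "bump1 (1 / R) (- R) R (x $ i) = bump1 1 (- 1) 1 (x $ i / R)" for i
    using assms by (simp add: bump1_def field_simps)
  then show ?thesis by (simp add: smooth_cutoff_def bump_def)
qed

lemma smooth_cutoff_bounds:
  assumes "R > 0" shows "0 \<le> smooth_cutoff R x" "smooth_cutoff R x \<le> 1"
proof -
  show "0 \<le> smooth_cutoff R x" by (simp add: smooth_cutoff_def bump_bounds)
  have "smooth_cutoff R x = exp 6 * (\<Prod>i\<in>UNIV. bump1 1 (- 1) 1 (x $ i / R))"
    unfolding smooth_cutoff_dilation[OF assms] by (simp add: smooth_cutoff_def bump_def)
  also have "\<dots> \<le> exp 6 * (\<Prod>i\<in>(UNIV::3 set). exp (- 2))"
    by (intro mult_left_mono prod_mono) (auto simp: bump1_le bump1_bounds)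
  also have "\<dots> = 1" by (simp add: exp_6)
  finally show "smooth_cutoff R x \<le> 1" .
qed

lemma test_function_smooth_cutoff: "R > 0 \<Longrightarrow> test_function (\<lambda>x. complex_of_real (smooth_cutoff R x))"
  unfolding smooth_cutoff_def of_real_mult by (intro test_function_cmult test_function_bump) simp

text \<open>All radii share one profile \<open>T\<close>, so the partial derivatives are at most B/R
  and disappear in the limit.\<close>

lemma smooth_cutoff_partials:
  obtains T B where "\<And>R. R > 0 \<Longrightarrow> has_partials (smooth_cutoff R) (\<lambda>j x. (1 / R) * T j ((1 / R) *\<^sub>R x))"
    "\<And>j x. \<bar>T j x\<bar> \<le> (B :: real)" "\<And>j. T j \<in> borel_measurable borel"
proof -
  note t = test_function_smooth_cutoff[of 1, simplified]
  obtain T where T: "has_partials (smooth_cutoff 1) T" using has_partials_Re_test[OF t] by blast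
  note cs = has_partials_compactly_supported[OF T compactly_supported_Re_test[OF t]]
  have "\<exists>B. \<forall>x. \<bar>T j x\<bar> \<le> B" for j
    using compactly_supported_bounded[OF has_partialsD(2)[OF T] cs, of j] by (metis real_norm_def)
  then obtain B where B: "\<And>j x. \<bar>T j x\<bar> \<le> B j" by metis
  show thesis
  proof (rule that[of T "\<Sum>j\<in>UNIV. \<bar>B j\<bar>"])
    show "has_partials (smooth_cutoff R) (\<lambda>j x. (1 / R) * T j ((1 / R) *\<^sub>R x))" if "R > 0" for R
    proof -
      have "smooth_cutoff R = (\<lambda>x. smooth_cutoff 1 ((1 / R) *\<^sub>R x))"
        using smooth_cutoff_dilation[OF that] by (rule ext)
      then show ?thesis using has_partials_dilation[OF T, of "1 / R"] by simp
    qed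
    show "\<bar>T j x\<bar> \<le> (\<Sum>j\<in>UNIV. \<bar>B j\<bar>)" for j x
    proof -
      have "\<bar>B j\<bar> \<le> (\<Sum>j\<in>UNIV. \<bar>B j\<bar>)" by (rule member_le_sum) auto
      then show ?thesis using B[of j x] by linarith
    qed
    show "T j \<in> borel_measurable borel" for j
      by (rule borel_measurable_continuous_onI[OF has_partialsD(2)[OF T]])
  qed
qed

lemma smooth_cutoff_tendsto: "(\<lambda>n. smooth_cutoff (real (Suc n)) x) \<longlonglongrightarrow> 1"
proof -
  note c = has_partialsD(1)[OF has_partials_Re_test[OF test_function_smooth_cutoff[of 1, simplified]]]
  have "(\<lambda>n. (1 / real (Suc n)) *\<^sub>R x) \<longlonglongrightarrow> 0 *\<^sub>R x" by (intro tendsto_intros null_step_seq)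
  then have "(\<lambda>n. smooth_cutoff 1 ((1 / real (Suc n)) *\<^sub>R x)) \<longlonglongrightarrow> smooth_cutoff 1 0"
    by (intro continuous_on_tendsto_compose[OF c]) auto
  moreover have "smooth_cutoff 1 0 = 1"
    by (simp add: smooth_cutoff_def bump_def bump1_def flat_def exp_add[symmetric] exp_6)
  moreover have "smooth_cutoff (real (Suc n)) x = smooth_cutoff 1 ((1 / real (Suc n)) *\<^sub>R x)" for n
    by (rule smooth_cutoff_dilation) simp
  ultimately show ?thesis by simp
qed

text \<open>Weak Leibniz rule: \<theta> times a test function is again a test function, and its
  derivative produces the extra term with \<open>T\<close>.\<close>

lemma weak_cov_gradient_cutoff:
  assumes weak: "weak_cov_gradient A f g" and A: "\<And>j. continuous_on UNIV (\<lambda>x. A x $ j)"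
    and lf: "locally_integrable f" and lg: "\<And>j. locally_integrable (\<lambda>y. g y $ j)"
    and t: "test_function (\<lambda>x. complex_of_real (\<theta> x))" and \<theta>: "has_partials \<theta> T"
  shows "weak_cov_gradient A (\<lambda>x. of_real (\<theta> x) * f x) (\<lambda>x. \<chi> j. of_real (\<theta> x) * g x $ j + of_real (T j x) * f x)"
  unfolding weak_cov_gradient_def
proof (intro allI impI)
  fix \<phi> :: "real^3 \<Rightarrow> complex" and j assume t': "test_function \<phi>"
  let ?\<theta> = "\<lambda>x. complex_of_real (\<theta> x)"
  note p = test_function_has_partials[OF t'] and cs = test_function_compactly_supported[OF t']
  note tt = test_function_mult[OF t t']
  note c = has_partialsD(1,2)[OF p] has_partialsD(1,2)[OF \<theta>] A
  have part: "partial j (\<lambda>x. ?\<theta> x * \<phi> x) x = ?\<theta> x * partial j \<phi> x + of_real (T j x) * \<phi> x" for x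
    by (rule partial_eqI[OF has_partials_mult[OF has_partials_linear[OF bounded_linear_of_real \<theta>] p]])
  have i1: "integrable lborel (\<lambda>x. g x $ j * (?\<theta> x * \<phi> x))"
    by (intro locally_integrable_mult_test lg continuous_intros c compactly_supported_mult(2) cs)
  have i2: "integrable lborel (\<lambda>x. f x * (of_real (T j x) * \<phi> x))"
    by (intro locally_integrable_mult_test lf continuous_intros c compactly_supported_mult(2) cs)
  have i3: "integrable lborel (\<lambda>x. f x * (- partial j (\<lambda>x. ?\<theta> x * \<phi> x) x + \<i> * of_real (A x $ j) * (?\<theta> x * \<phi> x)))"
  proof (rule locally_integrable_mult_test[OF lf])
    obtain R where R: "\<And>x. R < norm x \<Longrightarrow> \<phi> x = 0" using cs by (auto simp: compactly_supported_def)
    from has_partials_support[OF p R]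
    show "compactly_supported (\<lambda>x. - partial j (\<lambda>x. ?\<theta> x * \<phi> x) x + \<i> * of_real (A x $ j) * (?\<theta> x * \<phi> x))"
      unfolding part compactly_supported_def by (intro exI[of _ R]) (simp add: R)
  qed (unfold part, intro continuous_intros c)
  have "(LBINT x. (\<chi> j. ?\<theta> x * g x $ j + of_real (T j x) * f x) $ j * \<phi> x)
      = (LBINT x. g x $ j * (?\<theta> x * \<phi> x) + f x * (of_real (T j x) * \<phi> x))"
    by (simp add: algebra_simps)
  also have "\<dots> = (LBINT x. g x $ j * (?\<theta> x * \<phi> x)) + (LBINT x. f x * (of_real (T j x) * \<phi> x))"
    by (rule Bochner_Integration.integral_add[OF i1 i2])
  also have "(LBINT x. g x $ j * (?\<theta> x * \<phi> x))
      = (LBINT x. f x * (- partial j (\<lambda>x. ?\<theta> x * \<phi> x) x + \<i> * of_real (A x $ j) * (?\<theta> x * \<phi> x)))"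
    using weak tt unfolding weak_cov_gradient_def by blast
  also have "\<dots> + (LBINT x. f x * (of_real (T j x) * \<phi> x))
      = (LBINT x. f x * (- partial j (\<lambda>x. ?\<theta> x * \<phi> x) x + \<i> * of_real (A x $ j) * (?\<theta> x * \<phi> x)) + f x * (of_real (T j x) * \<phi> x))"
    by (rule Bochner_Integration.integral_add[OF i3 i2, symmetric])
  also have "\<dots> = (LBINT x. ?\<theta> x * f x * (- partial j \<phi> x + \<i> * of_real (A x $ j) * \<phi> x))"
    unfolding part by (intro Bochner_Integration.integral_cong) (auto simp: algebra_simps)
  finally show "(LBINT x. (\<chi> j. ?\<theta> x * g x $ j + of_real (T j x) * f x) $ j * \<phi> x)
      = (LBINT x. ?\<theta> x * f x * (- partial j \<phi> x + \<i> * of_real (A x $ j) * \<phi> x))" .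
qed

text \<open>Otherwise a sequence of shifts tending to 0 would contradict
  \<open>L1_translation_continuous\<close>.\<close>

lemma L1_modulus:
  fixes f :: "real^3 \<Rightarrow> complex"
  assumes f: "integrable lborel f" and "\<epsilon> > 0"
  shows "\<exists>\<delta>>0. \<forall>z. norm z \<le> \<delta> \<longrightarrow> (LBINT x. norm (f (x + z) - f x)) \<le> \<epsilon>"
proof (rule ccontr)
  assume "\<not> ?thesis"
  then have "\<exists>z. norm z \<le> 1 / real (Suc n) \<and> \<not> (LBINT x. norm (f (x + z) - f x)) \<le> \<epsilon>" for n
    by (metis of_nat_0_less_iff zero_less_Suc zero_less_divide_1_iff)
  then obtain z where z: "\<And>n. norm (z n) \<le> 1 / real (Suc n)"
    and big: "\<And>n. \<not> (LBINT x. norm (f (x + z n) - f x)) \<le> \<epsilon>" by metis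
  have "z \<longlonglongrightarrow> 0"
    by (rule Lim_null_comparison[OF _ null_step_seq(1)]) (use z in auto)
  from order_tendstoD(2)[OF L1_translation_continuous[OF f this] \<open>\<epsilon> > 0\<close>]
  obtain n where "(LBINT x. norm (f (x + z n) - f x)) < \<epsilon>"
    using eventually_happens'[OF trivial_limit_sequentially] by blast
  then show False using big[of n] by simp
qed

section \<open>Regular compactly supported approximations in the magnetic space\<close>

lemma borel_measurable_vecI:
  fixes g :: "'a \<Rightarrow> complex ^ 'n"
  assumes [measurable]: "\<And>j. (\<lambda>x. g x $ j) \<in> borel_measurable M"
  shows "g \<in> borel_measurable M"
proof (subst borel_measurable_euclidean_space, intro ballI)
  fix i :: "complex ^ 'n" assume "i \<in> Basis"
  then obtain j c where "i = axis j c" by (auto simp: Basis_vec_def)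
  then show "(\<lambda>x. g x \<bullet> i) \<in> borel_measurable M" by (simp add: inner_axis)
qed

text \<open>Cutting off makes f integrable with compact support, then mollifying makes it regular.
  Neither step increases the mass. Kinetic energies are controlled from above because cutoff
  gradients vanish and the mollification radius tends to 0; L^1 closeness gives almost everywhere
  convergence of a subsequence.\<close>

lemma smooth_approximation:
  fixes b :: real
  defines "A \<equiv> magnetic_potential b"
  assumes f: "f \<in> H1 A"
  obtains u U where "\<And>n. has_partials (u n) (U n)" "\<And>n. compactly_supported (u n)"
    "\<And>n. (LBINT x. (norm (u n x))\<^sup>2) \<le> (LBINT x. (norm (f x))\<^sup>2)"
    "\<And>\<epsilon>. \<epsilon> > 0 \<Longrightarrow> \<forall>\<^sub>F n in sequentially. (LBINT x. (norm (classical_cov_gradient A (u n) (U n) x))\<^sup>2)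
       < (LBINT x. (norm (cov_gradient A f x))\<^sup>2) + \<epsilon>"
    "AE x in lborel. (\<lambda>n. u n x) \<longlonglongrightarrow> f x"
proof -
  let ?g = "cov_gradient A f"
  define M where "M = (LBINT x. (norm (f x))\<^sup>2)"
  define G where "G = (LBINT x. (norm (?g x))\<^sup>2)"
  note g = cov_gradient_props[OF f]
  have f2: "integrable lborel (\<lambda>x. (norm (f x))\<^sup>2)" and mf[measurable]: "f \<in> borel_measurable borel"
    using f by (auto simp: H1_def Lp_2_iff)
  have g2: "integrable lborel (\<lambda>x. (norm (?g x))\<^sup>2)" and mg[measurable]: "?g \<in> borel_measurable borel"
    using g(1) by (auto simp: Lp_2_iff)
  have lf: "locally_integrable f" by (rule locally_integrable_square[OF mf f2])
  have lg: "locally_integrable (\<lambda>x. ?g x $ j)" for j by (rule Lp_2_component[OF g(1)])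
  have mgj[measurable]: "(\<lambda>x. ?g x $ j) \<in> borel_measurable borel" for j
    using lg[of j] by (simp add: locally_integrable_def)
  have A: "continuous_on UNIV (\<lambda>x. A x $ j)" for j unfolding A_def by (rule continuous_on_magnetic_potential)
  obtain T B where T: "\<And>R. R > 0 \<Longrightarrow> has_partials (smooth_cutoff R) (\<lambda>j x. (1 / R) * T j ((1 / R) *\<^sub>R x))"
    and B: "\<And>j x. \<bar>T j x\<bar> \<le> (B :: real)" and mT[measurable]: "\<And>j. T j \<in> borel_measurable borel"
    by (rule smooth_cutoff_partials) blast
  define \<theta> where "\<theta> = (\<lambda>n. smooth_cutoff (real (Suc n)))"
  define \<theta>' where "\<theta>' = (\<lambda>n j x. (1 / real (Suc n)) * T j ((1 / real (Suc n)) *\<^sub>R x))"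
  have \<theta>: "has_partials (\<theta> n) (\<theta>' n)" for n unfolding \<theta>_def \<theta>'_def by (rule T) simp
  have \<theta>_test: "test_function (\<lambda>x. complex_of_real (\<theta> n x))" for n
    unfolding \<theta>_def by (rule test_function_smooth_cutoff) simp
  have \<theta>_bounds: "0 \<le> \<theta> n x" "\<theta> n x \<le> 1" for n x
    unfolding \<theta>_def by (rule smooth_cutoff_bounds; simp)+
  have \<theta>'_bound: "\<bar>\<theta>' n j x\<bar> \<le> 1 / real (Suc n) * B" for n j x
    unfolding \<theta>'_def abs_mult using B by (intro mult_mono) auto
  have B0: "B \<ge> 0" using B[of 1 0] by linarith
  have [measurable]: "\<theta> n \<in> borel_measurable borel" "\<theta>' n j \<in> borel_measurable borel" for n j
    using has_partialsD(1,2)[OF \<theta>] by (auto intro: borel_measurable_continuous_onI)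
  define v where "v = (\<lambda>n x. of_real (\<theta> n x) * f x)"
  define w where "w = (\<lambda>n x. \<chi> j. of_real (\<theta> n x) * ?g x $ j + of_real (\<theta>' n j x) * f x)"
  have weak: "weak_cov_gradient A (v n) (w n)" for n
    unfolding v_def w_def by (rule weak_cov_gradient_cutoff[OF g(2) A lf lg \<theta>_test \<theta>])
  have v_le: "norm (v n x) \<le> norm (f x)" for n x
    using \<theta>_bounds by (simp add: v_def norm_mult mult_left_le_one_le)
  have v1: "integrable lborel (v n)" for n
    using locally_integrable_mult_test[OF lf has_partialsD(1)[OF test_function_has_partials[OF \<theta>_test[of n]]]
        test_function_compactly_supported[OF \<theta>_test[of n]]] by (simp add: v_def mult.commute)
  have [measurable]: "v n \<in> borel_measurable borel" for n using v1[of n] by auto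
  have v2: "integrable lborel (\<lambda>x. (norm (v n x))\<^sup>2)" for n
    by (rule Bochner_Integration.integrable_bound[OF f2]) (auto intro!: power_mono v_le)
  have v_mass: "(LBINT x. (norm (v n x))\<^sup>2) \<le> M" for n
    unfolding M_def by (intro integral_mono v2 f2 power_mono v_le) auto
  have v_cs: "compactly_supported (v n)" for n
    unfolding v_def by (intro compactly_supported_mult test_function_compactly_supported[OF \<theta>_test])
  have w_meas[measurable]: "w n \<in> borel_measurable borel" for n
    by (rule borel_measurable_vecI) (simp add: w_def)
  have w_bound: "(norm (w n x))\<^sup>2 \<le> 2 * (norm (?g x))\<^sup>2 + 6 * B\<^sup>2 * (norm (f x))\<^sup>2" for n x
  proof -
    have "(norm (w n x $ j))\<^sup>2 \<le> 2 * (norm (?g x $ j))\<^sup>2 + 2 * B\<^sup>2 * (norm (f x))\<^sup>2" for j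
    proof -
      have "norm (w n x $ j) \<le> \<bar>\<theta> n x\<bar> * norm (?g x $ j) + \<bar>\<theta>' n j x\<bar> * norm (f x)"
        using norm_triangle_ineq[of "of_real (\<theta> n x) * ?g x $ j" "of_real (\<theta>' n j x) * f x"] by (simp add: w_def norm_mult)
      also have "\<dots> \<le> 1 * norm (?g x $ j) + B * norm (f x)"
      proof (intro add_mono mult_right_mono)
        have "\<bar>\<theta>' n j x\<bar> \<le> 1 / real (Suc n) * B" by (rule \<theta>'_bound)
        also have "\<dots> \<le> 1 * B" using B0 by (intro mult_right_mono) auto
        finally show "\<bar>\<theta>' n j x\<bar> \<le> B" by simp
      qed (use \<theta>_bounds in auto)
      finally have "(norm (w n x $ j))\<^sup>2 \<le> (norm (?g x $ j) + B * norm (f x))\<^sup>2" by (intro power_mono) auto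
      also have "\<dots> \<le> 2 * (norm (?g x $ j))\<^sup>2 + 2 * (B * norm (f x))\<^sup>2"
        using sum_squares_bound[of "norm (?g x $ j)" "B * norm (f x)"] by (simp add: power2_sum)
      finally show ?thesis by (simp add: power_mult_distrib)
    qed
    then have "(norm (w n x))\<^sup>2 \<le> (\<Sum>j\<in>UNIV. 2 * (norm (?g x $ j))\<^sup>2 + 2 * B\<^sup>2 * (norm (f x))\<^sup>2)"
      unfolding norm_vec_squared by (rule sum_mono)
    also have "\<dots> = 2 * (norm (?g x))\<^sup>2 + 6 * B\<^sup>2 * (norm (f x))\<^sup>2"
      unfolding norm_vec_squared by (simp add: sum_3)
    finally show ?thesis .
  qed
  have w_dom: "integrable lborel (\<lambda>x. 2 * (norm (?g x))\<^sup>2 + 6 * B\<^sup>2 * (norm (f x))\<^sup>2)"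
    using f2 g2 by auto
  have w2: "w n \<in> Lp 2" for n
    unfolding Lp_2_iff
  proof
    show "integrable lborel (\<lambda>x. (norm (w n x))\<^sup>2)"
      by (rule Bochner_Integration.integrable_bound[OF w_dom]) (use w_bound in auto)
  qed (rule w_meas)
  have w_lim: "(\<lambda>n. LBINT x. (norm (w n x))\<^sup>2) \<longlonglongrightarrow> G"
    unfolding G_def
  proof (rule integral_dominated_convergence[OF _ _ w_dom])
    show "AE x in lborel. norm ((norm (w n x))\<^sup>2) \<le> 2 * (norm (?g x))\<^sup>2 + 6 * B\<^sup>2 * (norm (f x))\<^sup>2" for n
      using w_bound by auto
    show "AE x in lborel. (\<lambda>n. (norm (w n x))\<^sup>2) \<longlonglongrightarrow> (norm (?g x))\<^sup>2"
    proof (rule AE_I2)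
      fix x
      have "(\<lambda>n. w n x $ j) \<longlonglongrightarrow> of_real 1 * ?g x $ j + of_real 0 * f x" for j
      proof -
        have "(\<lambda>n. \<theta>' n j x) \<longlonglongrightarrow> 0"
        proof (rule Lim_null_comparison)
          show "\<forall>\<^sub>F n in sequentially. norm (\<theta>' n j x) \<le> 1 / real (Suc n) * B" using \<theta>'_bound by auto
          show "(\<lambda>n. 1 / real (Suc n) * B) \<longlonglongrightarrow> 0" using tendsto_mult_left_zero[OF null_step_seq(1), of B] .
        qed
        moreover have "(\<lambda>n. \<theta> n x) \<longlonglongrightarrow> 1" unfolding \<theta>_def by (rule smooth_cutoff_tendsto)
        ultimately show ?thesis
          unfolding w_def vec_lambda_beta by (intro tendsto_intros)
      qed
      then have "(\<lambda>n. \<Sum>j\<in>UNIV. (norm (w n x $ j))\<^sup>2) \<longlonglongrightarrow> (\<Sum>j\<in>UNIV. (norm (of_real 1 * ?g x $ j + of_real 0 * f x))\<^sup>2)"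
        by (intro tendsto_sum tendsto_power tendsto_norm)
      then show "(\<lambda>n. (norm (w n x))\<^sup>2) \<longlonglongrightarrow> (norm (?g x))\<^sup>2" by (simp add: norm_vec_squared)
    qed
  qed auto
  \<comment> \<open>The radius serves two purposes: at most 1/(n + 1) for the kinetic bound, and
    small enough for the L^1 modulus of \<open>v n\<close>.\<close>
  have "\<exists>d>0. d \<le> 1 / real (Suc n) \<and> (\<forall>z. norm z \<le> d \<longrightarrow> (LBINT x. norm (v n (x + z) - v n x)) \<le> 1 / real (Suc n))" for n
  proof -
    obtain d where "d > 0" "\<forall>z. norm z \<le> d \<longrightarrow> (LBINT x. norm (v n (x + z) - v n x)) \<le> 1 / real (Suc n)"
      using L1_modulus[OF v1, of "1 / real (Suc n)" n] by auto
    then show ?thesis by (intro exI[of _ "min d (1 / real (Suc n))"]) auto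
  qed
  then obtain d where d: "\<And>n. d n > 0" "\<And>n. d n \<le> 1 / real (Suc n)"
    "\<And>n z. norm z \<le> d n \<Longrightarrow> (LBINT x. norm (v n (x + z) - v n x)) \<le> 1 / real (Suc n)" by metis
  have "\<exists>\<eta> H. mollifier \<eta> H (d n)" for n by (rule mollifier_exists[OF d(1)])
  then obtain \<eta> H where mol: "\<And>n. mollifier (\<eta> n) (H n) (d n)" by metis
  define u where "u = (\<lambda>n. mollifier.conv (\<eta> n) (v n))"
  define U where "U = (\<lambda>n. mollifier.conv_partial (H n) (v n))"
  have u: "has_partials (u n) (U n)" for n
    unfolding u_def U_def by (rule mollifier.has_partials_conv[OF mol v1])
  have u_cs: "compactly_supported (u n)" for n
    unfolding u_def by (rule mollifier.compactly_supported_conv[OF mol v_cs])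
  have u_mass: "(LBINT x. (norm (u n x))\<^sup>2) \<le> M" for n
    using mollifier.mass_conv[OF mol v1 v2, of n n] v_mass[of n] by (simp add: u_def)
  let ?K = "\<lambda>n. LBINT x. (norm (classical_cov_gradient A (u n) (U n) x))\<^sup>2"
  have u_kin: "?K n \<le> (1 + d n) * (LBINT x. (norm (w n x))\<^sup>2) + (b / 2)\<^sup>2 * ((d n)\<^sup>2 + d n) * M" for n
  proof -
    have "?K n \<le> (1 + d n) * (LBINT x. (norm (w n x))\<^sup>2) + (b / 2)\<^sup>2 * ((d n)\<^sup>2 + d n) * (LBINT x. (norm (v n x))\<^sup>2)"
      unfolding u_def U_def A_def by (rule mollifier.kinetic_conv[OF mol v1 v2 w2 weak[unfolded A_def]])
    also have "\<dots> \<le> (1 + d n) * (LBINT x. (norm (w n x))\<^sup>2) + (b / 2)\<^sup>2 * ((d n)\<^sup>2 + d n) * M"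
      using d(1)[of n] by (intro add_left_mono mult_left_mono v_mass) auto
    finally show ?thesis .
  qed
  have d_lim: "d \<longlonglongrightarrow> 0"
    by (rule Lim_null_comparison[OF _ null_step_seq(1)]) (use d(1,2) in \<open>auto simp: less_imp_le\<close>)
  have K_lim: "(\<lambda>n. (1 + d n) * (LBINT x. (norm (w n x))\<^sup>2) + (b / 2)\<^sup>2 * ((d n)\<^sup>2 + d n) * M) \<longlonglongrightarrow> (1 + 0) * G + (b / 2)\<^sup>2 * (0\<^sup>2 + 0) * M"
    by (intro tendsto_intros d_lim w_lim)
  have u_L1: "integrable lborel (\<lambda>x. norm (u n x - v n x))" "(LBINT x. norm (u n x - v n x)) \<le> 1 / real (Suc n)" for n
    unfolding u_def using mollifier.L1_conv[OF mol v1 d(3), of n n] by auto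
  have [measurable]: "u n \<in> borel_measurable borel" for n
    by (rule borel_measurable_continuous_onI[OF has_partialsD(1)[OF u]])
  \<comment> \<open>L^1 convergence to 0 gives almost everywhere convergence along a subsequence, so
    the final sequences are reindexed by \<open>r\<close>.\<close>
  have "\<exists>r. strict_mono r \<and> (AE x in lborel. (\<lambda>n. u (r n) x - v (r n) x) \<longlonglongrightarrow> 0)"
  proof (rule tendsto_L1_AE_subseq)
    show "integrable lborel (\<lambda>x. u n x - v n x)" for n
    proof (subst integrable_norm_iff[symmetric])
      show "(\<lambda>x. u n x - v n x) \<in> borel_measurable lborel" by measurable
    qed (rule u_L1)
    show "(\<lambda>n. LBINT x. norm (u n x - v n x)) \<longlonglongrightarrow> 0"
      by (rule Lim_null_comparison[OF _ null_step_seq(1)])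
         (use u_L1(2) in \<open>auto intro!: always_eventually simp: abs_of_nonneg Bochner_Integration.integral_nonneg\<close>)
  qed
  then obtain r where r: "strict_mono r" "AE x in lborel. (\<lambda>n. u (r n) x - v (r n) x) \<longlonglongrightarrow> 0" by blast
  show thesis
  proof (rule that[of "\<lambda>n. u (r n)" "\<lambda>n. U (r n)"])
    show "AE x in lborel. (\<lambda>n. u (r n) x) \<longlonglongrightarrow> f x"
      using r(2)
    proof eventually_elim
      case (elim x)
      have "(\<lambda>n. \<theta> n x) \<longlonglongrightarrow> 1" unfolding \<theta>_def by (rule smooth_cutoff_tendsto)
      then have "(\<lambda>n. v n x) \<longlonglongrightarrow> of_real 1 * f x" unfolding v_def by (intro tendsto_intros)
      then have "(\<lambda>n. v (r n) x) \<longlonglongrightarrow> f x"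
        using LIMSEQ_subseq_LIMSEQ[OF _ r(1), of "\<lambda>n. v n x"] by (simp add: o_def)
      from tendsto_add[OF elim this] show ?case by simp
    qed
    fix \<epsilon> :: real assume "\<epsilon> > 0"
    have "\<forall>\<^sub>F n in sequentially. (1 + d n) * (LBINT x. (norm (w n x))\<^sup>2) + (b / 2)\<^sup>2 * ((d n)\<^sup>2 + d n) * M < G + \<epsilon>"
      using K_lim \<open>\<epsilon> > 0\<close> by (intro order_tendstoD) auto
    then have "\<forall>\<^sub>F n in sequentially. ?K n < G + \<epsilon>"
      by eventually_elim (use u_kin in \<open>auto intro: le_less_trans\<close>)
    then show "\<forall>\<^sub>F n in sequentially. (LBINT x. (norm (classical_cov_gradient A (u (r n)) (U (r n)) x))\<^sup>2)
       < (LBINT x. (norm (cov_gradient A f x))\<^sup>2) + \<epsilon>"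
      unfolding G_def by (rule eventually_subseq[OF r(1)])
  qed (use u u_cs u_mass in \<open>auto simp: M_def\<close>)
qed

section \<open>Nonexistence of minimizers\<close>

text \<open>If the bound failed infinitely often, Fatou along that subsequence would place the
  integral of f below itself by \<epsilon>. The statement also covers a non-integrable f, whose
  integral is 0 by default.\<close>

lemma integral_Fatou_eventually:
  fixes f :: "'a \<Rightarrow> real"
  assumes f: "f \<in> borel_measurable M" and u: "\<And>n. integrable M (u n)" "\<And>n x. 0 \<le> u n x"
    and lim: "AE x in M. (\<lambda>n. u n x) \<longlonglongrightarrow> f x" and "\<epsilon> > 0"
  shows "\<forall>\<^sub>F n in sequentially. (\<integral>x. f x \<partial>M) - \<epsilon> < (\<integral>x. u n x \<partial>M)"
proof (rule ccontr)
  assume "\<not> ?thesis"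
  then obtain r where r: "strict_mono r" "\<And>n::nat. \<not> (\<integral>x. f x \<partial>M) - \<epsilon> < (\<integral>x. u (r n) x \<partial>M)"
    using not_eventually_sequentiallyD by blast
  have "AE x in M. (\<lambda>n. u (r n) x) \<longlonglongrightarrow> f x"
    using lim
  proof eventually_elim
    case (elim x)
    then show ?case using LIMSEQ_subseq_LIMSEQ[OF elim r(1)] by (simp add: o_def)
  qed
  then have "(\<integral>x. f x \<partial>M) \<le> (\<integral>x. f x \<partial>M) - \<epsilon>"
    by (intro integral_Fatou(2)[OF f u(1) u(2)]) (use r(2) in \<open>auto simp: not_less\<close>)
  then show False using \<open>\<epsilon> > 0\<close> by simp
qed

text \<open>Approximants of f have magnetic kinetic energy at most about G and nonlinear term at
  least about P, while passing to their regularised moduli saves a fixed amount \<open>d\<close>.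
  Since G/2 - 3P/10 is nonpositive, some modulus of mass at most c has negative nonmagnetic energy,
  so the infimum is minus infinity and is not attained.\<close>

lemma no_critical_minimizer:
  assumes "b \<noteq> 0" "c > 0" and nonpos: "min_energy b (4 / 3) c \<le> 0"
  shows "\<not> minimizer b (4 / 3) c f"
proof
  assume min: "minimizer b (4 / 3) c f"
  let ?A = "magnetic_potential b"
  have H1: "f \<in> H1 ?A" and mass: "mass f = c" and E: "ereal (energy b (4 / 3) f) = min_energy b (4 / 3) c"
    using min by (auto simp: minimizer_def mass_sphere_def)
  have f2: "integrable lborel (\<lambda>x. (norm (f x))\<^sup>2)" and [measurable]: "f \<in> borel_measurable borel"
    using H1 by (auto simp: H1_def Lp_2_iff)
  define G P where "G = (LBINT x. (norm (cov_gradient ?A f x))\<^sup>2)" and "P = (LBINT x. norm (f x) powr (10 / 3))"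
  have M: "(LBINT x. (norm (f x))\<^sup>2) = c" using mass by (simp add: mass_eq)
  have G0: "G \<ge> 0" unfolding G_def by (intro Bochner_Integration.integral_nonneg) auto
  have e: "4 / 3 + 2 = (10 / 3 :: real)" by simp
  have E_eq: "energy b (4 / 3) f = G / 2 - 3 / 10 * P"
    unfolding energy_eq[of "4 / 3", simplified] e G_def P_def by simp
  have E0: "G / 2 - 3 / 10 * P \<le> 0" using nonpos unfolding E[symmetric] E_eq by (simp add: zero_ereal_def)
  \<comment> \<open>Makes (G + 1)/t equal to |b|c/4. With the approximate mass above c/2, the other
    |b|c/4 must come from t times the gap, so the gap is at least the \<open>d\<close> defined
    below.\<close>
  define t where "t = 4 * (G + 1) / (\<bar>b\<bar> * c)"
  have t: "t > 0" using assms(1,2) G0 by (simp add: t_def)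
  define d where "d = \<bar>b\<bar> * c / (4 * t)"
  have d: "d > 0" using assms(1,2) t by (simp add: d_def)
  \<comment> \<open>The errors cost \<epsilon>/2 in the kinetic and 3\<epsilon>/10 in the nonlinear
    term, together less than d/2; \<epsilon> at most 1 lets G + 1 bound the kinetic energy of the
    chosen approximant.\<close>
  define \<epsilon> where "\<epsilon> = min 1 (d / 2)"
  have \<epsilon>: "\<epsilon> > 0" "\<epsilon> \<le> 1" "\<epsilon> \<le> d / 2" using d by (auto simp: \<epsilon>_def)
  obtain u U where u: "\<And>n. has_partials (u n) (U n)" and cs: "\<And>n. compactly_supported (u n)"
    and u_mass: "\<And>n. (LBINT x. (norm (u n x))\<^sup>2) \<le> c"
    and u_kin: "\<forall>\<^sub>F n in sequentially. (LBINT x. (norm (classical_cov_gradient ?A (u n) (U n) x))\<^sup>2) < G + \<epsilon>"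
    and u_lim: "AE x in lborel. (\<lambda>n. u n x) \<longlonglongrightarrow> f x"
    by (rule smooth_approximation[OF H1, unfolded M, folded G_def]) (blast intro: \<epsilon>(1))
  define s where "s = (\<lambda>n. 1 / real (Suc n))"
  have s: "s n > 0" for n by (simp add: s_def)
  define h where "h = (\<lambda>n. regularized_modulus (s n) (u n))"
  define H where "H = (\<lambda>n. regularized_modulus_partial (s n) (u n) (U n))"
  have h: "has_partials (h n) (H n)" for n
    unfolding h_def H_def by (rule has_partials_regularized_modulus[OF u s])
  have h_cs: "compactly_supported (h n)" for n
    unfolding h_def by (rule compactly_supported_regularized_modulus[OF cs s])
  note h_bounds = regularized_modulus_bounds[OF s]
  have h0: "0 \<le> h n x" and h_le: "h n x \<le> norm (u n x)" for n x
    unfolding h_def using h_bounds by auto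
  have u2: "integrable lborel (\<lambda>x. (norm (u n x))\<^sup>2)" for n
    by (intro integrable_compactly_supported continuous_intros has_partialsD(1)[OF u] compactly_supported_comp[OF cs]) simp
  have h2: "integrable lborel (\<lambda>x. (h n x)\<^sup>2)" for n
    by (intro integrable_compactly_supported continuous_intros has_partialsD(1)[OF h] compactly_supported_comp[OF h_cs]) simp
  have h_mass: "(LBINT x. (h n x)\<^sup>2) \<le> c" for n
  proof -
    have "(LBINT x. (h n x)\<^sup>2) \<le> (LBINT x. (norm (u n x))\<^sup>2)"
      by (intro integral_mono h2 u2 power_mono h_le h0)
    also have "\<dots> \<le> c" by (rule u_mass)
    finally show ?thesis .
  qed
  have "\<forall>\<^sub>F n in sequentially. (LBINT x. (norm (f x))\<^sup>2) - c / 2 < (LBINT x. (norm (u n x))\<^sup>2)"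
  proof (rule integral_Fatou_eventually[OF _ u2])
    show "AE x in lborel. (\<lambda>n. (norm (u n x))\<^sup>2) \<longlonglongrightarrow> (norm (f x))\<^sup>2"
      using u_lim by eventually_elim (intro tendsto_power tendsto_norm)
  qed (use \<open>c > 0\<close> in auto)
  then have M_ev: "\<forall>\<^sub>F n in sequentially. c / 2 < (LBINT x. (norm (u n x))\<^sup>2)" unfolding M by simp
  have P_ev: "\<forall>\<^sub>F n in sequentially. P - \<epsilon> < (LBINT x. \<bar>h n x\<bar> powr (10 / 3))"
    unfolding P_def
  proof (rule integral_Fatou_eventually)
    show "integrable lborel (\<lambda>x. \<bar>h n x\<bar> powr (10 / 3))" for n
      by (intro integrable_compactly_supported continuous_on_powr' continuous_on_rabs has_partialsD(1)[OF h]
          continuous_on_const compactly_supported_comp[OF h_cs]) auto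
    show "AE x in lborel. (\<lambda>n. \<bar>h n x\<bar> powr (10 / 3)) \<longlonglongrightarrow> norm (f x) powr (10 / 3)"
      using u_lim
    proof eventually_elim
      case (elim x)
      then have ul: "(\<lambda>n. norm (u n x)) \<longlonglongrightarrow> norm (f x)" by (rule tendsto_norm)
      have "(\<lambda>n. norm (u n x) - s n) \<longlonglongrightarrow> norm (f x) - 0"
        unfolding s_def by (intro tendsto_diff ul null_step_seq)
      then have lower: "(\<lambda>n. norm (u n x) - s n) \<longlonglongrightarrow> norm (f x)" by simp
      have e1: "\<forall>\<^sub>F n in sequentially. norm (u n x) - s n \<le> h n x"
        unfolding h_def by (intro always_eventually allI h_bounds)
      have e2: "\<forall>\<^sub>F n in sequentially. h n x \<le> norm (u n x)"
        by (intro always_eventually allI h_le)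
      have "(\<lambda>n. h n x) \<longlonglongrightarrow> norm (f x)"
        by (rule tendsto_sandwich[OF e1 e2 lower ul])
      then have "(\<lambda>n. \<bar>h n x\<bar>) \<longlonglongrightarrow> \<bar>norm (f x)\<bar>" by (rule tendsto_rabs)
      then show ?case by (intro tendsto_powr') auto
    qed
  qed (use \<epsilon>(1) in auto)
  from eventually_conj[OF u_kin eventually_conj[OF M_ev P_ev]]
  obtain n where n: "(LBINT x. (norm (classical_cov_gradient ?A (u n) (U n) x))\<^sup>2) < G + \<epsilon>"
    "c / 2 < (LBINT x. (norm (u n x))\<^sup>2)" "P - \<epsilon> < (LBINT x. \<bar>h n x\<bar> powr (10 / 3))"
    using eventually_happens'[OF trivial_limit_sequentially] by blast
  define Gn where "Gn = (LBINT x. (norm (classical_cov_gradient ?A (u n) (U n) x))\<^sup>2)"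
  have "\<bar>b\<bar> * (LBINT x. (norm (u n x))\<^sup>2) \<le> t * (Gn - kinetic (H n)) + Gn / t"
    unfolding Gn_def H_def by (rule strict_diamagnetic[OF u cs t s])
  moreover have "\<bar>b\<bar> * (c / 2) \<le> \<bar>b\<bar> * (LBINT x. (norm (u n x))\<^sup>2)"
    using n(2) by (intro mult_left_mono) auto
  moreover have "Gn / t \<le> \<bar>b\<bar> * c / 4"
  proof -
    have "Gn / t \<le> (G + 1) / t" using n(1) \<epsilon>(2) t unfolding Gn_def by (intro divide_right_mono) auto
    also have "\<dots> = \<bar>b\<bar> * c / 4"
    proof -
      have "L / (4 * L / p) = p / 4" if "L > 0" "p > 0" for L p :: real using that by simp
      from this[of "G + 1" "\<bar>b\<bar> * c"] show ?thesis using G0 assms(1,2) by (simp only: t_def) auto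
    qed
    finally show ?thesis .
  qed
  ultimately have "\<bar>b\<bar> * c / 4 \<le> t * (Gn - kinetic (H n))" by linarith
  then have "d \<le> Gn - kinetic (H n)" using t by (simp add: d_def field_simps)
  then have "kinetic (H n) / 2 < 3 / 10 * (LBINT x. \<bar>h n x\<bar> powr (10 / 3))"
    using n(1,3) E0 \<epsilon> d unfolding Gn_def by linarith
  then have "min_energy b (4 / 3) c = - \<infinity>"
    by (rule min_energy_critical_negative[OF \<open>c > 0\<close> h h_cs h_mass])
  then show False using E by simp
qed

text \<open>Dilations of one fixed bump drive the energy to minus infinity, a value that no real
  energy attains.\<close>

lemma no_supercritical_minimizer:
  assumes "4 / 3 < \<alpha>" "c > 0" shows "\<not> minimizer b \<alpha> c f"
proof -
  let ?h = "bump 1 (vec (- 1)) (vec 1)"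
  obtain H where H: "has_partials ?h H" "compactly_supported ?h" by (rule bump_trial[of 1]) simp
  have "min_energy b \<alpha> c = - \<infinity>"
  proof (rule min_energy_supercritical[OF assms H])
    show "(LBINT x. (?h x)\<^sup>2) > 0"
      using integral_bump_powr_pos[of 1 2] by (simp add: bump_bounds)
    show "(LBINT x. \<bar>?h x\<bar> powr (\<alpha> + 2)) > 0"
      using integral_bump_powr_pos[of 1 "\<alpha> + 2"] assms(1) by (simp add: bump_bounds)
  qed
  then show ?thesis by (auto simp: minimizer_def)
qed

theorem proposition1p13:
  fixes b :: real
  assumes "b \<noteq> 0"
  shows "(\<forall>(Q :: real^3 \<Rightarrow> real) (c :: real).
            unique_positive_radial_solution Q \<and> c \<ge> mass (\<lambda>x. complex_of_real (Q x)) \<longrightarrow>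
            \<not> (\<exists>f. minimizer b (4 / 3) c f))
       \<and> (\<forall>(\<alpha> :: real) (c :: real). 4 / 3 < \<alpha> \<and> \<alpha> < 4 \<and> c > 0 \<longrightarrow>
            \<not> (\<exists>f. minimizer b \<alpha> c f))"
proof (intro conjI allI impI)
  fix Q :: "real^3 \<Rightarrow> real" and c :: real
  assume *: "unique_positive_radial_solution Q \<and> c \<ge> mass (\<lambda>x. complex_of_real (Q x))"
  then interpret ground_state Q
    by unfold_locales (simp add: unique_positive_radial_solution_def)
  have "c > 0" using * mass_Q_pos by (simp add: mass_Q)
  then show "\<not> (\<exists>f. minimizer b (4 / 3) c f)"
    using no_critical_minimizer[OF assms] min_energy_nonpos * by blast
next
  fix \<alpha> c :: real
  assume "4 / 3 < \<alpha> \<and> \<alpha> < 4 \<and> c > 0"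
  then show "\<not> (\<exists>f. minimizer b \<alpha> c f)"
    using no_supercritical_minimizer by blast
qed

end
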